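(* For a convex function $f:\mathbb{R}\to\mathbb{R}$ and vectors $a\in\mathbb{R}^n_{>0}$, $b\in\mathbb{R}^n$, both $(a,b,f)$-S/GBC/C and $(a,b,f)$-S/GBC/I can be solved in $O(n)$ time.
   Context: Let $\mathcal{N}=\{1,\ldots,n\}$, $\mathcal{M}=\{1,\ldots,m\}$, $R\in\mathbb{R}$, let $\mathcal{N}_1,\ldots,\mathcal{N}_m$ be a partition of $\mathcal{N}$, and let bounds $l,u\in\mathbb{R}^n$ and $L,U\in\mathbb{R}^m$ be given. The problem $(a,b,f)$-S/GBC/$\gamma$ is $$\min_x\ \sum_{i\in\mathcal{N}}a_if\left(\frac{x_i}{a_i}+b_i\right)\quad\text{s.t.}\quad\sum_{i\in\mathcal{N}}x_i=R,\quad L_j\le\sum_{i\in\mathcal{N}_j}x_i\le U_j\ (j\in\mathcal{M}),\quad l_i\le x_i\le u_i\ (i\in\mathcal{N}),$$ with $x\in\mathbb{R}^n$ if $\gamma=\text{C}$ and $x\in\mathbb{Z}^n$ if $\gamma=\text{I}$. Solving the problem means computing an optimal solution. *)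

theory Defs
  imports "HOL-Analysis.Analysis" "HOL-Library.Landau_Symbols" "HOL-Library.Disjoint_Sets"
begin

section \<open>Resource allocation with generalized bound constraints\<close>

datatype domain = Continuous | Integral

text \<open>
  The data of a problem apart from the cost function and the domain. In the usual notation the
  fields are, in this order, n, m, R, the blocks N_j, l, u, L, U, a and b. Vectors are functions
  on the natural numbers of which only the entries 1..n (respectively 1..m) are relevant.
\<close>
record gbc =
  num_acts :: nat
  num_blocks :: nat
  resource :: real
  block :: "nat \<Rightarrow> nat set"
  act_lo :: "nat \<Rightarrow> real"
  act_hi :: "nat \<Rightarrow> real"
  block_lo :: "nat \<Rightarrow> real"
  block_hi :: "nat \<Rightarrow> real"
  scale :: "nat \<Rightarrow> real"
  shift :: "nat \<Rightarrow> real"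

definition gbc_instance :: "gbc \<Rightarrow> bool" where
  "gbc_instance P \<longleftrightarrow>
     partition_on {1..num_acts P} (block P ` {1..num_blocks P}) \<and>
     inj_on (block P) {1..num_blocks P} \<and>
     (\<forall>i\<in>{1..num_acts P}. scale P i > 0)"

definition feasible :: "domain \<Rightarrow> gbc \<Rightarrow> (nat \<Rightarrow> real) \<Rightarrow> bool" where
  "feasible \<gamma> P x \<longleftrightarrow>
     (\<Sum>i\<in>{1..num_acts P}. x i) = resource P \<and>
     (\<forall>j\<in>{1..num_blocks P}.
        block_lo P j \<le> (\<Sum>i\<in>block P j. x i) \<and> (\<Sum>i\<in>block P j. x i) \<le> block_hi P j) \<and>
     (\<forall>i\<in>{1..num_acts P}. act_lo P i \<le> x i \<and> x i \<le> act_hi P i) \<and>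
     (\<gamma> = Integral \<longrightarrow> (\<forall>i\<in>{1..num_acts P}. x i \<in> \<int>))"

definition objective :: "(real \<Rightarrow> real) \<Rightarrow> gbc \<Rightarrow> (nat \<Rightarrow> real) \<Rightarrow> real" where
  "objective f P x = (\<Sum>i\<in>{1..num_acts P}. scale P i * f (x i / scale P i + shift P i))"

definition optimal :: "domain \<Rightarrow> (real \<Rightarrow> real) \<Rightarrow> gbc \<Rightarrow> (nat \<Rightarrow> real) \<Rightarrow> bool" where
  "optimal \<gamma> f P x \<longleftrightarrow> is_arg_min (objective f P) (feasible \<gamma> P) x"


section \<open>Unit-cost programs over the reals\<close>

text \<open>
  Running time is measured on a structured real RAM. Its memory consists of arrays of natural
  numbers (used for counting and addressing) and arrays of exact reals. An array is named by a
  constant of the program, so a program uses finitely many of them, while the position within an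
  array is computed. Numbers are added, subtracted, multiplied, divided and compared exactly.
  There is no operation from reals to naturals, so reals cannot be used as addresses.
  \<open>Prim k\<close> applies the \<open>k\<close>-th unary primitive of the machine; the primitives are a parameter of
  the semantics, which is how the cost function enters as an evaluation oracle.
\<close>
datatype nexp =
    NConst nat
  | NGet nat nexp
  | NAdd nexp nexp
  | NSub nexp nexp

datatype rexp =
    OfNat nexp
  | RGet nat nexp
  | RAdd rexp rexp
  | RSub rexp rexp
  | RMul rexp rexp
  | RDiv rexp rexp
  | Prim nat rexp

datatype bexp =
    NLess nexp nexp
  | RLess rexp rexp
  | BNot bexp
  | BAnd bexp bexp

datatype com =
    Skip
  | NSet nat nexp nexp
  | RSet nat nexp rexp
  | Seq com com
  | Cond bexp com com
  | While bexp com
  | Call nat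

text \<open>A finite list of possibly recursive parameterless procedures, and the main command.\<close>
type_synonym program = "com list \<times> com"

record state =
  nmem :: "nat \<Rightarrow> nat \<Rightarrow> nat"
  rmem :: "nat \<Rightarrow> nat \<Rightarrow> real"

primrec nval :: "state \<Rightarrow> nexp \<Rightarrow> nat" where
  "nval s (NConst c) = c"
| "nval s (NGet k e) = nmem s k (nval s e)"
| "nval s (NAdd e e') = nval s e + nval s e'"
| "nval s (NSub e e') = nval s e - nval s e'"

primrec rval :: "(nat \<Rightarrow> real \<Rightarrow> real) \<Rightarrow> state \<Rightarrow> rexp \<Rightarrow> real" where
  "rval prims s (OfNat e) = real (nval s e)"
| "rval prims s (RGet k e) = rmem s k (nval s e)"
| "rval prims s (RAdd e e') = rval prims s e + rval prims s e'"
| "rval prims s (RSub e e') = rval prims s e - rval prims s e'"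
| "rval prims s (RMul e e') = rval prims s e * rval prims s e'"
| "rval prims s (RDiv e e') = rval prims s e / rval prims s e'"
| "rval prims s (Prim k e) = prims k (rval prims s e)"

primrec bval :: "(nat \<Rightarrow> real \<Rightarrow> real) \<Rightarrow> state \<Rightarrow> bexp \<Rightarrow> bool" where
  "bval prims s (NLess e e') \<longleftrightarrow> nval s e < nval s e'"
| "bval prims s (RLess e e') \<longleftrightarrow> rval prims s e < rval prims s e'"
| "bval prims s (BNot c) \<longleftrightarrow> \<not> bval prims s c"
| "bval prims s (BAnd c c') \<longleftrightarrow> bval prims s c \<and> bval prims s c'"

definition nupd :: "nat \<Rightarrow> nat \<Rightarrow> nat \<Rightarrow> state \<Rightarrow> state" where
  "nupd k i v s = s\<lparr>nmem := (nmem s)(k := (nmem s k)(i := v))\<rparr>"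

definition rupd :: "nat \<Rightarrow> nat \<Rightarrow> real \<Rightarrow> state \<Rightarrow> state" where
  "rupd k i v s = s\<lparr>rmem := (rmem s)(k := (rmem s k)(i := v))\<rparr>"

text \<open>
  \<open>exec prims procs c s t s'\<close>: started in \<open>s\<close>, the command \<open>c\<close> halts in \<open>s'\<close> after \<open>t\<close> steps.
  Each skip, assignment, test and call counts as one step. The expressions occurring in a program are
  fixed with the program, so a step stands for a bounded number of elementary operations and
  counting these instead would change the running time by a constant factor only.
\<close>
inductive exec ::
  "(nat \<Rightarrow> real \<Rightarrow> real) \<Rightarrow> com list \<Rightarrow> com \<Rightarrow> state \<Rightarrow> nat \<Rightarrow> state \<Rightarrow> bool"
  for prims :: "nat \<Rightarrow> real \<Rightarrow> real" and procs :: "com list" where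
  Skip: "exec prims procs Skip s 1 s"
| NSet: "exec prims procs (NSet k i e) s 1 (nupd k (nval s i) (nval s e) s)"
| RSet: "exec prims procs (RSet k i e) s 1 (rupd k (nval s i) (rval prims s e) s)"
| Seq: "exec prims procs c s t s' \<Longrightarrow> exec prims procs c' s' t' s'' \<Longrightarrow>
    exec prims procs (Seq c c') s (t + t') s''"
| CondTrue: "bval prims s b \<Longrightarrow> exec prims procs c s t s' \<Longrightarrow>
    exec prims procs (Cond b c c') s (t + 1) s'"
| CondFalse: "\<not> bval prims s b \<Longrightarrow> exec prims procs c' s t s' \<Longrightarrow>
    exec prims procs (Cond b c c') s (t + 1) s'"
| WhileTrue: "bval prims s b \<Longrightarrow> exec prims procs c s t s' \<Longrightarrow>
    exec prims procs (While b c) s' t' s'' \<Longrightarrow>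
    exec prims procs (While b c) s (t + t' + 1) s''"
| WhileFalse: "\<not> bval prims s b \<Longrightarrow> exec prims procs (While b c) s 1 s"
| Call: "k < length procs \<Longrightarrow> exec prims procs (procs ! k) s t s' \<Longrightarrow>
    exec prims procs (Call k) s (t + 1) s'"

inductive_cases SkipE: "exec prims procs Skip s t s'"
inductive_cases NSetE: "exec prims procs (NSet k i e) s t s'"
inductive_cases RSetE: "exec prims procs (RSet k i e) s t s'"
inductive_cases SeqE: "exec prims procs (Seq c c') s t s'"
inductive_cases CondE: "exec prims procs (Cond b c c') s t s'"
inductive_cases WhileE: "exec prims procs (While b c) s t s'"
inductive_cases CallE: "exec prims procs (Call k) s t s'"

lemma exec_deterministic:
  "exec prims procs c s t s' \<Longrightarrow> exec prims procs c s u r \<Longrightarrow> t = u \<and> s' = r"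
proof (induction arbitrary: u r rule: exec.induct)
  case (Skip s)
  then show ?case by (rule SkipE) simp
next
  case (NSet k i e s)
  then show ?case by (rule NSetE) simp
next
  case (RSet k i e s)
  then show ?case by (rule RSetE) simp
next
  case (Seq c s t s' c' t' s'')
  from Seq.prems show ?case by (rule SeqE) (metis Suc_eq_plus1 add_Suc_right add_0_right Seq.IH)
next
  case (CondTrue s b c t s' c')
  from CondTrue.prems show ?case by (rule CondE) (metis Suc_eq_plus1 add_Suc_right add_0_right CondTrue.IH CondTrue.hyps(1))+
next
  case (CondFalse s b c' t s' c)
  from CondFalse.prems show ?case by (rule CondE) (metis Suc_eq_plus1 add_Suc_right add_0_right CondFalse.IH CondFalse.hyps(1))+
next
  case (WhileTrue s b c t s' t' s'')
  from WhileTrue.prems show ?case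
    by (rule WhileE) (metis Suc_eq_plus1 add_Suc_right add_0_right WhileTrue.IH WhileTrue.hyps(1))+
next
  case (WhileFalse s b c)
  from WhileFalse.prems show ?case by (rule WhileE) (use WhileFalse.hyps in simp_all)
next
  case (Call k s t s')
  from Call.prems show ?case by (rule CallE) (metis Suc_eq_plus1 add_Suc_right add_0_right Call.IH)
qed


section \<open>Solving the problem on the machine\<close>

text \<open>
  Evaluation of the cost function is a unit-cost primitive. Rounding is available only for the
  integral problem, the continuous one is to be solved with exact arithmetic and comparisons.
\<close>
fun primitives :: "domain \<Rightarrow> (real \<Rightarrow> real) \<Rightarrow> nat \<Rightarrow> real \<Rightarrow> real" where
  "primitives Continuous f k = f"
| "primitives Integral f k = (if k = 0 then f else (\<lambda>y. real_of_int \<lfloor>y\<rfloor>))"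

definition vec_array :: "nat \<Rightarrow> (nat \<Rightarrow> real) \<Rightarrow> nat \<Rightarrow> real" where
  "vec_array k v i = (if i \<in> {1..k} then v i else 0)"

definition block_index :: "gbc \<Rightarrow> nat \<Rightarrow> nat" where
  "block_index P i =
     (if i \<in> {1..num_acts P} then (THE j. j \<in> {1..num_blocks P} \<and> i \<in> block P j) else 0)"

text \<open>
  The natural array 0 holds the two sizes at its positions 0 and 1, the natural array 1 holds the
  partition as the map from an activity to the index of its block. The real arrays 1 to 7 hold the
  real data, and the real array 0 is reserved for the solution. All other cells are 0.
\<close>
definition input_state :: "gbc \<Rightarrow> state" where
  "input_state P =
     \<lparr>nmem = (\<lambda>_ _. 0)(0 := (\<lambda>_. 0)(0 := num_acts P, 1 := num_blocks P), 1 := block_index P),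
      rmem = (\<lambda>_ _. 0)
        (1 := (\<lambda>_. 0)(0 := resource P),
         2 := vec_array (num_acts P) (act_lo P),
         3 := vec_array (num_acts P) (act_hi P),
         4 := vec_array (num_blocks P) (block_lo P),
         5 := vec_array (num_blocks P) (block_hi P),
         6 := vec_array (num_acts P) (scale P),
         7 := vec_array (num_acts P) (shift P))\<rparr>"

definition solution :: "state \<Rightarrow> nat \<Rightarrow> real" where
  "solution s = rmem s 0"

text \<open>
  The program has to halt within the given time even on infeasible instances, where its result is
  irrelevant. For convex \<open>f\<close> every feasible instance has an optimal solution, since the variables
  are bounded and \<open>f\<close> is continuous.
\<close>
definition solves_within ::
  "program \<Rightarrow> domain \<Rightarrow> (real \<Rightarrow> real) \<Rightarrow> gbc \<Rightarrow> real \<Rightarrow> bool" where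
  "solves_within prog \<gamma> f P T \<longleftrightarrow>
     (\<exists>t s. exec (primitives \<gamma> f) (fst prog) (snd prog) (input_state P) t s \<and>
        real t \<le> T \<and>
        ((\<exists>x. feasible \<gamma> P x) \<longrightarrow> optimal \<gamma> f P (solution s)))"

end

(*
  The objective is decided by one multiplier per sum constraint. For each block, first move the lower
  bounds to a solution of the box problem with the smallest admissible block total, then the upper
  bounds to a solution with the largest one; the box problem over all activities with these new
  bounds solves the original problem, because its multiplier, clipped to the interval between the
  two multipliers of the block, prices the block (priced_block).

  For a continuous box problem, x i = clip (a i * (y - b i)) is optimal for every convex f, as all
  marginal costs are governed by the subgradients of f at the common level y. The total is
  piecewise linear in y, and the right level is found by prune and search over its breakpoints.
  For an integral box problem, levels of the totals T - k and T + k, with k the number of activities,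
  leave a window of at most 4 k unit increments; those with the smallest slopes are selected by the same
  search. The search is linear by choosing pivots as medians of medians.
*)
theory Submission
  imports Defs
begin

section \<open>Total correctness with running time\<close>

text \<open>A convex \<open>f\<close> may have kinks, so multipliers appear as prices:
  \<open>priced\<close> asks for a linear minorant of cost differences instead of derivatives, and
  its parameter \<open>D\<close> lets one exchange argument serve reals and integers. Programs must
  halt in time on every instance, feasible or not. Hence the time bounds are proved outright, while
  correctness is an implication whose premises follow from feasibility, and each loop steered by
  real data is capped by a natural counter. As reals cannot become counters, integral units are
  counted by stepping through a window whose width is known in advance. The width 4 k consists of 2
  k between the totals T - k and T + k and of at most one unit per activity lost to rounding at
  either end; the slack k lets an averaging argument find an activity a whole unit away from the
  level. Linear stages add up to a linear program because the block sizes sum to n and, blocks being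
  nonempty, there are at most n of them.\<close>

definition runs ::
  "(nat \<Rightarrow> real \<Rightarrow> real) \<Rightarrow> com list \<Rightarrow> com \<Rightarrow> state \<Rightarrow> (nat \<Rightarrow> state \<Rightarrow> bool) \<Rightarrow> bool" where
  "runs pr ps c s Q \<longleftrightarrow> (\<exists>t s'. exec pr ps c s t s' \<and> Q t s')"

abbreviation seq :: "com \<Rightarrow> com \<Rightarrow> com" (infixr ";;" 60) where
  "c ;; c' \<equiv> Seq c c'"

lemma runs_Skip: "runs pr ps Skip s Q \<longleftrightarrow> Q 1 s"
  unfolding runs_def by (metis exec.Skip SkipE)

lemma runs_NSet: "runs pr ps (NSet k i e) s Q \<longleftrightarrow> Q 1 (nupd k (nval s i) (nval s e) s)"
  unfolding runs_def by (metis exec.NSet NSetE)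

lemma runs_RSet: "runs pr ps (RSet k i e) s Q \<longleftrightarrow> Q 1 (rupd k (nval s i) (rval pr s e) s)"
  unfolding runs_def by (metis exec.RSet RSetE)

lemma runs_Seq:
  "runs pr ps (c ;; c') s Q \<longleftrightarrow> runs pr ps c s (\<lambda>t s'. runs pr ps c' s' (\<lambda>t' s''. Q (t + t') s''))"
  unfolding runs_def by (metis exec.Seq SeqE)

lemma runs_Cond:
  "runs pr ps (Cond b c c') s Q \<longleftrightarrow>
     (if bval pr s b then runs pr ps c s (\<lambda>t. Q (Suc t)) else runs pr ps c' s (\<lambda>t. Q (Suc t)))"
  unfolding runs_def
  by (cases "bval pr s b") (metis exec.CondTrue exec.CondFalse CondE Suc_eq_plus1)+

lemma runs_Call:
  "runs pr ps (Call k) s Q \<longleftrightarrow> k < length ps \<and> runs pr ps (ps ! k) s (\<lambda>t. Q (Suc t))"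
  unfolding runs_def by (metis exec.Call CallE Suc_eq_plus1)

lemmas runs_simps = runs_Skip runs_NSet runs_RSet runs_Seq runs_Cond

lemma runs_mono:
  assumes "runs pr ps c s R" and "\<And>t s'. R t s' \<Longrightarrow> Q t s'"
  shows "runs pr ps c s Q"
  using assms unfolding runs_def by blast

lemma runs_SeqI:
  assumes "runs pr ps c s R" and "\<And>t s'. R t s' \<Longrightarrow> runs pr ps c' s' (\<lambda>t' s''. Q (t + t') s'')"
  shows "runs pr ps (c ;; c') s Q"
  unfolding runs_Seq using assms by (rule runs_mono)

text \<open>Termination rests on \<open>\<mu>\<close> alone. Time is carried by \<open>J\<close>,
  whose argument counts the steps made before the current test, so an iteration costing an unbounded
  number of steps can be charged to a potential in \<open>J\<close>.\<close>

lemma runs_While: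
  fixes \<mu> :: "state \<Rightarrow> nat"
  assumes init: "J 0 s"
    and step: "\<And>t s. J t s \<Longrightarrow> bval pr s b \<Longrightarrow>
      runs pr ps c s (\<lambda>t' s'. J (Suc (t + t')) s' \<and> \<mu> s' < \<mu> s)"
    and exit: "\<And>t s. J t s \<Longrightarrow> \<not> bval pr s b \<Longrightarrow> Q (Suc t) s"
  shows "runs pr ps (While b c) s Q"
proof -
  have "J t0 s \<Longrightarrow> \<exists>t s'. exec pr ps (While b c) s t s' \<and> Q (t0 + t) s'" for t0
  proof (induction "\<mu> s" arbitrary: s t0 rule: less_induct)
    case less
    show ?case
    proof (cases "bval pr s b")
      case True
      from step[OF less.prems True] obtain t1 s1 where
        1: "exec pr ps c s t1 s1" "J (Suc (t0 + t1)) s1" "\<mu> s1 < \<mu> s"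
        unfolding runs_def by blast
      from less.hyps[OF 1(3,2)] obtain t2 s2 where
        2: "exec pr ps (While b c) s1 t2 s2" "Q (Suc (t0 + t1) + t2) s2" by blast
      have "Suc (t0 + t1) + t2 = t0 + (t1 + t2 + 1)" by simp
      with exec.WhileTrue[OF True 1(1) 2(1)] 2(2) show ?thesis by metis
    next
      case False
      have "Suc t0 = t0 + 1" by simp
      with exec.WhileFalse[OF False] exit[OF less.prems False]
      show ?thesis by metis
    qed
  qed
  from this[OF init] show ?thesis unfolding runs_def by simp
qed

lemma nmem_nupd [simp]: "nmem (nupd k i v s) = (nmem s)(k := (nmem s k)(i := v))"
  and rmem_nupd [simp]: "rmem (nupd k i v s) = rmem s"
  and nmem_rupd [simp]: "nmem (rupd k i w s) = nmem s"
  and rmem_rupd [simp]: "rmem (rupd k i w s) = (rmem s)(k := (rmem s k)(i := w))"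
  by (simp_all add: nupd_def rupd_def)


text \<open>Calls are assumed to write only arrays in \<open>W\<close>.\<close>

primrec nwrites :: "nat set \<Rightarrow> com \<Rightarrow> nat set" where
  "nwrites W Skip = {}"
| "nwrites W (NSet k i e) = {k}"
| "nwrites W (RSet k i e) = {}"
| "nwrites W (Seq c c') = nwrites W c \<union> nwrites W c'"
| "nwrites W (Cond b c c') = nwrites W c \<union> nwrites W c'"
| "nwrites W (While b c) = nwrites W c"
| "nwrites W (Call k) = W"

primrec rwrites :: "nat set \<Rightarrow> com \<Rightarrow> nat set" where
  "rwrites W Skip = {}"
| "rwrites W (NSet k i e) = {}"
| "rwrites W (RSet k i e) = {k}"
| "rwrites W (Seq c c') = rwrites W c \<union> rwrites W c'"
| "rwrites W (Cond b c c') = rwrites W c \<union> rwrites W c'"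
| "rwrites W (While b c) = rwrites W c"
| "rwrites W (Call k) = W"

text \<open>The induction follows the execution, not the syntax. So recursion is covered as soon as
  every body stays within \<open>W\<close> under the assumption that calls do.\<close>

lemma exec_nmem_frame:
  assumes "exec pr ps c s t s'" "\<forall>p\<in>set ps. nwrites W p \<subseteq> W" "k \<notin> nwrites W c"
  shows "nmem s' k = nmem s k"
  using assms by (induction rule: exec.induct) (auto simp: subset_iff, (meson nth_mem)+)

lemma exec_rmem_frame:
  assumes "exec pr ps c s t s'" "\<forall>p\<in>set ps. rwrites W p \<subseteq> W" "k \<notin> rwrites W c"
  shows "rmem s' k = rmem s k"
  using assms by (induction rule: exec.induct) (auto simp: subset_iff, (meson nth_mem)+)

lemma runs_frame:
  assumes "runs pr ps c s Q"
    and "\<forall>p\<in>set ps. nwrites W p \<subseteq> W" "\<forall>p\<in>set ps. rwrites V p \<subseteq> V"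
  shows "runs pr ps c s (\<lambda>t s'. Q t s' \<and>
    (\<forall>k. k \<notin> nwrites W c \<longrightarrow> nmem s' k = nmem s k) \<and>
    (\<forall>k. k \<notin> rwrites V c \<longrightarrow> rmem s' k = rmem s k))"
  using assms unfolding runs_def by (blast intro: exec_nmem_frame exec_rmem_frame)

section \<open>Searching for the crossing point of a step-linear function\<close>

type_synonym item = "real \<times> real \<times> real"

abbreviation key :: "item \<Rightarrow> real" where "key \<equiv> fst"
abbreviation slp :: "item \<Rightarrow> real" where "slp x \<equiv> fst (snd x)"
abbreviation off :: "item \<Rightarrow> real" where "off x \<equiv> snd (snd x)"

text \<open>An item switches on the affine function \<open>\<lambda>y. slp x * y + off x\<close> at its key.\<close>

definition val_le :: "item list \<Rightarrow> real \<Rightarrow> real" where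
  "val_le X y = (\<Sum>x\<leftarrow>X. if key x \<le> y then slp x * y + off x else 0)"

definition val_lt :: "item list \<Rightarrow> real \<Rightarrow> real" where
  "val_lt X y = (\<Sum>x\<leftarrow>X. if key x < y then slp x * y + off x else 0)"

text \<open>
  With slopes 0 and offsets 1 the value counts keys and a crossing is a quantile. With the
  breakpoints of clipped lines the value is continuous and a crossing solves \<open>val_le X y = T\<close>.
\<close>
definition crossing :: "item list \<Rightarrow> real \<Rightarrow> real \<Rightarrow> bool" where
  "crossing X T y \<longleftrightarrow>
     (0 \<le> T \<and> (\<forall>y. (\<forall>x\<in>set X. key x \<le> y) \<longrightarrow> T \<le> val_le X y) \<longrightarrow>
      val_lt X y \<le> T \<and> T \<le> val_le X y)"

text \<open>
  State of a search: \<open>I\<close> are the items strictly between the bounds \<open>lo\<close> and \<open>h\<close> found so far, and \<open>A\<close> and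
  \<open>B\<close> summarize the discarded items up to \<open>lo\<close>. As long as \<open>h\<close> is infinite, \<open>hi\<close> is meaningless.
\<close>
definition narrowed :: "item list \<Rightarrow> real \<Rightarrow> real \<Rightarrow> real \<Rightarrow> real \<Rightarrow> item list \<Rightarrow> bool" where
  "narrowed X T A B hi I \<longleftrightarrow> (\<exists>lo h :: ereal.
     I = filter (\<lambda>x. lo < ereal (key x) \<and> ereal (key x) < h) X \<and>
     A = (\<Sum>x\<leftarrow>X. if ereal (key x) \<le> lo then slp x else 0) \<and>
     B = (\<Sum>x\<leftarrow>X. if ereal (key x) \<le> lo then off x else 0) \<and>
     lo < h \<and>
     (lo = -\<infinity> \<or> (\<exists>r. lo = ereal r \<and> val_le X r < T)) \<and>
     (h = \<infinity> \<or> h = ereal hi \<and> T \<le> val_le X hi))"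

lemma narrowed_init: "narrowed X T 0 0 hi X"
  unfolding narrowed_def by (rule exI[of _ "-\<infinity>"], rule exI[of _ \<infinity>]) (simp add: comp_def)

lemma sum_list_if_mono:
  fixes g :: "'a \<Rightarrow> 'b::comm_monoid_add"
  assumes "\<And>x. P x \<longleftrightarrow> Q x \<or> R x" "\<And>x. \<not> (Q x \<and> R x)"
  shows "(\<Sum>x\<leftarrow>X. if P x then g x else 0) = (\<Sum>x\<leftarrow>X. if Q x then g x else 0) + (\<Sum>x\<leftarrow>filter R X. g x)"
  using assms by (induction X) (auto simp: ac_simps)

lemma sum_list_if_affine:
  fixes y :: real
  shows "(\<Sum>x\<leftarrow>X. if P x then slp x * y + off x else 0) =
    (\<Sum>x\<leftarrow>X. if P x then slp x else 0) * y + (\<Sum>x\<leftarrow>X. if P x then off x else 0)"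
  by (induction X) (auto simp: algebra_simps)

text \<open>This is bisection: the invariant records only that the value is below \<open>T\<close>
  at the lower bound and at least \<open>T\<close> at the upper one. The pivot lies strictly between
  the bounds, so the items with key at most \<open>p\<close> are the discarded lower ones together
  with those found in \<open>I\<close>. Hence a scan of \<open>I\<close> alone yields
  \<open>A' * p + B'\<close>, the value of the whole list at \<open>p\<close>.\<close>

lemma narrowed_step:
  assumes n: "narrowed X T A B hi I"
    and p: "\<exists>x\<in>set I. key x \<le> p" "\<exists>x\<in>set I. p \<le> key x"
    and A': "A' = A + (\<Sum>x\<leftarrow>filter (\<lambda>x. key x \<le> p) I. slp x)"
    and B': "B' = B + (\<Sum>x\<leftarrow>filter (\<lambda>x. key x \<le> p) I. off x)"
  shows "A' * p + B' < T \<Longrightarrow> narrowed X T A' B' hi (filter (\<lambda>x. p < key x) I)"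
    and "\<not> A' * p + B' < T \<Longrightarrow> narrowed X T A B p (filter (\<lambda>x. key x < p) I)"
proof -
  from n obtain lo h :: ereal where
    I: "I = filter (\<lambda>x. lo < ereal (key x) \<and> ereal (key x) < h) X" and
    A: "A = (\<Sum>x\<leftarrow>X. if ereal (key x) \<le> lo then slp x else 0)" and
    B: "B = (\<Sum>x\<leftarrow>X. if ereal (key x) \<le> lo then off x else 0)" and
    lh: "(lo = -\<infinity> \<or> (\<exists>r. lo = ereal r \<and> val_le X r < T))"
     "(h = \<infinity> \<or> h = ereal hi \<and> T \<le> val_le X hi)"
    unfolding narrowed_def by blast
  have lp: "lo < ereal p" "ereal p < h"
    using p unfolding I
    by (cases lo; cases h; force)+
  have eq: "ereal (key x) \<le> ereal p \<longleftrightarrow>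
    ereal (key x) \<le> lo \<or> (lo < ereal (key x) \<and> ereal (key x) < h \<and> key x \<le> p)" for x :: item
    using lp by (cases lo; cases h) auto
  have eq1: "(lo < ereal (key x) \<and> ereal (key x) < h) \<and> p < key x \<longleftrightarrow>
      ereal p < ereal (key x) \<and> ereal (key x) < h"
    and eq2: "(lo < ereal (key x) \<and> ereal (key x) < h) \<and> key x < p \<longleftrightarrow>
      lo < ereal (key x) \<and> ereal (key x) < ereal p" for x :: item
    using lp by (cases lo; cases h; auto)+
  have A'': "A' = (\<Sum>x\<leftarrow>X. if key x \<le> p then slp x else 0)"
    unfolding A' A I filter_filter
    by (subst sum_list_if_mono[where Q = "\<lambda>x. ereal (key x) \<le> lo"
          and R = "\<lambda>x. (lo < ereal (key x) \<and> ereal (key x) < h) \<and> key x \<le> p"])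
      (use eq in \<open>auto simp: conj_ac\<close>)
  have B'': "B' = (\<Sum>x\<leftarrow>X. if key x \<le> p then off x else 0)"
    unfolding B' B I filter_filter
    by (subst sum_list_if_mono[where Q = "\<lambda>x. ereal (key x) \<le> lo"
          and R = "\<lambda>x. (lo < ereal (key x) \<and> ereal (key x) < h) \<and> key x \<le> p"])
      (use eq in \<open>auto simp: conj_ac\<close>)
  have val: "val_le X p = A' * p + B'"
    unfolding val_le_def A'' B'' by (rule sum_list_if_affine)
  show "narrowed X T A' B' hi (filter (\<lambda>x. p < key x) I)" if "A' * p + B' < T"
    unfolding narrowed_def
  proof (rule exI[of _ "ereal p"], rule exI[of _ h], intro conjI)
    show "filter (\<lambda>x. p < key x) I = filter (\<lambda>x. ereal p < ereal (key x) \<and> ereal (key x) < h) X"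
      unfolding I filter_filter by (rule filter_cong[OF refl eq1])
  qed (use A'' B'' lp lh that val in auto)
  show "narrowed X T A B p (filter (\<lambda>x. key x < p) I)" if "\<not> A' * p + B' < T"
    unfolding narrowed_def
  proof (rule exI[of _ lo], rule exI[of _ "ereal p"], intro conjI)
    show "filter (\<lambda>x. key x < p) I = filter (\<lambda>x. lo < ereal (key x) \<and> ereal (key x) < ereal p) X"
      unfolding I filter_filter by (rule filter_cong[OF refl eq2])
  qed (use A B lp lh that val in auto)
qed

text \<open>Between the bounds the value is the affine function \<open>A * y + B\<close>, which also
  gives the limit from the left at \<open>hi\<close>. If this limit exceeds \<open>T\<close>, the
  crossing is where the line meets \<open>T\<close>; otherwise the value jumps over \<open>T\<close>
  at \<open>hi\<close>.\<close>

lemma narrowed_crossing: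
  assumes n: "narrowed X T A B hi []"
  shows "crossing X T (if T < A * hi + B then (T - B) / A else hi)"
  unfolding crossing_def
proof (intro impI)
  assume T: "0 \<le> T \<and> (\<forall>y. (\<forall>x\<in>set X. key x \<le> y) \<longrightarrow> T \<le> val_le X y)"
  from n obtain lo h :: ereal where
    I: "[] = filter (\<lambda>x. lo < ereal (key x) \<and> ereal (key x) < h) X" and
    A: "A = (\<Sum>x\<leftarrow>X. if ereal (key x) \<le> lo then slp x else 0)" and
    B: "B = (\<Sum>x\<leftarrow>X. if ereal (key x) \<le> lo then off x else 0)" and
    lt: "lo < h" and
    lh: "(lo = -\<infinity> \<or> (\<exists>r. lo = ereal r \<and> val_le X r < T))"
     "(h = \<infinity> \<or> h = ereal hi \<and> T \<le> val_le X hi)"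
    unfolding narrowed_def by blast
  have key: "ereal (key x) \<le> lo \<or> h \<le> ereal (key x)" if "x \<in> set X" for x
    using I[symmetric] that unfolding filter_empty_conv by (meson not_le)
  have le: "val_le X y = A * y + B" if y: "lo \<le> ereal y" "ereal y < h" for y
  proof -
    have "ereal (key x) \<le> lo \<longleftrightarrow> key x \<le> y" if "x \<in> set X" for x
      using key[OF that] y by (cases lo; cases h) auto
    then have "val_le X y = (\<Sum>x\<leftarrow>X. if ereal (key x) \<le> lo then slp x * y + off x else 0)"
      unfolding val_le_def by (intro arg_cong[where f = sum_list] map_cong) auto
    then show ?thesis unfolding A B sum_list_if_affine by simp
  qed
  have lt': "val_lt X y = A * y + B" if y: "lo < ereal y" "ereal y \<le> h" for y
  proof -
    have "ereal (key x) \<le> lo \<longleftrightarrow> key x < y" if "x \<in> set X" for x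
      using key[OF that] y by (cases lo; cases h) auto
    then have "val_lt X y = (\<Sum>x\<leftarrow>X. if ereal (key x) \<le> lo then slp x * y + off x else 0)"
      unfolding val_lt_def by (intro arg_cong[where f = sum_list] map_cong) auto
    then show ?thesis unfolding A B sum_list_if_affine by simp
  qed
  let ?y = "if T < A * hi + B then (T - B) / A else hi"
  show "val_lt X ?y \<le> T \<and> T \<le> val_le X ?y"
  proof (cases "h = \<infinity>")
    case True
    \<comment> \<open>Without an upper bound, a finite \<open>lo\<close> would lie above all keys
      with a value below \<open>T\<close>, which the premise on \<open>T\<close> excludes. Then no
      key remains at all and \<open>T\<close> is 0.\<close>
    have "lo = -\<infinity>"
    proof (rule ccontr)
      assume "lo \<noteq> -\<infinity>"
      then obtain r where r: "lo = ereal r" "val_le X r < T" using lh by auto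
      then have "\<forall>x\<in>set X. key x \<le> r" using key True by (metis ereal_infty_less_eq(1) ereal_less_eq(3) PInfty_neq_ereal(2))
      with T have "T \<le> val_le X r" by blast
      with r show False by simp
    qed
    then have "x \<notin> set X" for x using key[of x] True by auto
    then have "X = []" by (metis last_in_set)
    with T have "0 \<le> T" "T \<le> 0" by (simp_all add: val_le_def)
    with \<open>X = []\<close> show ?thesis by (simp add: val_le_def val_lt_def)
  next
    case False
    then have h: "h = ereal hi" "T \<le> val_le X hi" using lh by auto
    show ?thesis
    proof (cases "T < A * hi + B")
      case False
      have "val_lt X hi = A * hi + B" using lt'[of hi] h lt by simp
      with False h show ?thesis by simp
    next
      case True
      \<comment> \<open>With nothing discarded below, the line is constantly 0, and the case
        assumption would make \<open>T\<close> negative.\<close>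
      have "lo \<noteq> -\<infinity>"
      proof
        assume "lo = -\<infinity>"
        then have "A = 0" "B = 0" unfolding A B by (auto simp: comp_def)
        with True T show False by simp
      qed
      then obtain r where r: "lo = ereal r" "val_le X r < T" using lh by auto
      have rh: "r < hi" using lt r h by simp
      have "A * r + B < T" using le[of r] r h rh by simp
      with True have "A * r < A * hi" by simp
      \<comment> \<open>The line is below \<open>T\<close> at \<open>r\<close> and above it at
        \<open>hi\<close>, so it rises and the division is meaningful.\<close>
      then have Apos: "A > 0" using rh by (simp add: mult_less_cancel_left)
      then have "r < (T - B) / A" "(T - B) / A < hi"
        using \<open>A * r + B < T\<close> True by (auto simp: field_simps)
      then have "val_lt X ((T - B) / A) = T" "val_le X ((T - B) / A) = T"
        using lt'[of "(T - B) / A"] le[of "(T - B) / A"] r(1) h(1) Apos by simp_all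
      then show ?thesis using True by simp
    qed
  qed
qed

lemma val_le_unit: "(\<And>x. x \<in> set X \<Longrightarrow> snd x = (0, 1)) \<Longrightarrow>
  val_le X y = real (length (filter (\<lambda>x. key x \<le> y) X))"
  unfolding val_le_def by (induction X) auto

lemma val_lt_unit: "(\<And>x. x \<in> set X \<Longrightarrow> snd x = (0, 1)) \<Longrightarrow>
  val_lt X y = real (length (filter (\<lambda>x. key x < y) X))"
  unfolding val_lt_def by (induction X) auto

lemma crossing_unit:
  assumes "crossing X T y" "\<And>x. x \<in> set X \<Longrightarrow> snd x = (0, 1)" "0 \<le> T" "T \<le> length X"
  shows "real (length (filter (\<lambda>x. key x < y) X)) \<le> T"
    and "T \<le> real (length (filter (\<lambda>x. key x \<le> y) X))"
proof -
  have "T \<le> val_le X y" if "\<forall>x\<in>set X. key x \<le> y" for y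
  proof -
    have "filter (\<lambda>x. key x \<le> y) X = X" using that by simp
    then show ?thesis using assms(4) by (simp add: val_le_unit[OF assms(2)])
  qed
  then have "val_lt X y \<le> T \<and> T \<le> val_le X y"
    using assms(1,3) unfolding crossing_def by blast
  then show "real (length (filter (\<lambda>x. key x < y) X)) \<le> T"
    and "T \<le> real (length (filter (\<lambda>x. key x \<le> y) X))"
    by (simp_all add: val_le_unit[OF assms(2)] val_lt_unit[OF assms(2)])
qed

section \<open>Linear-time search\<close>

definition med3 :: "real \<Rightarrow> real \<Rightarrow> real \<Rightarrow> real" where
  "med3 x y z = (if x < y then if y < z then y else if x < z then z else x
     else if x < z then x else if y < z then z else y)"

definition med9 :: "(nat \<Rightarrow> real) \<Rightarrow> real" where
  "med9 k = med3 (med3 (k 0) (k 1) (k 2)) (med3 (k 3) (k 4) (k 5)) (med3 (k 6) (k 7) (k 8))"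

lemma med3_le: "2 * of_bool (med3 x y z \<le> p) \<le> (of_bool (x \<le> p) + of_bool (y \<le> p) + of_bool (z \<le> p) :: nat)"
  and med3_ge: "2 * of_bool (p \<le> med3 x y z) \<le> (of_bool (p \<le> x) + of_bool (p \<le> y) + of_bool (p \<le> z) :: nat)"
  by (auto simp: med3_def)

text \<open>Two of the three inner medians follow the outer one, and each brings two of its own
  three keys. Counting with \<open>of_bool\<close> keeps the bound additive over disjoint
  groups.\<close>

lemma med9_le: "4 * of_bool (med9 k \<le> p) \<le> (\<Sum>j<9. of_bool (k j \<le> p) :: nat)"
  using med3_le[of "med3 (k 0) (k 1) (k 2)" "med3 (k 3) (k 4) (k 5)" "med3 (k 6) (k 7) (k 8)" p]
    med3_le[of "k 0" "k 1" "k 2" p] med3_le[of "k 3" "k 4" "k 5" p] med3_le[of "k 6" "k 7" "k 8" p]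
  by (simp add: med9_def eval_nat_numeral del: of_bool_eq_1_iff)

lemma med9_ge: "4 * of_bool (p \<le> med9 k) \<le> (\<Sum>j<9. of_bool (p \<le> k j) :: nat)"
  using med3_ge[of p "med3 (k 0) (k 1) (k 2)" "med3 (k 3) (k 4) (k 5)" "med3 (k 6) (k 7) (k 8)"]
    med3_ge[of p "k 0" "k 1" "k 2"] med3_ge[of p "k 3" "k 4" "k 5"] med3_ge[of p "k 6" "k 7" "k 8"]
  by (simp add: med9_def eval_nat_numeral del: of_bool_eq_1_iff)

lemma length_filter_upt: "length (filter P [0..<n]) = (\<Sum>i<n. of_bool (P i))"
  by (induction n) auto

lemma sum_lessThan_add: "(\<Sum>i<m + n. f i) = (\<Sum>i<m. f i) + (\<Sum>i<n. f (m + i :: nat) :: nat)"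
  by (induction n) auto

lemma count_med9:
  fixes P :: "real \<Rightarrow> bool"
  assumes "\<And>k. 4 * of_bool (P (med9 k)) \<le> (\<Sum>j<9. of_bool (P (k j)) :: nat)"
    and "9 * m \<le> n"
  shows "4 * length (filter (\<lambda>i. P (med9 (\<lambda>j. k (9 * i + j)))) [0..<m]) \<le> length (filter (\<lambda>j. P (k j)) [0..<n])"
proof -
  have "4 * length (filter (\<lambda>i. P (med9 (\<lambda>j. k (9 * i + j)))) [0..<m])
      \<le> length (filter (\<lambda>j. P (k j)) [0..<9 * m])"
    unfolding length_filter_upt
  proof (induction m)
    case (Suc m)
    have "9 * Suc m = 9 * m + 9" by simp
    then show ?case using Suc assms(1)[of "\<lambda>j. k (9 * m + j)"]
      by (simp only: sum_lessThan_add sum.lessThan_Suc distrib_left add_mono)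
  qed simp
  also have "\<dots> \<le> length (filter (\<lambda>j. P (k j)) [0..<n])"
    unfolding length_filter_upt using assms(2) by (intro sum_mono2) auto
  finally show ?thesis .
qed

text \<open>At least half of the \<open>m\<close> medians lie on either side of the crossing
  \<open>p\<close>, and each of them brings four of its nine keys. The groups are disjoint, so
  \<open>2 * m\<close> keys result. The lower bound at \<open>p \<le>\<close> comes from the
  complement of the medians strictly below \<open>p\<close>.\<close>

lemma pivot_quality:
  assumes c: "crossing (map (\<lambda>i. (med9 (\<lambda>j. k (9 * i + j)), 0, 1)) [0..<m]) (real m / 2) p"
    and "9 * m \<le> n"
  shows "2 * m \<le> length (filter (\<lambda>j. k j \<le> p) [0..<n])"
    and "2 * m \<le> length (filter (\<lambda>j. p \<le> k j) [0..<n])"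
proof -
  let ?M = "\<lambda>i. med9 (\<lambda>j. k (9 * i + j))"
  have 1: "real (length (filter (\<lambda>i. ?M i < p) [0..<m])) \<le> real m / 2"
    "real m / 2 \<le> real (length (filter (\<lambda>i. ?M i \<le> p) [0..<m]))"
    using crossing_unit[OF c] by (simp_all add: filter_map comp_def) force+
  have "length (filter (\<lambda>i. ?M i < p) [0..<m]) + length (filter (\<lambda>i. p \<le> ?M i) [0..<m]) = m"
    using sum_length_filter_compl[of "\<lambda>i. ?M i < p" "[0..<m]"] by (simp add: not_less)
  then have "m \<le> 2 * length (filter (\<lambda>i. p \<le> ?M i) [0..<m])"
    "m \<le> 2 * length (filter (\<lambda>i. ?M i \<le> p) [0..<m])"
    using 1 by linarith+
  then show "2 * m \<le> length (filter (\<lambda>j. k j \<le> p) [0..<n])"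
    "2 * m \<le> length (filter (\<lambda>j. p \<le> k j) [0..<n])"
    using count_med9[of "\<lambda>x. x \<le> p", OF med9_le assms(2), of k]
      count_med9[of "\<lambda>x. p \<le> x", OF med9_ge assms(2), of k] by linarith+
qed

section \<open>Storage layout and program text of the search\<close>

abbreviation "ncell k \<equiv> NGet k (NConst 0)"
abbreviation "rcell k \<equiv> RGet k (NConst 0)"
abbreviation "nset k \<equiv> NSet k (NConst 0)"
abbreviation "rset k \<equiv> RSet k (NConst 0)"
abbreviation "rconst c \<equiv> OfNat (NConst c)"

text \<open>
  Array names. Natural and real arrays are numbered independently, and the first eight real arrays
  are those of the input. A scalar is stored at position 0 of its array. The arrays \<open>LEN\<close>, \<open>BASE\<close> and
  \<open>GOAL\<close> to \<open>RES\<close> hold the local variables of the recursive search, indexed by recursion depth.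
\<close>
abbreviation (input) "HEAD \<equiv> 2 :: nat"
abbreviation (input) "NEXT \<equiv> 3 :: nat"
abbreviation (input) "STAGE \<equiv> 6 :: nat"
abbreviation (input) "PTR \<equiv> 7 :: nat"
abbreviation (input) "DEPTH \<equiv> 8 :: nat"
abbreviation (input) "LEN \<equiv> 9 :: nat"
abbreviation (input) "BASE \<equiv> 10 :: nat"
abbreviation (input) "IDX \<equiv> 11 :: nat"
abbreviation (input) "OUT \<equiv> 12 :: nat"
abbreviation (input) "SRC \<equiv> 13 :: nat"
abbreviation (input) "FUEL \<equiv> 14 :: nat"
abbreviation (input) "CNT \<equiv> 15 :: nat"

abbreviation (input) "SOL \<equiv> 0 :: nat"
abbreviation (input) "LO \<equiv> 2 :: nat"
abbreviation (input) "HI \<equiv> 3 :: nat"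
abbreviation (input) "BLO \<equiv> 4 :: nat"
abbreviation (input) "BHI \<equiv> 5 :: nat"
abbreviation (input) "SCALE \<equiv> 6 :: nat"
abbreviation (input) "SHIFT \<equiv> 7 :: nat"
abbreviation (input) "KEY \<equiv> 8 :: nat"
abbreviation (input) "SLP \<equiv> 9 :: nat"
abbreviation (input) "OFF \<equiv> 10 :: nat"
abbreviation (input) "GOAL \<equiv> 11 :: nat"
abbreviation (input) "SSLP \<equiv> 12 :: nat"
abbreviation (input) "SOFF \<equiv> 13 :: nat"
abbreviation (input) "RES \<equiv> 14 :: nat"
abbreviation (input) "PIV \<equiv> 15 :: nat"
abbreviation (input) "TMP1 \<equiv> 16 :: nat"
abbreviation (input) "TMP2 \<equiv> 17 :: nat"

abbreviation "dep \<equiv> ncell DEPTH"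
abbreviation "len \<equiv> NGet LEN dep"
abbreviation "bas \<equiv> NGet BASE dep"
abbreviation "cur k \<equiv> RGet k (NAdd bas (ncell IDX))"

definition med3_com :: "nat \<Rightarrow> nexp \<Rightarrow> rexp \<Rightarrow> rexp \<Rightarrow> rexp \<Rightarrow> com" where
  "med3_com k i x y z =
     Cond (RLess x y) (Cond (RLess y z) (RSet k i y) (Cond (RLess x z) (RSet k i z) (RSet k i x)))
       (Cond (RLess x z) (RSet k i x) (Cond (RLess y z) (RSet k i z) (RSet k i y)))"

abbreviation "src_key c \<equiv> RGet KEY (NAdd (ncell SRC) (NConst c))"
abbreviation "med_pos \<equiv> NAdd (NAdd bas len) (ncell IDX)"

text \<open>Medians of medians of three, since they are cheaper to program than medians of five; a
  median of them still has at least two ninths of the items on either side. They are stored right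
  behind the items of the current frame and become the items of the next one.\<close>
definition medians :: com where
  "medians =
     nset IDX (NConst 0);; nset SRC bas;;
     While (NLess (NAdd (ncell SRC) (NConst 8)) (NAdd bas len))
       (med3_com PIV (NConst 0) (src_key 0) (src_key 1) (src_key 2);;
        med3_com TMP1 (NConst 0) (src_key 3) (src_key 4) (src_key 5);;
        med3_com TMP2 (NConst 0) (src_key 6) (src_key 7) (src_key 8);;
        med3_com KEY med_pos (rcell PIV) (rcell TMP1) (rcell TMP2);;
        RSet SLP med_pos (rconst 0);;
        RSet OFF med_pos (rconst 1);;
        nset IDX (NAdd (ncell IDX) (NConst 1));;
        nset SRC (NAdd (ncell SRC) (NConst 9)))"

text \<open>The middle of the medians is again a crossing, so the search calls itself one frame
  deeper, with half their number as its goal. Below nine items there is no full group and the first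
  key is taken, which removes at least one item per round.\<close>

definition pivot :: com where
  "pivot =
     Cond (NLess len (NConst 9))
       (rset PIV (RGet KEY bas))
       (medians;;
        nset DEPTH (NAdd dep (NConst 1));;
        NSet LEN dep (ncell IDX);;
        NSet BASE dep (NAdd (NGet BASE (NSub dep (NConst 1))) (NGet LEN (NSub dep (NConst 1))));;
        RSet GOAL dep (RDiv (OfNat (ncell IDX)) (rconst 2));;
        RSet SSLP dep (rconst 0);; RSet SOFF dep (rconst 0);; RSet RES dep (rconst 0);;
        Call 0;;
        rset PIV (RGet RES dep);;
        nset DEPTH (NSub dep (NConst 1)))"

definition evaluate :: com where
  "evaluate =
     rset TMP1 (RGet SSLP dep);; rset TMP2 (RGet SOFF dep);; nset IDX (NConst 0);;
     While (NLess (ncell IDX) len)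
       (Cond (BNot (RLess (rcell PIV) (cur KEY)))
          (rset TMP1 (RAdd (rcell TMP1) (cur SLP));; rset TMP2 (RAdd (rcell TMP2) (cur OFF)))
          Skip;;
        nset IDX (NAdd (ncell IDX) (NConst 1)))"

definition retain :: "bexp \<Rightarrow> com" where
  "retain c =
     nset IDX (NConst 0);; nset OUT (NConst 0);;
     While (NLess (ncell IDX) len)
       (Cond c
          (RSet KEY (NAdd bas (ncell OUT)) (cur KEY);;
           RSet SLP (NAdd bas (ncell OUT)) (cur SLP);;
           RSet OFF (NAdd bas (ncell OUT)) (cur OFF);;
           nset OUT (NAdd (ncell OUT) (NConst 1)))
          Skip;;
        nset IDX (NAdd (ncell IDX) (NConst 1)));;
     NSet LEN dep (ncell OUT)"

text \<open>The cells \<open>GOAL\<close>, \<open>SSLP\<close>, \<open>SOFF\<close> and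
  \<open>RES\<close> of a frame are the parameters \<open>T\<close>, \<open>A\<close>,
  \<open>B\<close> and \<open>hi\<close> of \<open>narrowed\<close>. Only the call inside
  \<open>pivot\<close> opens a new frame; the final call is a tail call that reuses the narrowed
  one.\<close>

definition search :: com where
  "search =
     Cond (NLess (NConst 0) len)
       (pivot;; evaluate;;
        Cond (RLess (RAdd (RMul (rcell TMP1) (rcell PIV)) (rcell TMP2)) (RGet GOAL dep))
          (RSet SSLP dep (rcell TMP1);; RSet SOFF dep (rcell TMP2);;
           retain (RLess (rcell PIV) (cur KEY)))
          (RSet RES dep (rcell PIV);;
           retain (RLess (cur KEY) (rcell PIV)));;
        Call 0)
       (Cond (RLess (RGet GOAL dep) (RAdd (RMul (RGet SSLP dep) (RGet RES dep)) (RGet SOFF dep)))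
          (RSet RES dep (RDiv (RSub (RGet GOAL dep) (RGet SOFF dep)) (RGet SSLP dep)))
          Skip)"

definition item_at :: "state \<Rightarrow> nat \<Rightarrow> item" where
  "item_at s i = (rmem s KEY i, rmem s SLP i, rmem s OFF i)"

definition items :: "state \<Rightarrow> nat \<Rightarrow> item list" where
  "items s d = map (\<lambda>i. item_at s (nmem s BASE d + i)) [0..<nmem s LEN d]"

section \<open>Correctness and running time of the search\<close>

lemma runs_med3I:
  assumes "\<And>t. t \<le> 4 \<Longrightarrow> Q t (rupd k (nval s i) (med3 (rval pr s x) (rval pr s y) (rval pr s z)) s)"
  shows "runs pr ps (med3_com k i x y z) s Q"
  using assms[of 3] assms[of 4]
  by (auto simp: med3_com_def runs_simps med3_def eval_nat_numeral split: if_splits)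

lemma runs_medians:
  fixes s :: state
  defines "d \<equiv> nmem s DEPTH 0"
  defines "n \<equiv> nmem s LEN d" and "b \<equiv> nmem s BASE d"
  assumes "n \<ge> 9"
  shows "runs pr ps medians s (\<lambda>t s'. t \<le> 3 * n + 3 \<and> nmem s' IDX 0 = n div 9 \<and>
    (\<forall>k. k \<notin> {IDX, SRC} \<longrightarrow> nmem s' k = nmem s k) \<and>
    (\<forall>k. k \<notin> {KEY, SLP, OFF, PIV, TMP1, TMP2} \<longrightarrow> rmem s' k = rmem s k) \<and>
    (\<forall>i < b + n. item_at s' i = item_at s i) \<and>
    (\<forall>i < n div 9. item_at s' (b + n + i) = (med9 (\<lambda>j. rmem s KEY (b + (9 * i + j))), 0, 1)))"
proof -
  \<comment> \<open>Four medians of at most 4 steps each, four assignments and the loop test make 21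
    steps for nine items.\<close>
  define J where "J = (\<lambda>t s'. \<exists>m. t \<le> 21 * m + 2 \<and> 9 * m \<le> n \<and> nmem s' IDX 0 = m \<and> nmem s' SRC 0 = b + 9 * m \<and>
    (\<forall>k. k \<notin> {IDX, SRC} \<longrightarrow> nmem s' k = nmem s k) \<and>
    (\<forall>k. k \<notin> {KEY, SLP, OFF, PIV, TMP1, TMP2} \<longrightarrow> rmem s' k = rmem s k) \<and>
    (\<forall>i < b + n. item_at s' i = item_at s i) \<and>
    (\<forall>i < m. item_at s' (b + n + i) = (med9 (\<lambda>j. rmem s KEY (b + (9 * i + j))), 0, 1)))"
  have init: "J 2 (nupd SRC 0 b (nupd IDX 0 0 s))"
    unfolding J_def by (intro exI[of _ 0]) (simp add: item_at_def)
  show ?thesis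
    unfolding medians_def
    apply (simp add: runs_Seq runs_NSet)
    apply (rule runs_While[where J = "\<lambda>t. J (Suc (Suc t))" and \<mu> = "\<lambda>s. n - 9 * nmem s IDX 0"])
    subgoal using init by (simp add: d_def b_def numeral_2_eq_2)
    subgoal premises prems for t s1
    proof -
      from prems(1) obtain m where J: "Suc (Suc t) \<le> 21 * m + 2" "9 * m \<le> n" "nmem s1 IDX 0 = m" "nmem s1 SRC 0 = b + 9 * m"
        and fn: "\<And>k. k \<notin> {IDX, SRC} \<Longrightarrow> nmem s1 k = nmem s k"
        and fr: "\<And>k. k \<notin> {KEY, SLP, OFF, PIV, TMP1, TMP2} \<Longrightarrow> rmem s1 k = rmem s k"
        and it: "\<And>i. i < b + n \<Longrightarrow> item_at s1 i = item_at s i"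
        and md: "\<And>i. i < m \<Longrightarrow> item_at s1 (b + n + i) = (med9 (\<lambda>j. rmem s KEY (b + (9 * i + j))), 0, 1)"
        unfolding J_def by blast
      have f1: "nmem s1 DEPTH 0 = d" "nmem s1 LEN d = n" "nmem s1 BASE d = b"
        using fn by (simp_all add: d_def n_def b_def)
      have m1: "9 * Suc m \<le> n" using prems(2) J f1 by simp
      have kk: "rmem s1 KEY i = rmem s KEY i" if "i < b + n" for i
        using it[OF that] by (simp add: item_at_def)
      show ?thesis
        apply (simp add: runs_Seq)
        apply (rule runs_med3I)
        apply (rule runs_med3I)
        apply (rule runs_med3I)
        apply (rule runs_med3I)
        apply (simp add: runs_simps f1 J)
        apply (rule conjI)
        subgoal premises tt for t1 t2 t3 t4
        proof -
          show ?thesis (is "J _ ?s2")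
          unfolding J_def
        proof (intro exI[of _ "Suc m"] conjI allI impI)
          fix i assume "i < b + n"
          then show "item_at ?s2 i = item_at s i" using it[of i] by (simp add: item_at_def J f1)
        next
          fix i assume "i < Suc m"
          then show "item_at ?s2 (b + n + i) = (med9 (\<lambda>j. rmem s KEY (b + (9 * i + j))), 0, 1)"
            using md[of i] kk m1 by (cases "i = m") (simp_all add: item_at_def med9_def J f1 add.assoc)
        qed (use tt J m1 f1 fn fr in simp_all)
        qed
        subgoal using m1 J by simp
        done
    qed
    subgoal premises prems for t s1
    proof -
      from prems(1) obtain m where J: "Suc (Suc t) \<le> 21 * m + 2" "9 * m \<le> n" "nmem s1 IDX 0 = m" "nmem s1 SRC 0 = b + 9 * m"
        and fn: "\<And>k. k \<notin> {IDX, SRC} \<Longrightarrow> nmem s1 k = nmem s k"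
        and R: "(\<forall>k. k \<notin> {KEY, SLP, OFF, PIV, TMP1, TMP2} \<longrightarrow> rmem s1 k = rmem s k) \<and>
          (\<forall>i < b + n. item_at s1 i = item_at s i) \<and>
          (\<forall>i < m. item_at s1 (b + n + i) = (med9 (\<lambda>j. rmem s KEY (b + (9 * i + j))), 0, 1))"
        unfolding J_def by blast
      have f1: "nmem s1 DEPTH 0 = d" "nmem s1 LEN d = n" "nmem s1 BASE d = b"
        using fn by (simp_all add: d_def n_def b_def)
      have "n < 9 * m + 9" using prems(2) J f1 by simp
      then have m: "m = n div 9" using J(2) by simp
      have "Suc (Suc (Suc t)) \<le> 3 * n + 3" using J(1,2) by linarith
      then show ?thesis using R fn J m by simp
    qed
    done
qed

lemma runs_evaluate:
  fixes s :: state
  defines "d \<equiv> nmem s DEPTH 0"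
  defines "n \<equiv> nmem s LEN d" and "I \<equiv> filter (\<lambda>x. key x \<le> rmem s PIV 0) (items s d)"
  shows "runs pr ps evaluate s (\<lambda>t s'. t \<le> 5 * n + 4 \<and>
    (\<forall>k. k \<noteq> IDX \<longrightarrow> nmem s' k = nmem s k) \<and>
    (\<forall>k. k \<notin> {TMP1, TMP2} \<longrightarrow> rmem s' k = rmem s k) \<and>
    rmem s' TMP1 0 = rmem s SSLP d + (\<Sum>x\<leftarrow>I. slp x) \<and>
    rmem s' TMP2 0 = rmem s SOFF d + (\<Sum>x\<leftarrow>I. off x))"
proof -
  define b where "b = nmem s BASE d"
  define It where "It i = filter (\<lambda>x. key x \<le> rmem s PIV 0) (map (\<lambda>i. item_at s (b + i)) [0..<i])" for i
  define J where "J = (\<lambda>(t::nat) (s'::state). t \<le> 5 * nmem s' IDX 0 \<and> nmem s' IDX 0 \<le> n \<and>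
    (\<forall>k. k \<noteq> IDX \<longrightarrow> nmem s' k = nmem s k) \<and>
    (\<forall>k. k \<notin> {TMP1, TMP2} \<longrightarrow> rmem s' k = rmem s k) \<and>
    rmem s' TMP1 0 = rmem s SSLP d + (\<Sum>x\<leftarrow>It (nmem s' IDX 0). slp x) \<and>
    rmem s' TMP2 0 = rmem s SOFF d + (\<Sum>x\<leftarrow>It (nmem s' IDX 0). off x))"
  have I: "I = It n"
    by (simp add: I_def It_def items_def n_def b_def)
  have Suc: "It (Suc i) = It i @ (if rmem s KEY (b + i) \<le> rmem s PIV 0 then [item_at s (b + i)] else [])" for i
    by (simp add: It_def item_at_def)
  show ?thesis
    unfolding evaluate_def
    apply (simp add: runs_simps)
    apply (rule runs_While[where J = J and \<mu> = "\<lambda>s. n - nmem s IDX 0"])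
    subgoal by (simp add: J_def d_def It_def)
    subgoal for t s1
      by (auto simp: J_def runs_simps Suc item_at_def n_def b_def d_def algebra_simps)
    subgoal for t s1
      by (auto simp: J_def I n_def d_def not_less dest!: le_antisym)
    done
qed

lemma runs_retain:
  fixes s :: state
  assumes c: "\<And>s. bval pr s c \<longleftrightarrow>
    C (rmem s PIV 0) (rmem s KEY (nmem s BASE (nmem s DEPTH 0) + nmem s IDX 0))"
  defines "d \<equiv> nmem s DEPTH 0"
  defines "n \<equiv> nmem s LEN d" and "b \<equiv> nmem s BASE d"
    and "I \<equiv> filter (\<lambda>x. C (rmem s PIV 0) (key x)) (items s d)"
  shows "runs pr ps (retain c) s (\<lambda>t s'. t \<le> 7 * n + 4 \<and>
    (\<forall>k. k \<notin> {IDX, OUT, LEN} \<longrightarrow> nmem s' k = nmem s k) \<and>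
    (\<forall>e. e \<noteq> d \<longrightarrow> nmem s' LEN e = nmem s LEN e) \<and>
    (\<forall>k. k \<notin> {KEY, SLP, OFF} \<longrightarrow> rmem s' k = rmem s k) \<and>
    (\<forall>i < b. item_at s' i = item_at s i) \<and>
    nmem s' LEN d = length I \<and> items s' d = I)"
proof -
  define It where "It i = filter (\<lambda>x. C (rmem s PIV 0) (key x)) (map (\<lambda>i. item_at s (b + i)) [0..<i])" for i
  define J where "J = (\<lambda>(t::nat) (s'::state). \<exists>i. t \<le> 7 * i \<and> nmem s' IDX 0 = i \<and> i \<le> n \<and>
    (\<forall>k. k \<notin> {IDX, OUT} \<longrightarrow> nmem s' k = nmem s k) \<and>
    (\<forall>k. k \<notin> {KEY, SLP, OFF} \<longrightarrow> rmem s' k = rmem s k) \<and>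
    nmem s' OUT 0 = length (It i) \<and>
    (\<forall>j < length (It i). item_at s' (b + j) = It i ! j) \<and>
    (\<forall>j < b. item_at s' j = item_at s j) \<and>
    (\<forall>j < n. i \<le> j \<longrightarrow> item_at s' (b + j) = item_at s (b + j)))"
  have I: "I = It n"
    by (simp add: I_def It_def items_def n_def b_def)
  have Suc: "It (Suc i) = It i @ (if C (rmem s PIV 0) (rmem s KEY (b + i)) then [item_at s (b + i)] else [])" for i
    by (simp add: It_def item_at_def)
  \<comment> \<open>The write position never overtakes the read position, so compacting in place
    destroys no unread item.\<close>
  have le: "length (It i) \<le> i" for i
    using length_filter_le[of "\<lambda>x. C (rmem s PIV 0) (key x)" "map (\<lambda>i. item_at s (b + i)) [0..<i]"]
    by (simp add: It_def)
  show ?thesis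
    unfolding retain_def
    apply (simp add: runs_simps)
    apply (rule runs_While[where J = J and \<mu> = "\<lambda>s. n - nmem s IDX 0"])
    subgoal by (simp add: J_def d_def It_def item_at_def)
    subgoal premises prems for t s1
    proof -
      from prems(1) obtain i where J: "t \<le> 7 * i" "nmem s1 IDX 0 = i" "i \<le> n"
        and fn: "\<And>k. k \<notin> {IDX, OUT} \<Longrightarrow> nmem s1 k = nmem s k"
        and fr: "\<And>k. k \<notin> {KEY, SLP, OFF} \<Longrightarrow> rmem s1 k = rmem s k"
        and out: "nmem s1 OUT 0 = length (It i)"
        and it: "\<And>j. j < length (It i) \<Longrightarrow> item_at s1 (b + j) = It i ! j"
        and lo: "\<And>j. j < b \<Longrightarrow> item_at s1 j = item_at s j"
        and hi: "\<And>j. j < n \<Longrightarrow> i \<le> j \<Longrightarrow> item_at s1 (b + j) = item_at s (b + j)"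
        unfolding J_def by blast
      have f1: "nmem s1 DEPTH 0 = d" "nmem s1 LEN d = n" "nmem s1 BASE d = b" "rmem s1 PIV = rmem s PIV"
        using fn fr by (simp_all add: d_def n_def b_def)
      have i: "i < n" using prems(2) f1 J by simp
      have h: "rmem s1 KEY (b + i) = rmem s KEY (b + i)" "rmem s1 SLP (b + i) = rmem s SLP (b + i)"
        "rmem s1 OFF (b + i) = rmem s OFF (b + i)"
        using hi[OF i] by (simp_all add: item_at_def)
      show ?thesis
      proof (cases "C (rmem s PIV 0) (rmem s KEY (b + i))")
        case True
        show ?thesis
          apply (simp add: runs_simps c f1 J True h)
          apply (rule conjI)
          subgoal
          proof -
            show ?thesis (is "J _ ?s2")
              unfolding J_def
            proof (intro exI[of _ "Suc i"] conjI allI impI)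
              fix j assume "j < length (It (Suc i))"
              then consider "j = length (It i)" | "j < length (It i)" using True by (auto simp: Suc less_Suc_eq)
              then show "item_at ?s2 (b + j) = It (Suc i) ! j"
                using it[of j] True by cases (simp_all add: Suc item_at_def out nth_append f1)
            next
              fix j assume "j < b"
              then show "item_at ?s2 j = item_at s j" using lo[of j] by (simp add: item_at_def)
            next
              fix j assume "j < n" "Suc i \<le> j"
              then show "item_at ?s2 (b + j) = item_at s (b + j)"
                using hi[of j] le[of i] by (simp add: item_at_def out)
            qed (use J i fn fr out True in \<open>simp_all add: Suc\<close>)
          qed
          subgoal using i J by simp
          done
      next
        case False
        show ?thesis
          apply (simp add: runs_simps c f1 J False h)
          apply (rule conjI)
          subgoal unfolding J_def
            by (rule exI[of _ "Suc i"])
              (use J i fn fr out it lo hi in \<open>simp add: Suc False item_at_def\<close>)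
          subgoal using i J by simp
          done
      qed
    qed
    subgoal premises prems for t s1
    proof -
      from prems(1) obtain i where J: "t \<le> 7 * i" "nmem s1 IDX 0 = i" "i \<le> n"
        and fn: "\<And>k. k \<notin> {IDX, OUT} \<Longrightarrow> nmem s1 k = nmem s k"
        and fr: "\<And>k. k \<notin> {KEY, SLP, OFF} \<Longrightarrow> rmem s1 k = rmem s k"
        and out: "nmem s1 OUT 0 = length (It i)"
        and it: "\<And>j. j < length (It i) \<Longrightarrow> item_at s1 (b + j) = It i ! j"
        and lo: "\<And>j. j < b \<Longrightarrow> item_at s1 j = item_at s j"
        unfolding J_def by blast
      have f1: "nmem s1 DEPTH 0 = d" "nmem s1 LEN d = n" "nmem s1 BASE d = b"
        using fn by (simp_all add: d_def n_def b_def)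
      have i: "i = n" using prems(2) f1 J by simp
      have "map (\<lambda>i. item_at s1 (b + i)) [0..<length (It n)] = It n"
        by (rule nth_equalityI) (simp_all add: it[unfolded i])
      then show ?thesis
        using J fn fr lo f1 out i by (simp add: I items_def item_at_def runs_simps)
    qed
    done
qed

lemma item_at_upd [simp]:
  "k \<notin> {KEY, SLP, OFF} \<Longrightarrow> item_at (rupd k i v s) = item_at s"
  "item_at (nupd k i w s) = item_at s"
  by (auto simp: item_at_def fun_eq_iff)

lemma items_upd [simp]:
  "k \<notin> {KEY, SLP, OFF} \<Longrightarrow> items (rupd k i v s) = items s"
  "k \<notin> {LEN, BASE} \<Longrightarrow> items (nupd k i w s) = items s"
  by (auto simp: items_def fun_eq_iff)

text \<open>The contract between frames: a call at depth \<open>d\<close> may spoil its own frame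
  and the item cells from its base on, but what the suspended callers need is below both.\<close>

definition same_below :: "nat \<Rightarrow> nat \<Rightarrow> state \<Rightarrow> state \<Rightarrow> bool" where
  "same_below d b s s' \<longleftrightarrow> nmem s' DEPTH 0 = nmem s DEPTH 0 \<and>
     (\<forall>e<d. nmem s' LEN e = nmem s LEN e \<and> nmem s' BASE e = nmem s BASE e \<and>
       rmem s' GOAL e = rmem s GOAL e \<and> rmem s' SSLP e = rmem s SSLP e \<and>
       rmem s' SOFF e = rmem s SOFF e \<and> rmem s' RES e = rmem s RES e) \<and>
     (\<forall>i<b. item_at s' i = item_at s i)"

text \<open>After the first pruning the list under search is no longer in memory. Quantifying over
  every \<open>X\<close> that the frame may be a narrowing of lets the induction hypothesis for the
  tail call speak about the original list.\<close>

definition search_post :: "state \<Rightarrow> nat \<Rightarrow> state \<Rightarrow> bool" where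
  "search_post s t s' \<longleftrightarrow> (let d = nmem s DEPTH 0 in
     t \<le> 300 * nmem s LEN d + 4 \<and> same_below d (nmem s BASE d) s s' \<and>
     (\<forall>X. narrowed X (rmem s GOAL d) (rmem s SSLP d) (rmem s SOFF d) (rmem s RES d) (items s d) \<longrightarrow>
       crossing X (rmem s GOAL d) (rmem s' RES d)))"

text \<open>The medians form a strictly smaller problem, to which \<open>IH\<close> applies. The
  \<open>max 1\<close> stems from fewer than nine items, where the pivot is an item and lies on both
  of its own sides; it guarantees progress there.\<close>

lemma runs_pivot:
  fixes s :: state
  assumes IH: "\<And>s1. nmem s1 LEN (nmem s1 DEPTH 0) < nmem s LEN (nmem s DEPTH 0) \<Longrightarrow>
    runs pr [search] search s1 (search_post s1)"
  defines "d \<equiv> nmem s DEPTH 0"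
  defines "n \<equiv> nmem s LEN d" and "b \<equiv> nmem s BASE d"
  assumes "0 < n"
  shows "runs pr [search] pivot s (\<lambda>t s'. t \<le> 3 * n + 20 + 300 * (n div 9) \<and>
    same_below (Suc d) (b + n) s s' \<and>
    max 1 (2 * (n div 9)) \<le> length (filter (\<lambda>x. key x \<le> rmem s' PIV 0) (items s d)) \<and>
    max 1 (2 * (n div 9)) \<le> length (filter (\<lambda>x. rmem s' PIV 0 \<le> key x) (items s d)))"
proof (cases "n < 9")
  case True
  have I: "items s d = item_at s b # map (\<lambda>i. item_at s (b + i)) [1..<n]"
    using \<open>0 < n\<close> by (simp add: items_def n_def[symmetric] b_def[symmetric] upt_conv_Cons)
  show ?thesis unfolding pivot_def
    using True by (simp add: runs_simps d_def[symmetric] n_def[symmetric] b_def[symmetric]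
      same_below_def item_at_def I)
next
  case False
  let ?m = "n div 9"
  show ?thesis unfolding pivot_def
    apply (simp add: runs_Cond d_def[symmetric] n_def[symmetric] False)
    apply (rule runs_SeqI)
     apply (rule runs_medians)
    subgoal using False by (simp add: n_def d_def)
    subgoal premises prems for t1 s1
    proof -
      have t1: "t1 \<le> 3 * n + 3" and idx: "nmem s1 IDX 0 = ?m"
        and fn: "\<And>k. k \<notin> {IDX, SRC} \<Longrightarrow> nmem s1 k = nmem s k"
        and fr: "\<And>k. k \<notin> {KEY, SLP, OFF, PIV, TMP1, TMP2} \<Longrightarrow> rmem s1 k = rmem s k"
        and it: "\<And>i. i < b + n \<Longrightarrow> item_at s1 i = item_at s i"
        and md: "\<And>i. i < ?m \<Longrightarrow> item_at s1 (b + n + i) = (med9 (\<lambda>j. rmem s KEY (b + (9 * i + j))), 0, 1)"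
        using prems unfolding n_def b_def d_def by blast+
      have f1: "nmem s1 DEPTH 0 = d" "nmem s1 LEN d = n" "nmem s1 BASE d = b"
        using fn by (simp_all add: d_def n_def b_def)
      have m: "?m < n" using \<open>0 < n\<close> by simp
      show ?thesis
        apply (simp add: runs_simps runs_Call f1 idx)
        apply (rule runs_mono)
         apply (rule IH)
        subgoal using m by (simp add: d_def[symmetric] n_def[symmetric])
        subgoal premises post for t2 s2
        proof -
          have below: "\<forall>e<Suc d. nmem s2 LEN e = nmem s1 LEN e \<and> nmem s2 BASE e = nmem s1 BASE e \<and>
              rmem s2 GOAL e = rmem s1 GOAL e \<and> rmem s2 SSLP e = rmem s1 SSLP e \<and>
              rmem s2 SOFF e = rmem s1 SOFF e \<and> rmem s2 RES e = rmem s1 RES e"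
            "\<forall>i<b + n. item_at s2 i = item_at s1 i"
            using post unfolding search_post_def same_below_def
            by (simp_all add: Let_def item_at_def f1)
          have len: "t2 \<le> 300 * ?m + 4"
            using post unfolding search_post_def by (simp add: Let_def)
          let ?X = "map (\<lambda>i. (med9 (\<lambda>j. rmem s KEY (b + (9 * i + j))), 0, 1)) [0..<?m]"
          have "crossing ?X (real ?m / 2) (rmem s2 RES (Suc d))"
          proof -
            have "map (\<lambda>i. (rmem s1 KEY (b + n + i), rmem s1 SLP (b + n + i), rmem s1 OFF (b + n + i))) [0..<?m] = ?X"
              using md by (simp add: item_at_def)
            then show ?thesis using post narrowed_init[of ?X "real ?m / 2" 0]
              unfolding search_post_def by (simp add: Let_def items_def item_at_def f1 del: map_eq_conv)
          qed
          from pivot_quality[of "\<lambda>i. rmem s KEY (b + i)", OF this, of n]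
          have q: "2 * ?m \<le> length (filter (\<lambda>j. rmem s KEY (b + j) \<le> rmem s2 RES (Suc d)) [0..<n])"
            "2 * ?m \<le> length (filter (\<lambda>j. rmem s2 RES (Suc d) \<le> rmem s KEY (b + j)) [0..<n])"
            by simp_all
          have d2: "nmem s2 DEPTH 0 = Suc d"
            using post unfolding search_post_def same_below_def by (simp add: Let_def)
          have m1: "?m \<ge> 1" using False by linarith
          show ?thesis
            using t1 len q m1 below d2 f1 fn fr it
            by (simp add: same_below_def items_def item_at_def filter_map comp_def d_def[symmetric] n_def[symmetric] b_def[symmetric])
        qed
        done
    qed
    done
qed

text \<open>Write m for \<open>n div 9\<close>. The pivot costs 300 m and saves 600 m by removing 2
  m items, which leaves 300 m to pay for the scans; \<open>15 * n + 40\<close> fits because n is at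
  most 9 m + 8 and m is at least 1. Below nine items the single removed item pays 300, while the
  scans cost at most 160.\<close>

lemma recurrence:
  fixes n n' :: nat
  assumes "n' \<le> n - max 1 (2 * (n div 9))" "0 < n"
  shows "15 * n + 40 + 300 * (n div 9) + (300 * n' + 4) \<le> 300 * n + 4"
proof (cases "n < 9")
  case False
  have "n' + 2 * (n div 9) \<le> n" using assms by (simp add: max_def split: if_splits)
  moreover have "n \<le> 9 * (n div 9) + 8" "1 \<le> n div 9" using False by linarith+
  ultimately show ?thesis by linarith
qed (use assms in simp)

lemma runs_search: "runs pr [search] search s (search_post s)"
proof (induction "nmem s LEN (nmem s DEPTH 0)" arbitrary: s rule: less_induct)
  case less
  define d where "d = nmem s DEPTH 0"
  define n where "n = nmem s LEN d"
  define b where "b = nmem s BASE d"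
  define T where "T = rmem s GOAL d"
  define A where "A = rmem s SSLP d"
  define B where "B = rmem s SOFF d"
  note defs = d_def[symmetric] n_def[symmetric] b_def[symmetric] T_def[symmetric]
    A_def[symmetric] B_def[symmetric]
  show ?case
  proof (cases "n = 0")
    case True
    then have "items s d = []" by (simp add: items_def n_def)
    then show ?thesis
      using narrowed_crossing[of _ T A B "rmem s RES d"] True
      by (subst (2) search_def) (auto simp: runs_simps defs search_post_def same_below_def item_at_def)
  next
    case False
    then have n: "0 < n" by simp
    let ?m = "max 1 (2 * (n div 9))"
    show ?thesis
      apply (subst (2) search_def)
      apply (simp only: runs_Cond)
      apply (simp only: if_True bval.simps nval.simps defs n)
      apply (rule runs_SeqI)
       apply (rule runs_pivot)
      subgoal using less by blast
      subgoal using n by (simp add: defs)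
      subgoal premises prems for t1 s1
      proof -
        define p where "p = rmem s1 PIV 0"
        have t1: "t1 \<le> 3 * n + 20 + 300 * (n div 9)"
          and b1: "same_below (Suc d) (b + n) s s1"
          and q: "?m \<le> length (filter (\<lambda>x. key x \<le> p) (items s d))"
            "?m \<le> length (filter (\<lambda>x. p \<le> key x) (items s d))"
          using prems by (simp_all add: defs p_def)
        have f1: "nmem s1 DEPTH 0 = d" "nmem s1 LEN d = n" "nmem s1 BASE d = b"
          "rmem s1 GOAL d = T" "rmem s1 SSLP d = A" "rmem s1 SOFF d = B" "rmem s1 RES d = rmem s RES d"
          using b1 by (simp_all add: same_below_def defs)
        have I1: "items s1 d = items s d"
          using b1 unfolding items_def same_below_def by (simp add: defs f1)
        define A' where "A' = A + (\<Sum>x\<leftarrow>filter (\<lambda>x. key x \<le> p) (items s d). slp x)"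
        define B' where "B' = B + (\<Sum>x\<leftarrow>filter (\<lambda>x. key x \<le> p) (items s d). off x)"
        have ex: "\<exists>x\<in>set (items s d). key x \<le> p" "\<exists>x\<in>set (items s d). p \<le> key x"
        proof -
          have "filter (\<lambda>x. key x \<le> p) (items s d) \<noteq> []" "filter (\<lambda>x. p \<le> key x) (items s d) \<noteq> []"
            using q by force+
          then show "\<exists>x\<in>set (items s d). key x \<le> p" "\<exists>x\<in>set (items s d). p \<le> key x"
            unfolding filter_empty_conv by blast+
        qed
        have ln: "length (items s d) = n" by (simp add: items_def n_def)
        \<comment> \<open>The discarded items are those on the other side of the pivot, whose number
          is known to be at least \<open>?m\<close>.\<close>
        have l1: "length (filter (\<lambda>x. p < key x) (items s d)) \<le> n - ?m"
          using q sum_length_filter_compl[of "\<lambda>x. p < key x" "items s d"] unfolding not_less ln by linarith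
        have l2: "length (filter (\<lambda>x. key x < p) (items s d)) \<le> n - ?m"
          using q sum_length_filter_compl[of "\<lambda>x. key x < p" "items s d"] unfolding not_less ln by linarith
        show ?thesis
          apply (rule runs_SeqI)
           apply (rule runs_evaluate)
          subgoal premises prems for t2 s2
          proof -
            have t2: "t2 \<le> 5 * n + 4"
              and fn: "\<And>k. k \<noteq> IDX \<Longrightarrow> nmem s2 k = nmem s1 k"
              and fr: "\<And>k. k \<notin> {TMP1, TMP2} \<Longrightarrow> rmem s2 k = rmem s1 k"
              and S: "rmem s2 TMP1 0 = A'" "rmem s2 TMP2 0 = B'"
              using prems by (simp_all add: f1 I1 p_def[symmetric] A'_def B'_def)
            have f2: "nmem s2 DEPTH 0 = d" "nmem s2 LEN d = n" "nmem s2 BASE d = b" "rmem s2 PIV 0 = p"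
              "rmem s2 GOAL d = T" "rmem s2 SSLP d = A" "rmem s2 SOFF d = B" "rmem s2 RES d = rmem s RES d"
              using fn fr by (simp_all add: f1 p_def)
            have I2: "items s2 d = items s d"
              using fn fr unfolding I1[symmetric] by (simp add: items_def item_at_def)
            have b2: "same_below d b s s2"
              using b1 fn fr unfolding same_below_def by (simp add: item_at_def)
            \<comment> \<open>Both branches end with the same tail call. Its time is reported
              separately, hence the 0 in \<open>search_post s 0 s'\<close>; the recurrence supplies
              the true time afterwards.\<close>
            have fin: "runs pr [search] (Call 0) s4 (\<lambda>t s'. t \<le> 300 * nmem s4 LEN d + 5 \<and> search_post s 0 s')"
              if b4: "same_below d b s s4" and l4: "nmem s4 LEN d \<le> n - ?m"
                and f4: "nmem s4 BASE d = b" "rmem s4 GOAL d = T"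
                and I4: "\<And>X. narrowed X T A B (rmem s RES d) (items s d) \<Longrightarrow>
                  narrowed X T (rmem s4 SSLP d) (rmem s4 SOFF d) (rmem s4 RES d) (items s4 d)" for s4
            proof -
              have d4: "nmem s4 DEPTH 0 = d" using b4 by (simp add: same_below_def defs)
              have "nmem s4 LEN d < n" using l4 n by (simp add: max_def split: if_splits)
              then have "runs pr [search] search s4 (search_post s4)"
                using less by (simp add: d4 defs)
              then show ?thesis
                apply (simp add: runs_Call)
                apply (erule runs_mono)
                using b4 I4 f4 by (auto simp: search_post_def d4 defs same_below_def)
            qed
            note rec = recurrence[OF _ n]
            show ?thesis
            proof (cases "A' * p + B' < T")
              case True
              show ?thesis
                apply (simp add: runs_simps f2 S True)
                apply (rule runs_mono[OF runs_retain[where C = "\<lambda>p k. p < k"]])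
                subgoal by simp
                subgoal premises post for t3 s4
                  apply (rule runs_mono)
                   apply (rule fin)
                  subgoal using post b2 unfolding same_below_def by (simp add: f2)
                  subgoal using post l1 by (simp add: f2 I2)
                  subgoal using post by (simp add: f2)
                  subgoal using post by (simp add: f2)
                  subgoal for X
                    using narrowed_step(1)[OF _ ex A'_def B'_def True] post I2
                    by (simp add: f2 S I2)
                  subgoal premises fin for t4 s5
                  proof -
                    have "nmem s4 LEN d \<le> n - ?m"
                      using post l1 by (simp add: f2 I2)
                    from rec[OF this] have "t1 + t2 + t3 + t4 + 6 \<le> 300 * n + 4"
                      using post fin t1 t2 by (simp add: f2)
                    then show ?thesis using fin unfolding search_post_def by (simp add: Let_def defs)
                  qed
                  done
                done
            next
              case False
              show ?thesis
                apply (simp add: runs_simps f2 S False)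
                apply (rule runs_mono[OF runs_retain[where C = "\<lambda>p k. k < p"]])
                subgoal by simp
                subgoal premises post for t3 s4
                  apply (rule runs_mono)
                   apply (rule fin)
                  subgoal using post b2 unfolding same_below_def by (simp add: f2)
                  subgoal using post l2 by (simp add: f2 I2)
                  subgoal using post by (simp add: f2)
                  subgoal using post by (simp add: f2)
                  subgoal for X
                    using narrowed_step(2)[OF _ ex A'_def B'_def False] post I2
                    by (simp add: f2 S I2)
                  subgoal premises fin for t4 s5
                  proof -
                    have "nmem s4 LEN d \<le> n - ?m"
                      using post l2 by (simp add: f2 I2)
                    from rec[OF this] have "t1 + t2 + t3 + t4 + 6 \<le> 300 * n + 4"
                      using post fin t1 t2 by (simp add: f2)
                    then show ?thesis using fin unfolding search_post_def by (simp add: Let_def defs)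
                  qed
                  done
                done
            qed
          qed
          done
      qed
      done
  qed
qed

section \<open>Optimality by prices\<close>

text \<open>Each \<open>x i\<close> minimizes \<open>F i z - c * z\<close> over the points of
  \<open>D\<close> between the bounds, so \<open>c\<close> is a Lagrange multiplier of the sum
  constraint: summed over \<open>J\<close>, the inequalities make \<open>x\<close> optimal among all
  points with its own total.\<close>

definition priced ::
  "real set \<Rightarrow> (nat \<Rightarrow> real \<Rightarrow> real) \<Rightarrow> (nat \<Rightarrow> real) \<Rightarrow> (nat \<Rightarrow> real) \<Rightarrow> nat set \<Rightarrow> (nat \<Rightarrow> real) \<Rightarrow> real \<Rightarrow> bool"
  where
  "priced D F l u J x c \<longleftrightarrow> (\<forall>i\<in>J. x i \<in> D \<and> l i \<le> x i \<and> x i \<le> u i \<and>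
     (\<forall>z\<in>D. l i \<le> z \<longrightarrow> z \<le> u i \<longrightarrow> c * (z - x i) \<le> F i z - F i (x i)))"

lemma pricedD:
  assumes "priced D F l u J x c" "i \<in> J"
  shows "x i \<in> D" "l i \<le> x i" "x i \<le> u i"
    and "z \<in> D \<Longrightarrow> l i \<le> z \<Longrightarrow> z \<le> u i \<Longrightarrow> c * (z - x i) \<le> F i z - F i (x i)"
  using assms unfolding priced_def by blast+

lemma priced_narrow:
  assumes "priced D F l u J x c"
    and "\<And>i. i \<in> J \<Longrightarrow> x' i = x i \<and> l i \<le> l' i \<and> l' i \<le> x i \<and> x i \<le> u' i \<and> u' i \<le> u i"
  shows "priced D F l' u' J x' c"
  unfolding priced_def
proof (intro ballI conjI impI)
  fix i assume i: "i \<in> J"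
  note 1 = pricedD[OF assms(1) i] and 2 = assms(2)[OF i]
  show "x' i \<in> D" "l' i \<le> x' i" "x' i \<le> u' i" using 1(1) 2 by auto
  fix z assume "z \<in> D" "l' i \<le> z" "z \<le> u' i"
  with 2 1(4)[of z] show "c * (z - x' i) \<le> F i z - F i (x' i)" by simp
qed

text \<open>Two inequalities at the same price telescope: one from \<open>z\<close> to the nearer
  end of the window, one from that end to \<open>x i\<close>.\<close>

lemma priced_widen:
  assumes x: "priced D F p q J x c"
    and pq: "\<And>i. i \<in> J \<Longrightarrow> l i \<le> p i \<and> q i \<le> u i"
    and below: "\<And>i z. i \<in> J \<Longrightarrow> z \<in> D \<Longrightarrow> l i \<le> z \<Longrightarrow> z < p i \<Longrightarrow>
      p i \<in> D \<and> c * (z - p i) \<le> F i z - F i (p i)"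
    and above: "\<And>i z. i \<in> J \<Longrightarrow> z \<in> D \<Longrightarrow> z \<le> u i \<Longrightarrow> q i < z \<Longrightarrow>
      q i \<in> D \<and> c * (z - q i) \<le> F i z - F i (q i)"
  shows "priced D F l u J x c"
  unfolding priced_def
proof (intro ballI conjI impI)
  fix i assume i: "i \<in> J"
  note xi = pricedD[OF x i] and pqi = pq[OF i]
  show "x i \<in> D" "l i \<le> x i" "x i \<le> u i" using xi pqi by auto
  fix z assume z: "z \<in> D" "l i \<le> z" "z \<le> u i"
  consider "z < p i" | "q i < z" | "p i \<le> z" "z \<le> q i" by linarith
  then show "c * (z - x i) \<le> F i z - F i (x i)"
  proof cases
    case 1
    with below[OF i z(1,2) 1] xi(4)[of "p i"] xi(2,3) pqi show ?thesis
      by (simp add: algebra_simps)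
  next
    case 2
    with above[OF i z(1,3) 2] xi(4)[of "q i"] xi(2,3) pqi show ?thesis
      by (simp add: algebra_simps)
  next
    case 3
    with xi z show ?thesis by blast
  qed
qed

text \<open>Adding the two price inequalities shows that a minimizer cannot grow when the price
  drops. Here \<open>x\<close> has become the lower bound, so it cannot shrink either.\<close>

lemma priced_stuck:
  assumes "priced D F l u J x c" "priced D F x u J x' c'" "c' < c" "i \<in> J"
  shows "x' i = x i"
proof -
  note 1 = pricedD[OF assms(1,4)] and 2 = pricedD[OF assms(2,4)]
  have "c * (x' i - x i) \<le> F i (x' i) - F i (x i)" by (rule 1(4)) (use 1(1-3) 2(1-3) in simp_all)
  moreover have "c' * (x i - x' i) \<le> F i (x i) - F i (x' i)" by (rule 2(4)) (use 1(1-3) 2(1-3) in simp_all)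
  ultimately have "(c - c') * (x' i - x i) \<le> 0" by (simp add: algebra_simps)
  then have "x' i \<le> x i" using \<open>c' < c\<close> by (simp add: mult_le_0_iff)
  then show ?thesis using 2 by simp
qed

lemma priced_stuck_upper:
  assumes "priced D F l u J x c" "priced D F l x J x' c'" "c < c'" "i \<in> J"
  shows "x' i = x i"
proof -
  note 1 = pricedD[OF assms(1,4)] and 2 = pricedD[OF assms(2,4)]
  have "c * (x' i - x i) \<le> F i (x' i) - F i (x i)" by (rule 1(4)) (use 1(1-3) 2(1-3) in simp_all)
  moreover have "c' * (x i - x' i) \<le> F i (x i) - F i (x' i)" by (rule 2(4)) (use 1(1-3) 2(1-3) in simp_all)
  ultimately have "0 \<le> (c' - c) * (x' i - x i)" by (simp add: algebra_simps)
  then have "x i \<le> x' i" using \<open>c < c'\<close> by (simp add: zero_le_mult_iff)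
  then show ?thesis using 2 by simp
qed

text \<open>
  Depending on where the outer price \<open>c\<close> lies relative to the prices of the two extreme totals,
  the block is priced at \<open>cL\<close>, \<open>c\<close> or \<open>cU\<close>. In the outer cases its total is extreme, so that the
  difference of the prices has a sign.
\<close>
lemma priced_block:
  assumes xL: "priced D F l u J xL cL" and xU: "priced D F xL u J xU cU"
    and x: "priced D F xL xU J x c"
    and z: "\<And>i. i \<in> J \<Longrightarrow> z i \<in> D \<and> l i \<le> z i \<and> z i \<le> u i"
    and sums: "sum xL J \<le> sum z J" "sum z J \<le> sum xU J"
  shows "c * (sum z J - sum x J) \<le> (\<Sum>i\<in>J. F i (z i)) - (\<Sum>i\<in>J. F i (x i))"
proof -
  have gap: "c' * (sum z J - sum x' J) \<le> (\<Sum>i\<in>J. F i (z i)) - (\<Sum>i\<in>J. F i (x' i))"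
    if "priced D F l u J x' c'" for x' c'
    unfolding sum_subtractf[symmetric] sum_distrib_left
    by (intro sum_mono) (use pricedD(4)[OF that] z in blast)
  \<comment> \<open>The two prices may be taken as ordered. If the price for the largest total were
    below the one for the smallest, raising would have moved nothing, and \<open>cL\<close> prices
    \<open>xU\<close> as well.\<close>
  have xU': "\<exists>c'\<ge>cL. priced D F l u J xU c' \<and> priced D F xL u J xU c'"
  proof (cases "cL \<le> cU")
    case True
    have "priced D F l u J xU cU"
    proof (rule priced_widen[OF xU])
      fix i z assume i: "i \<in> J" and z: "z \<in> D" "l i \<le> z" "z < xL i"
      then have "cU * (z - xL i) \<le> cL * (z - xL i)" using True by (simp add: mult_le_cancel_right)
      moreover have "z \<le> u i" using pricedD[OF xL i] z by simp
      note pricedD(4)[OF xL i z(1,2) this]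
      ultimately show "xL i \<in> D \<and> cU * (z - xL i) \<le> F i z - F i (xL i)"
        using pricedD(1)[OF xL i] by linarith
    qed (use pricedD(2)[OF xL] in auto)
    with True xU show ?thesis by blast
  next
    case False
    then have "xU i = xL i" if "i \<in> J" for i using priced_stuck[OF xL xU] that by simp
    then have "priced D F l u J xU cL \<and> priced D F xL u J xU cL"
      using pricedD(2,3)[OF xL] by (intro conjI priced_narrow[OF xL]) auto
    then show ?thesis by blast
  qed
  then obtain cU' where c': "cL \<le> cU'" "priced D F l u J xU cU'" "priced D F xL u J xU cU'" by blast
  consider "c < cL" | "cU' < c" | "cL \<le> c" "c \<le> cU'" by linarith
  then show ?thesis
  proof cases
    case 1
    have "\<And>i. i \<in> J \<Longrightarrow> x i = xL i"
    proof (rule priced_stuck[OF _ x 1])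
      show "priced D F l xU J xL cL"
        by (rule priced_narrow[OF xL]) (use pricedD(2,3)[OF xL] pricedD(2,3)[OF xU] in force)
    qed
    then have eq: "sum x J = sum xL J" "(\<Sum>i\<in>J. F i (x i)) = (\<Sum>i\<in>J. F i (xL i))"
      by (simp_all cong: sum.cong)
    have "c * (sum z J - sum xL J) \<le> cL * (sum z J - sum xL J)"
      using 1 sums by (intro mult_right_mono) auto
    then show ?thesis unfolding eq using gap[OF xL] by linarith
  next
    case 2
    have "\<And>i. i \<in> J \<Longrightarrow> x i = xU i"
      by (rule priced_stuck_upper[OF c'(3) x 2])
    then have eq: "sum x J = sum xU J" "(\<Sum>i\<in>J. F i (x i)) = (\<Sum>i\<in>J. F i (xU i))"
      by (simp_all cong: sum.cong)
    have "c * (sum z J - sum xU J) \<le> cU' * (sum z J - sum xU J)"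
      using 2 sums by (intro mult_right_mono_neg) auto
    then show ?thesis unfolding eq using gap[OF c'(2)] by linarith
  next
    case 3
    have "priced D F l u J x c"
    proof (rule priced_widen[OF x])
      fix i z assume i: "i \<in> J" and z: "z \<in> D" "l i \<le> z" "z < xL i"
      then have "c * (z - xL i) \<le> cL * (z - xL i)" using 3 by (simp add: mult_le_cancel_right)
      moreover have "z \<le> u i" using pricedD[OF xL i] z by simp
      note pricedD(4)[OF xL i z(1,2) this]
      ultimately show "xL i \<in> D \<and> c * (z - xL i) \<le> F i z - F i (xL i)"
        using pricedD(1)[OF xL i] by linarith
    next
      fix i z assume i: "i \<in> J" and z: "z \<in> D" "z \<le> u i" "xU i < z"
      then have "c * (z - xU i) \<le> cU' * (z - xU i)" using 3 by (simp add: mult_le_cancel_right)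
      moreover have "l i \<le> z" using pricedD[OF c'(2) i] z by simp
      note pricedD(4)[OF c'(2) i z(1) this z(2)]
      ultimately show "xU i \<in> D \<and> c * (z - xU i) \<le> F i z - F i (xU i)"
        using pricedD(1)[OF xU i] by linarith
    qed (use pricedD(2,3)[OF xL] pricedD(2,3)[OF xU] in force)
    then show ?thesis by (rule gap)
  qed
qed


section \<open>Prices from subgradients\<close>

text \<open>The witness is the right derivative at \<open>y\<close>, written as the infimum of the
  difference quotients to the right of \<open>y\<close>.\<close>

lemma subgradient_exists:
  fixes f :: "real \<Rightarrow> real"
  assumes "convex_on UNIV f"
  obtains g where "\<And>z. g * (z - y) \<le> f z - f y"
proof -
  have "f y + Inf ((\<lambda>t. (f y - f t) / (y - t)) ` ({y<..} \<inter> UNIV)) * (z - y) \<le> f z" for z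
    by (rule convex_le_Inf_differential[OF assms]) auto
  then show thesis
    by (intro that[of "Inf ((\<lambda>t. (f y - f t) / (y - t)) ` ({y<..} \<inter> UNIV))"]) (simp add: le_diff_eq add.commute)
qed

text \<open>Subgradients are monotone: one taken at \<open>w\<close>, to the right of
  \<open>y\<close>, is at least \<open>g\<close>, and moving right from \<open>w\<close> costs at
  least its slope.\<close>

lemma subgradient_above:
  fixes f :: "real \<Rightarrow> real"
  assumes f: "convex_on UNIV f" and g: "\<And>z. g * (z - y) \<le> f z - f y" and "y \<le> w" "w \<le> v"
  shows "g * (v - w) \<le> f v - f w"
proof (cases "w = y")
  case False
  obtain h where h: "\<And>z. h * (z - w) \<le> f z - f w" using subgradient_exists[OF f] by blast
  have "0 \<le> (h - g) * (w - y)" using g[of w] h[of y] by (simp add: algebra_simps)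
  then have "g \<le> h" using False \<open>y \<le> w\<close> by (simp add: zero_le_mult_iff)
  then have "g * (v - w) \<le> h * (v - w)" using \<open>w \<le> v\<close> by (intro mult_right_mono) auto
  with h[of v] show ?thesis by linarith
qed (use g in simp)

lemma subgradient_below:
  fixes f :: "real \<Rightarrow> real"
  assumes f: "convex_on UNIV f" and g: "\<And>z. g * (z - y) \<le> f z - f y" and "w \<le> y" "v \<le> w"
  shows "g * (v - w) \<le> f v - f w"
proof (cases "w = y")
  case False
  obtain h where h: "\<And>z. h * (z - w) \<le> f z - f w" using subgradient_exists[OF f] by blast
  have "(h - g) * (y - w) \<le> 0" using g[of w] h[of y] by (simp add: algebra_simps)
  then have "h \<le> g" using False \<open>w \<le> y\<close> by (simp add: mult_le_0_iff)
  then have "g * (v - w) \<le> h * (v - w)" using \<open>v \<le> w\<close> by (intro mult_right_mono_neg) auto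
  with h[of v] show ?thesis by linarith
qed (use g in simp)

section \<open>Activity costs at a common level, over the reals and over the integers\<close>

definition cost :: "(real \<Rightarrow> real) \<Rightarrow> (nat \<Rightarrow> real) \<Rightarrow> (nat \<Rightarrow> real) \<Rightarrow> nat \<Rightarrow> real \<Rightarrow> real" where
  "cost f a b i x = a i * f (x / a i + b i)"

text \<open>The factor \<open>a i\<close> outside cancels the division inside, so the slope of the
  cost at \<open>x\<close> is the slope of \<open>f\<close> at \<open>x / a i + b i\<close>.
  Therefore one level \<open>y\<close> shared by all activities yields one price for all of
  them.\<close>

lemma cost_above:
  assumes f: "convex_on UNIV f" and g: "\<And>z. g * (z - y) \<le> f z - f y"
    and "0 < a i" "a i * (y - b i) \<le> x" "x \<le> z"
  shows "g * (z - x) \<le> cost f a b i z - cost f a b i x"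
proof -
  have "y \<le> x / a i + b i" "x / a i + b i \<le> z / a i + b i" using assms by (auto simp: field_simps)
  from subgradient_above[OF f g this] have "a i * (g * (z / a i - x / a i)) \<le> a i * (f (z / a i + b i) - f (x / a i + b i))"
    using \<open>0 < a i\<close> by (intro mult_left_mono) auto
  moreover have "a i * (g * (z / a i - x / a i)) = g * (z - x)"
    using \<open>0 < a i\<close> by (simp add: field_simps)
  ultimately show ?thesis by (simp add: cost_def right_diff_distrib)
qed

lemma cost_below:
  assumes f: "convex_on UNIV f" and g: "\<And>z. g * (z - y) \<le> f z - f y"
    and "0 < a i" "x \<le> a i * (y - b i)" "z \<le> x"
  shows "g * (z - x) \<le> cost f a b i z - cost f a b i x"
proof -
  have "x / a i + b i \<le> y" "z / a i + b i \<le> x / a i + b i" using assms by (auto simp: field_simps)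
  from subgradient_below[OF f g this] have "a i * (g * (z / a i - x / a i)) \<le> a i * (f (z / a i + b i) - f (x / a i + b i))"
    using \<open>0 < a i\<close> by (intro mult_left_mono) auto
  moreover have "a i * (g * (z / a i - x / a i)) = g * (z - x)"
    using \<open>0 < a i\<close> by (simp add: field_simps)
  ultimately show ?thesis by (simp add: cost_def right_diff_distrib)
qed

definition clip :: "real \<Rightarrow> real \<Rightarrow> real \<Rightarrow> real" where
  "clip l u x = (if x < l then l else if u < x then u else x)"

lemma clip_bounds: "l \<le> u \<Longrightarrow> l \<le> clip l u x" "l \<le> u \<Longrightarrow> clip l u x \<le> u"
  by (auto simp: clip_def)

lemma priced_clip:
  assumes f: "convex_on UNIV f" and J: "\<And>i. i \<in> J \<Longrightarrow> 0 < a i \<and> l i \<le> u i"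
    and x: "\<And>i. i \<in> J \<Longrightarrow> x i = clip (l i) (u i) (a i * (y - b i))"
  shows "\<exists>c. priced UNIV (cost f a b) l u J x c"
proof -
  obtain g where g: "\<And>z. g * (z - y) \<le> f z - f y" using subgradient_exists[OF f] by blast
  have "g * (z - x i) \<le> cost f a b i z - cost f a b i (x i)" if i: "i \<in> J" and z: "l i \<le> z" "z \<le> u i" for i z
  proof -
    note 1 = J[OF i] x[OF i]
    \<comment> \<open>If the unclipped point lies strictly beyond \<open>x i\<close>, then
      \<open>x i\<close> is the bound on that side, and \<open>z\<close> can differ from it only in
      the opposite direction.\<close>
    consider "a i * (y - b i) \<le> x i" "x i \<le> z" | "x i \<le> a i * (y - b i)" "z \<le> x i"
      using 1 z unfolding clip_def by (cases "x i \<le> z") (auto split: if_splits)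
    then show ?thesis
      using cost_above[OF f g] cost_below[OF f g] 1(1) by cases blast+
  qed
  then have "priced UNIV (cost f a b) l u J x g"
    using J x clip_bounds unfolding priced_def by simp
  then show ?thesis ..
qed

text \<open>A subgradient of \<open>f\<close> at the level of \<open>v + 1\<close> separates the two
  unit increments, of which one ends there and the other starts there or later.\<close>

lemma slope_mono:
  assumes f: "convex_on UNIV f" and "0 < a i" "v + 1 \<le> w"
  shows "cost f a b i (v + 1) - cost f a b i v \<le> cost f a b i (w + 1) - cost f a b i w"
proof -
  define y where "y = (v + 1) / a i + b i"
  have y: "a i * (y - b i) = v + 1" using \<open>0 < a i\<close> by (simp add: y_def)
  obtain g where g: "\<And>z. g * (z - y) \<le> f z - f y" using subgradient_exists[OF f] by blast
  show ?thesis using cost_above[OF f g, where a = a and i = i and b = b and x = w and z = "w + 1"] cost_below[OF f g, where a = a and i = i and b = b and x = "v + 1" and z = v] assms(2,3) y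
    by simp
qed

text \<open>Over the integers the cost difference between \<open>z\<close> and \<open>x i\<close>
  telescopes into unit increments, each of which is compared with \<open>c\<close>.\<close>

lemma priced_units:
  assumes J: "\<And>i. i \<in> J \<Longrightarrow> p i \<in> \<int> \<and> x i \<in> \<int> \<and> p i \<le> x i \<and> x i \<le> q i"
    and lo: "\<And>i v. i \<in> J \<Longrightarrow> v \<in> \<int> \<Longrightarrow> p i \<le> v \<Longrightarrow> v < x i \<Longrightarrow> F i (v + 1) - F i v \<le> c"
    and hi: "\<And>i v. i \<in> J \<Longrightarrow> v \<in> \<int> \<Longrightarrow> x i \<le> v \<Longrightarrow> v < q i \<Longrightarrow> c \<le> F i (v + 1) - F i v"
  shows "priced \<int> F p q J x c"
  unfolding priced_def
proof (intro ballI conjI impI)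
  fix i assume i: "i \<in> J"
  show "x i \<in> \<int>" "p i \<le> x i" "x i \<le> q i" using J[OF i] by auto
  have up: "x i + real n \<le> q i \<Longrightarrow> c * real n \<le> F i (x i + real n) - F i (x i)" for n
  proof (induction n)
    case (Suc n)
    then show ?case using hi[OF i, of "x i + real n"] J[OF i] by (simp add: algebra_simps)
  qed simp
  have down: "p i \<le> x i - real n \<Longrightarrow> F i (x i) - F i (x i - real n) \<le> c * real n" for n
  proof (induction n)
    case (Suc n)
    then show ?case using lo[OF i, of "x i - real n - 1"] J[OF i] by (simp add: algebra_simps)
  qed simp
  fix z assume z: "z \<in> \<int>" "p i \<le> z" "z \<le> q i"
  have "z - x i \<in> \<int>" using z J[OF i] by simp
  then obtain k where k: "z - x i = of_int k" by (auto elim: Ints_cases)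
  show "c * (z - x i) \<le> F i z - F i (x i)"
  proof (cases "k \<ge> 0")
    case True
    then have "z = x i + real (nat k)" using k by simp
    then show ?thesis using up[of "nat k"] z by simp
  next
    case False
    then have "z = x i - real (nat (- k))" using k by simp
    then show ?thesis using down[of "nat (- k)"] z by simp
  qed
qed

lemma sum_zero_nonneg:
  fixes h :: "'a \<Rightarrow> real"
  assumes "finite J" "J \<noteq> {}" "sum h J = 0"
  shows "\<exists>k\<in>J. 0 \<le> h k"
proof (rule ccontr)
  assume "\<not> ?thesis"
  then have "sum h J < (\<Sum>k\<in>J. 0)" using assms by (intro sum_strict_mono) auto
  with assms show False by simp
qed

text \<open>
  The window between the roundings at the levels of the totals \<open>T - card J\<close> and \<open>T + card J\<close>
  loses nothing: some coordinate of \<open>x\<close> exceeds its value at the lower level by at least one, and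
  the last unit of it compares the price \<open>c\<close> with the subgradient at that level.
\<close>
lemma priced_window:
  fixes l u a b x :: "nat \<Rightarrow> real"
  assumes f: "convex_on UNIV f" and fin: "finite J"
    and J: "\<And>i. i \<in> J \<Longrightarrow> 0 < a i \<and> l i \<in> \<int> \<and> u i \<in> \<int> \<and> l i \<le> u i"
    and p: "\<And>i. i \<in> J \<Longrightarrow> p i = of_int \<lfloor>clip (l i) (u i) (a i * (y1 - b i))\<rfloor>"
    and q: "\<And>i. i \<in> J \<Longrightarrow> q i = of_int \<lceil>clip (l i) (u i) (a i * (y2 - b i))\<rceil>"
    and sums: "(\<Sum>i\<in>J. clip (l i) (u i) (a i * (y1 - b i))) = max (sum l J) (sum x J - card J)"
      "(\<Sum>i\<in>J. clip (l i) (u i) (a i * (y2 - b i))) = min (sum u J) (sum x J + card J)"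
    and x: "priced \<int> (cost f a b) p q J x c"
  shows "priced \<int> (cost f a b) l u J x c"
proof -
  let ?c1 = "\<lambda>i. clip (l i) (u i) (a i * (y1 - b i))" and ?c2 = "\<lambda>i. clip (l i) (u i) (a i * (y2 - b i))"
  have pq: "l i \<le> p i \<and> q i \<le> u i" if "i \<in> J" for i
    using J[OF that] clip_bounds[of "l i" "u i"] p[OF that] q[OF that]
    by (auto elim!: Ints_cases simp: le_floor_iff ceiling_le_iff)
  have x1: "p i \<le> x i" "x i \<le> q i" "x i \<in> \<int>" if "i \<in> J" for i using pricedD[OF x that] by auto
  show ?thesis
  proof (rule priced_widen[OF x])
    show "l i \<le> p i \<and> q i \<le> u i" if "i \<in> J" for i using pq[OF that] .
  next
    fix i z assume i: "i \<in> J" and z: "z \<in> \<int>" "l i \<le> z" "z < p i"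
    have pc: "p i \<le> ?c1 i" using p[OF i] by simp
    have ne: "?c1 i \<noteq> l i" using z pc by auto
    \<comment> \<open>The lower level is above \<open>l\<close> at \<open>i\<close>, so its total
      has not been truncated at \<open>sum l J\<close> and is exactly \<open>card J\<close> below
      that of \<open>x\<close>.\<close>
    have "sum l J < sum ?c1 J"
      by (rule sum_strict_mono_ex1[OF fin])
        (use ne clip_bounds(1) J i in \<open>auto simp: order_less_le intro!: bexI[of _ i]\<close>)
    then have "sum ?c1 J = sum x J - card J" using sums by linarith
    then have z0: "(\<Sum>k\<in>J. x k - ?c1 k - 1) = 0" by (simp add: sum_subtractf)
    obtain k where k: "k \<in> J" "0 \<le> x k - ?c1 k - 1"
      using sum_zero_nonneg[OF fin _ z0] i by blast
    obtain g where g: "\<And>z. g * (z - y1) \<le> f z - f y1" using subgradient_exists[OF f] by blast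
    have "x k \<le> u k" using x1[OF k(1)] pq[OF k(1)] by linarith
    then have "a k * (y1 - b k) \<le> x k - 1" using k(2) by (auto simp: clip_def split: if_splits)
    then have "g * 1 \<le> cost f a b k (x k) - cost f a b k (x k - 1)"
      using cost_above[OF f g, where a = a and i = k and b = b and x = "x k - 1" and z = "x k"] J[OF k(1)] by simp
    moreover have "c * (x k - 1 - x k) \<le> cost f a b k (x k - 1) - cost f a b k (x k)"
      using x1[OF k(1)] k(2) p[OF k(1)] by (intro pricedD(4)[OF x k(1)]) (auto, linarith)
    ultimately have "g \<le> c" by simp
    then have "c * (z - p i) \<le> g * (z - p i)" using z by (intro mult_right_mono_neg) auto
    moreover have "p i \<le> a i * (y1 - b i)" using ne pc by (auto simp: clip_def split: if_splits)
    ultimately show "p i \<in> \<int> \<and> c * (z - p i) \<le> cost f a b i z - cost f a b i (p i)"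
      using J[OF i] z p[OF i] by (intro conjI order.trans[OF _ cost_below[OF f g]]) simp_all
  next
    fix i z assume i: "i \<in> J" and z: "z \<in> \<int>" "z \<le> u i" "q i < z"
    have qc: "?c2 i \<le> q i" using q[OF i] by simp
    have ne: "?c2 i \<noteq> u i" using z qc by auto
    \<comment> \<open>Likewise the upper total has not been truncated at
      \<open>sum u J\<close>.\<close>
    have "sum ?c2 J < sum u J"
      by (rule sum_strict_mono_ex1[OF fin])
        (use ne clip_bounds(2) J i in \<open>auto simp: order_less_le intro!: bexI[of _ i]\<close>)
    then have "sum ?c2 J = sum x J + card J" using sums by linarith
    then have z0: "(\<Sum>k\<in>J. ?c2 k - x k - 1) = 0" by (simp add: sum_subtractf)
    obtain k where k: "k \<in> J" "0 \<le> ?c2 k - x k - 1"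
      using sum_zero_nonneg[OF fin _ z0] i by blast
    obtain g where g: "\<And>z. g * (z - y2) \<le> f z - f y2" using subgradient_exists[OF f] by blast
    have "l k \<le> x k" using x1[OF k(1)] pq[OF k(1)] by linarith
    then have "x k + 1 \<le> a k * (y2 - b k)" using k(2) by (auto simp: clip_def split: if_splits)
    then have "g * (x k - (x k + 1)) \<le> cost f a b k (x k) - cost f a b k (x k + 1)"
      using J[OF k(1)] by (intro cost_below[OF f g]) simp_all
    moreover have "c * (x k + 1 - x k) \<le> cost f a b k (x k + 1) - cost f a b k (x k)"
      using x1[OF k(1)] k(2) q[OF k(1)] by (intro pricedD(4)[OF x k(1)]) (auto, linarith)
    ultimately have "c \<le> g" by simp
    then have "c * (z - q i) \<le> g * (z - q i)" using z by (intro mult_right_mono) auto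
    moreover have "a i * (y2 - b i) \<le> q i" using ne qc by (auto simp: clip_def split: if_splits)
    ultimately show "q i \<in> \<int> \<and> c * (z - q i) \<le> cost f a b i z - cost f a b i (q i)"
      using J[OF i] z q[OF i] by (intro conjI order.trans[OF _ cost_above[OF f g]]) simp_all
  qed
qed

section \<open>Loops over linked lists of activities\<close>

lemma runs_While_unfold:
  "runs pr ps (While b c) s Q \<longleftrightarrow>
     (if bval pr s b then runs pr ps c s (\<lambda>t s'. runs pr ps (While b c) s' (\<lambda>t'. Q (t + t' + 1)))
      else Q 1 s)"
  unfolding runs_def
  by (cases "bval pr s b") (metis exec.WhileTrue exec.WhileFalse WhileE Suc_eq_plus1)+

fun chain :: "(nat \<Rightarrow> nat) \<Rightarrow> nat \<Rightarrow> nat list \<Rightarrow> bool" where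
  "chain nx p [] \<longleftrightarrow> p = 0"
| "chain nx p (i # xs) \<longleftrightarrow> p = i \<and> i \<noteq> 0 \<and> chain nx (nx i) xs"

abbreviation "ptr \<equiv> ncell PTR"

definition foreach :: "com \<Rightarrow> com" where
  "foreach c = nset PTR (ncell STAGE);;
     While (NLess (NConst 0) ptr) (c;; nset PTR (NGet NEXT ptr))"

text \<open>The invariant is indexed by the visited prefix, and the list itself drives the induction
  in place of a measure. Each iteration adds 2 steps for the loop test and the pointer update; the
  final 2 are the initial assignment and the last test.\<close>

lemma runs_foreach:
  assumes ch: "chain (nmem s NEXT) (nmem s STAGE 0) xs"
    and ps: "\<forall>p\<in>set ps. nwrites W p \<subseteq> W" and c: "PTR \<notin> nwrites W c" "NEXT \<notin> nwrites W c"
    and init: "J [] 0 (nupd PTR 0 (nmem s STAGE 0) s)"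
    and step: "\<And>ys i zs t s'. xs = ys @ i # zs \<Longrightarrow> J ys t s' \<Longrightarrow> nmem s' PTR 0 = i \<Longrightarrow>
      runs pr ps c s' (\<lambda>t' s''. J (ys @ [i]) (t + t' + 2) (nupd PTR 0 (nmem s NEXT i) s''))"
    and exit: "\<And>t s'. J xs t s' \<Longrightarrow> Q (t + 2) s'"
  shows "runs pr ps (foreach c) s Q"
proof -
  let ?w = "While (NLess (NConst 0) ptr) (c;; nset PTR (NGet NEXT ptr))"
  have "runs pr ps ?w s' (\<lambda>t'. Q (t + t' + 1))"
    if "xs = ys @ zs" "J ys t s'" "chain (nmem s NEXT) (nmem s' PTR 0) zs" "nmem s' NEXT = nmem s NEXT"
    for ys zs t s'
    using that
  proof (induction zs arbitrary: ys t s')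
    case Nil
    then show ?case using exit by (subst runs_While_unfold) simp
  next
    case (Cons i zs)
    then have p: "nmem s' PTR 0 = i" "0 < i" by simp_all
    have "runs pr ps c s' (\<lambda>t' s''. J (ys @ [i]) (t + t' + 2) (nupd PTR 0 (nmem s NEXT i) s''))"
      using step Cons.prems p by blast
    then have "runs pr ps c s' (\<lambda>t' s''. J (ys @ [i]) (t + t' + 2) (nupd PTR 0 (nmem s NEXT i) s'') \<and>
      nmem s'' PTR = nmem s' PTR \<and> nmem s'' NEXT = nmem s' NEXT)"
      using exec_nmem_frame[OF _ ps c(1)] exec_nmem_frame[OF _ ps c(2)] unfolding runs_def by blast
    then show ?case
      apply (subst runs_While_unfold)
      apply (simp add: p runs_Seq runs_NSet)
      apply (erule runs_mono)
      subgoal for t' s''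
        using Cons.IH[of "ys @ [i]" "t + t' + 2" "nupd PTR 0 (nmem s NEXT i) s''"] Cons.prems p
        by (auto elim!: runs_mono simp: add_ac)
      done
  qed
  from this[OF _ init] ch show ?thesis
    by (auto simp: foreach_def runs_Seq runs_NSet)
qed

lemma rupd_rupd [simp]: "rupd k i v (rupd k i w s) = rupd k i v s"
  by (simp add: rupd_def)

lemma runs_assign:
  assumes ch: "chain (nmem s NEXT) (nmem s STAGE 0) xs"
    and c: "nwrites UNIV c = {}"
    and step: "\<And>i s'. i \<in> set xs \<Longrightarrow> nmem s' PTR 0 = i \<Longrightarrow> (\<And>j. j \<noteq> k \<Longrightarrow> rmem s' j = rmem s j) \<Longrightarrow>
      runs pr ps c s' (\<lambda>t s''. t \<le> C \<and> s'' = rupd k i (g i) s')"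
  shows "runs pr ps (foreach c) s (\<lambda>t s'. t \<le> (C + 2) * length xs + 2 \<and>
    (\<forall>j. j \<noteq> PTR \<longrightarrow> nmem s' j = nmem s j) \<and> (\<forall>j. j \<noteq> k \<longrightarrow> rmem s' j = rmem s j) \<and>
    rmem s' k = (\<lambda>i. if i \<in> set xs then g i else rmem s k i))"
proof -
  define J where "J = (\<lambda>ys (t::nat) (s'::state). t \<le> (C + 2) * length ys \<and>
    (\<forall>j. j \<noteq> PTR \<longrightarrow> nmem s' j = nmem s j) \<and> (\<forall>j. j \<noteq> k \<longrightarrow> rmem s' j = rmem s j) \<and>
    rmem s' k = (\<lambda>i. if i \<in> set ys then g i else rmem s k i))"
  show ?thesis
    apply (rule runs_foreach[where W = UNIV and J = J and xs = xs])
    subgoal by (rule ch)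
    subgoal by simp
    subgoal using c by simp
    subgoal using c by simp
    subgoal by (simp add: J_def)
    subgoal for ys i zs t s'
      apply (rule runs_mono[OF step[of i]])
      subgoal by simp
      subgoal by simp
      subgoal by (simp add: J_def)
      subgoal by (auto simp: J_def fun_eq_iff algebra_simps)
      done
    subgoal by (simp add: J_def)
    done
qed


section \<open>The level of a given total\<close>

abbreviation (input) "TOTAL \<equiv> 18 :: nat"
abbreviation (input) "TARGET \<equiv> 19 :: nat"

abbreviation "bp k \<equiv> RAdd (RDiv (RGet k ptr) (RGet SCALE ptr)) (RGet SHIFT ptr)"
abbreviation "off_exp k \<equiv> RAdd (RGet k ptr) (RMul (RGet SCALE ptr) (RGet SHIFT ptr))"

definition add_breakpoints :: com where
  "add_breakpoints =
     RSet KEY (ncell LEN) (bp LO);; RSet SLP (ncell LEN) (RGet SCALE ptr);;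
     RSet OFF (ncell LEN) (RSub (rconst 0) (off_exp LO));;
     nset LEN (NAdd (ncell LEN) (NConst 1));;
     RSet KEY (ncell LEN) (bp HI);; RSet SLP (ncell LEN) (RSub (rconst 0) (RGet SCALE ptr));;
     RSet OFF (ncell LEN) (off_exp HI);;
     nset LEN (NAdd (ncell LEN) (NConst 1));;
     rset GOAL (RSub (rcell GOAL) (RGet LO ptr))"

definition init_search :: com where
  "init_search =
     nset DEPTH (NConst 0);; nset LEN (NConst 0);; nset BASE (NConst 0);;
     rset GOAL (rcell TARGET);; rset SSLP (rconst 0);; rset SOFF (rconst 0);; rset RES (rconst 0)"

definition level :: com where
  "level = init_search;; foreach add_breakpoints;; Call 0"

text \<open>The line \<open>a i * (y - b i) - l i\<close> is switched on where it reaches 0 and is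
  completed to the constant \<open>u i - l i\<close> where the upper bound is reached. The sum is
  the clipped line minus \<open>l i\<close>, which is why the goal is reduced by the lower
  bounds.\<close>

definition breakpoints ::
  "(nat \<Rightarrow> real) \<Rightarrow> (nat \<Rightarrow> real) \<Rightarrow> (nat \<Rightarrow> real) \<Rightarrow> (nat \<Rightarrow> real) \<Rightarrow> nat \<Rightarrow> item list" where
  "breakpoints l u a b i =
     [(l i / a i + b i, a i, - (l i + a i * b i)), (u i / a i + b i, - a i, u i + a i * b i)]"

lemma val_append: "val_le (X @ Y) y = val_le X y + val_le Y y" "val_lt (X @ Y) y = val_lt X y + val_lt Y y"
  by (simp_all add: val_le_def val_lt_def)

text \<open>Each item vanishes at its own key, so switching it on causes no jump and both one-sided
  values agree.\<close>

lemma val_breakpoints: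
  assumes "0 < a i" "l i \<le> u i"
  shows "val_le (breakpoints l u a b i) y = clip (l i) (u i) (a i * (y - b i)) - l i"
    and "val_lt (breakpoints l u a b i) y = clip (l i) (u i) (a i * (y - b i)) - l i"
proof -
  have "l i / a i + b i \<le> y \<longleftrightarrow> l i \<le> a i * (y - b i)" "u i / a i + b i \<le> y \<longleftrightarrow> u i \<le> a i * (y - b i)"
    "l i / a i + b i < y \<longleftrightarrow> l i < a i * (y - b i)" "u i / a i + b i < y \<longleftrightarrow> u i < a i * (y - b i)"
    using assms(1) by (auto simp: field_simps)
  then show "val_le (breakpoints l u a b i) y = clip (l i) (u i) (a i * (y - b i)) - l i"
    "val_lt (breakpoints l u a b i) y = clip (l i) (u i) (a i * (y - b i)) - l i"
    using assms by (auto simp: val_le_def val_lt_def breakpoints_def clip_def algebra_simps)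
qed

text \<open>By continuity the two inequalities of a crossing collapse to an equation. Its premise
  holds because beyond all breakpoints every activity is at its upper bound.\<close>

lemma crossing_breakpoints:
  assumes c: "crossing (concat (map (breakpoints l u a b) xs)) (T - (\<Sum>i\<leftarrow>xs. l i)) y"
    and J: "\<And>i. i \<in> set xs \<Longrightarrow> 0 < a i \<and> l i \<le> u i" and T: "(\<Sum>i\<leftarrow>xs. l i) \<le> T" "T \<le> (\<Sum>i\<leftarrow>xs. u i)"
  shows "(\<Sum>i\<leftarrow>xs. clip (l i) (u i) (a i * (y - b i))) = T"
proof -
  let ?X = "concat (map (breakpoints l u a b) xs)" and ?c = "\<lambda>y i. clip (l i) (u i) (a i * (y - b i))"
  have v: "val_le ?X y = (\<Sum>i\<leftarrow>xs. ?c y i) - (\<Sum>i\<leftarrow>xs. l i)" "val_lt ?X y = (\<Sum>i\<leftarrow>xs. ?c y i) - (\<Sum>i\<leftarrow>xs. l i)" for y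
    using J by (induction xs) (simp_all add: val_append val_breakpoints, simp_all add: val_le_def val_lt_def)
  have "T - (\<Sum>i\<leftarrow>xs. l i) \<le> val_le ?X y" if y: "\<forall>x\<in>set ?X. key x \<le> y" for y
  proof -
    have "?c y i = u i" if i: "i \<in> set xs" for i
    proof -
      have "u i / a i + b i \<le> y" using y i by (auto simp: breakpoints_def)
      then have "u i \<le> a i * (y - b i)" using J[OF i] by (auto simp: field_simps)
      then show ?thesis using J[OF i] by (auto simp: clip_def)
    qed
    then have "(\<Sum>i\<leftarrow>xs. ?c y i) = (\<Sum>i\<leftarrow>xs. u i)" by (intro arg_cong[where f = sum_list] map_cong) auto
    then show ?thesis using T by (simp add: v)
  qed
  then have "val_lt ?X y \<le> T - (\<Sum>i\<leftarrow>xs. l i) \<and> T - (\<Sum>i\<leftarrow>xs. l i) \<le> val_le ?X y"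
    using c T unfolding crossing_def by auto
  then show ?thesis by (simp add: v)
qed

lemma items_push:
  assumes "nmem s BASE 0 = 0" "nmem s' BASE 0 = 0" "nmem s' LEN 0 = nmem s LEN 0 + length X"
    "\<And>i. i < nmem s LEN 0 \<Longrightarrow> item_at s' i = item_at s i"
    "\<And>i. i < length X \<Longrightarrow> item_at s' (nmem s LEN 0 + i) = X ! i"
  shows "items s' 0 = items s 0 @ X"
  by (rule nth_equalityI) (use assms in \<open>auto simp: items_def nth_append\<close>,
      metis add_diff_inverse_nat nat_add_left_cancel_less)

text \<open>The sets reproduce themselves as the effect of \<open>Call 0\<close>, as the frame rule
  demands of a recursive procedure.\<close>

lemma search_writes:
  "nwrites {DEPTH..SRC} search \<subseteq> {DEPTH..SRC}" "rwrites {KEY..TMP2} search \<subseteq> {KEY..TMP2}"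
  by (auto simp: search_def pivot_def medians_def evaluate_def retain_def med3_com_def)

lemma level_writes:
  "nwrites {DEPTH..SRC} level \<subseteq> {PTR..SRC}" "rwrites {KEY..TMP2} level \<subseteq> {KEY..TMP2}"
  by (auto simp: level_def init_search_def foreach_def add_breakpoints_def)

lemma runs_frame_search:
  assumes "runs pr [search] c s Q" and "nwrites {DEPTH..SRC} c \<subseteq> N" "rwrites {KEY..TMP2} c \<subseteq> R"
  shows "runs pr [search] c s (\<lambda>t s'. Q t s' \<and>
    (\<forall>k. k \<notin> N \<longrightarrow> nmem s' k = nmem s k) \<and> (\<forall>k. k \<notin> R \<longrightarrow> rmem s' k = rmem s k))"
proof -
  have "runs pr [search] c s (\<lambda>t s'. Q t s' \<and>
    (\<forall>k. k \<notin> nwrites {DEPTH..SRC} c \<longrightarrow> nmem s' k = nmem s k) \<and>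
    (\<forall>k. k \<notin> rwrites {KEY..TMP2} c \<longrightarrow> rmem s' k = rmem s k))"
    by (rule runs_frame[OF assms(1)]) (use search_writes in simp_all)
  then show ?thesis by (rule runs_mono) (use assms(2,3) in blast)
qed

lemma runs_search_init:
  assumes "nmem s DEPTH 0 = 0" "rmem s SSLP 0 = 0" "rmem s SOFF 0 = 0"
  shows "runs pr [search] (Call 0) s (\<lambda>t s'. t \<le> 300 * nmem s LEN 0 + 5 \<and>
    crossing (items s 0) (rmem s GOAL 0) (rmem s' RES 0) \<and>
    (\<forall>k. k \<notin> {DEPTH..SRC} \<longrightarrow> nmem s' k = nmem s k) \<and> (\<forall>k. k \<notin> {KEY..TMP2} \<longrightarrow> rmem s' k = rmem s k))"
proof -
  have "runs pr [search] (Call 0) s (\<lambda>t s'. t \<le> 300 * nmem s LEN 0 + 5 \<and>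
    crossing (items s 0) (rmem s GOAL 0) (rmem s' RES 0))"
    unfolding runs_Call
    by (simp, rule runs_mono[OF runs_search])
      (use narrowed_init[of "items s 0"] assms in \<open>auto simp: search_post_def Let_def\<close>)
  from runs_frame_search[OF this, of "{DEPTH..SRC}" "{KEY..TMP2}"] show ?thesis by (simp add: conj_assoc)
qed

text \<open>Every activity contributes two items, so 600 of the steps per activity belong to the
  search; nine assignments and two steps of loop overhead produce the items.\<close>

lemma runs_level:
  fixes s :: state
  assumes ch: "chain (nmem s NEXT) (nmem s STAGE 0) xs"
  defines "l \<equiv> rmem s LO" and "u \<equiv> rmem s HI" and "a \<equiv> rmem s SCALE" and "b \<equiv> rmem s SHIFT"
    and "T \<equiv> rmem s TARGET 0"
  shows "runs pr [search] level s (\<lambda>t s'. t \<le> 620 * length xs + 20 \<and>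
    ((\<forall>i\<in>set xs. 0 < a i \<and> l i \<le> u i) \<and> (\<Sum>i\<leftarrow>xs. l i) \<le> T \<and> T \<le> (\<Sum>i\<leftarrow>xs. u i) \<longrightarrow>
      (\<Sum>i\<leftarrow>xs. clip (l i) (u i) (a i * (rmem s' RES 0 - b i))) = T) \<and>
    (\<forall>k. k \<notin> {PTR..SRC} \<longrightarrow> nmem s' k = nmem s k) \<and> (\<forall>k. k \<notin> {KEY..TMP2} \<longrightarrow> rmem s' k = rmem s k))"
proof -
  define J where "J = (\<lambda>ys (t::nat) (s'::state). t \<le> 11 * length ys \<and> nmem s' LEN 0 = 2 * length ys \<and>
    nmem s' DEPTH 0 = 0 \<and> nmem s' BASE 0 = 0 \<and> items s' 0 = concat (map (breakpoints l u a b) ys) \<and>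
    rmem s' LO = l \<and> rmem s' HI = u \<and> rmem s' SCALE = a \<and> rmem s' SHIFT = b \<and>
    rmem s' GOAL 0 = T - (\<Sum>i\<leftarrow>ys. l i) \<and> rmem s' SSLP 0 = 0 \<and> rmem s' SOFF 0 = 0)"
  have "runs pr [search] level s (\<lambda>t s'. t \<le> 620 * length xs + 20 \<and>
    ((\<forall>i\<in>set xs. 0 < a i \<and> l i \<le> u i) \<and> (\<Sum>i\<leftarrow>xs. l i) \<le> T \<and> T \<le> (\<Sum>i\<leftarrow>xs. u i) \<longrightarrow>
      (\<Sum>i\<leftarrow>xs. clip (l i) (u i) (a i * (rmem s' RES 0 - b i))) = T))"
    unfolding level_def init_search_def
    apply (simp add: runs_simps)
    apply (rule runs_foreach[where W = UNIV and J = J and xs = xs])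
    subgoal using ch by simp
    subgoal by simp
    subgoal by (simp add: add_breakpoints_def)
    subgoal by (simp add: add_breakpoints_def)
    subgoal by (simp add: J_def items_def l_def u_def a_def b_def T_def)
    subgoal premises prems for ys i zs t s'
    proof -
      have J: "t \<le> 11 * length ys" "nmem s' LEN 0 = 2 * length ys"
        "nmem s' DEPTH 0 = 0" "nmem s' BASE 0 = 0" "items s' 0 = concat (map (breakpoints l u a b) ys)"
        "rmem s' LO = l" "rmem s' HI = u" "rmem s' SCALE = a" "rmem s' SHIFT = b"
        "rmem s' GOAL 0 = T - (\<Sum>i\<leftarrow>ys. l i)" "rmem s' SSLP 0 = 0" "rmem s' SOFF 0 = 0"
        using prems(2) by (simp_all add: J_def)
      show ?thesis
        unfolding add_breakpoints_def
        apply (simp add: runs_simps J prems(3))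
        apply (simp add: J_def J)
        apply (subst items_push[where s = s' and X = "breakpoints l u a b i"])
        by (auto simp: J item_at_def breakpoints_def less_Suc_eq)
    qed
    subgoal premises prems for t s'
      apply (rule runs_mono[OF runs_search_init])
      using prems crossing_breakpoints[of l u a b xs T] by (auto simp: J_def)
    done
  from runs_frame_search[OF this level_writes] show ?thesis by (simp add: conj_assoc)
qed

section \<open>The continuous stage\<close>

definition clip_com :: "nat \<Rightarrow> com" where
  "clip_com k = RSet k ptr (RMul (RGet SCALE ptr) (RSub (rcell RES) (RGet SHIFT ptr)));;
     Cond (RLess (RGet k ptr) (RGet LO ptr)) (RSet k ptr (RGet LO ptr))
       (Cond (RLess (RGet HI ptr) (RGet k ptr)) (RSet k ptr (RGet HI ptr)) Skip)"

lemma runs_clip_com: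
  assumes "k \<notin> {LO, HI, SCALE, SHIFT, RES}"
  shows "runs pr ps (clip_com k) s (\<lambda>t s'. t \<le> 4 \<and>
    s' = rupd k (nmem s PTR 0) (clip (rmem s LO (nmem s PTR 0)) (rmem s HI (nmem s PTR 0))
      (rmem s SCALE (nmem s PTR 0) * (rmem s RES 0 - rmem s SHIFT (nmem s PTR 0)))) s)"
  using assms by (auto simp: clip_com_def runs_simps clip_def)

definition domain_set :: "domain \<Rightarrow> real set" where
  "domain_set \<gamma> = (if \<gamma> = Integral then \<int> else UNIV)"

text \<open>A stage distributes the total in cell \<open>TOTAL\<close> over the activities of a linked list, subject to
  their bounds only.\<close>
definition solves_stage :: "domain \<Rightarrow> (real \<Rightarrow> real) \<Rightarrow> nat list \<Rightarrow> state \<Rightarrow> (nat \<Rightarrow> real) \<Rightarrow> bool" where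
  "solves_stage \<gamma> f xs s x \<longleftrightarrow>
     (\<forall>i\<in>set xs. rmem s LO i \<in> domain_set \<gamma> \<and> rmem s HI i \<in> domain_set \<gamma> \<and> rmem s LO i \<le> rmem s HI i) \<and>
     rmem s TOTAL 0 \<in> domain_set \<gamma> \<and>
     sum (rmem s LO) (set xs) \<le> rmem s TOTAL 0 \<and> rmem s TOTAL 0 \<le> sum (rmem s HI) (set xs) \<longrightarrow>
     sum x (set xs) = rmem s TOTAL 0 \<and>
     (\<exists>c. priced (domain_set \<gamma>) (cost f (rmem s SCALE) (rmem s SHIFT)) (rmem s LO) (rmem s HI) (set xs) x c)"

text \<open>The write sets protect what the surrounding program relies on: the list structure and
  counters lie below \<open>PTR\<close>, the instance data are real arrays below \<open>KEY\<close>
  other than \<open>SOL\<close>. The time bound holds even for inconsistent bounds or totals, so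
  that infeasible instances halt in time too.\<close>

definition correct_stage :: "domain \<Rightarrow> nat \<Rightarrow> com \<Rightarrow> bool" where
  "correct_stage \<gamma> C c \<longleftrightarrow>
     nwrites {DEPTH..SRC} c \<subseteq> {PTR..} \<and> rwrites {KEY..TMP2} c \<subseteq> insert SOL {KEY..} \<and>
     (\<forall>f s xs. convex_on UNIV f \<longrightarrow> chain (nmem s NEXT) (nmem s STAGE 0) xs \<longrightarrow> distinct xs \<longrightarrow>
       (\<forall>i\<in>set xs. 0 < rmem s SCALE i) \<longrightarrow>
       runs (primitives \<gamma> f) [search] c s (\<lambda>t s'. t \<le> C * (length xs + 1) \<and>
         solves_stage \<gamma> f xs s (rmem s' SOL)))"

definition continuous_stage :: com where
  "continuous_stage = rset TARGET (rcell TOTAL);; level;; foreach (clip_com SOL)"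

lemma continuous_stage_correct: "correct_stage Continuous 700 continuous_stage"
  unfolding correct_stage_def
proof (intro conjI allI impI)
  show "nwrites {DEPTH..SRC} continuous_stage \<subseteq> {PTR..}"
    "rwrites {KEY..TMP2} continuous_stage \<subseteq> insert SOL {KEY..}"
    using level_writes by (auto simp: continuous_stage_def foreach_def clip_com_def)
next
  fix f :: "real \<Rightarrow> real" and s :: state and xs
  assume f: "convex_on UNIV f" and ch: "chain (nmem s NEXT) (nmem s STAGE 0) xs" and d: "distinct xs"
    and pos: "\<forall>i\<in>set xs. 0 < rmem s SCALE i"
  show "runs (primitives Continuous f) [search] continuous_stage s (\<lambda>t s'. t \<le> 700 * (length xs + 1) \<and>
    solves_stage Continuous f xs s (rmem s' SOL))"
    unfolding continuous_stage_def
    apply (simp add: runs_simps)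
    apply (rule runs_mono[OF runs_level[where xs = xs]])
    subgoal using ch by simp
    subgoal premises lev for t1 s1
    proof -
      have f1: "nmem s1 NEXT = nmem s NEXT" "nmem s1 STAGE = nmem s STAGE" "rmem s1 LO = rmem s LO"
        "rmem s1 HI = rmem s HI" "rmem s1 SCALE = rmem s SCALE" "rmem s1 SHIFT = rmem s SHIFT"
        using lev by simp_all
      define y where "y = rmem s1 RES 0"
      let ?g = "\<lambda>i. clip (rmem s LO i) (rmem s HI i) (rmem s SCALE i * (y - rmem s SHIFT i))"
      show ?thesis
        apply (rule runs_mono)
         apply (rule runs_assign[where xs = xs and k = SOL and C = 4 and g = ?g])
        subgoal using ch by (simp add: f1)
        subgoal by (simp add: clip_com_def)
        subgoal for i s'
          by (rule runs_mono[OF runs_clip_com]) (auto simp: f1 y_def)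
        subgoal premises post for t2 s2
        proof -
          have t: "t1 \<le> 620 * length xs + 20" "t2 \<le> 6 * length xs + 2" using lev post by simp_all
          have sol: "rmem s2 SOL i = ?g i" if "i \<in> set xs" for i using post that by simp
          have "sum (rmem s2 SOL) (set xs) = rmem s TOTAL 0 \<and>
              (\<exists>c. priced UNIV (cost f (rmem s SCALE) (rmem s SHIFT)) (rmem s LO) (rmem s HI) (set xs) (rmem s2 SOL) c)"
            if "\<forall>i\<in>set xs. rmem s LO i \<le> rmem s HI i"
              "sum (rmem s LO) (set xs) \<le> rmem s TOTAL 0" "rmem s TOTAL 0 \<le> sum (rmem s HI) (set xs)"
          proof
            have "sum ?g (set xs) = rmem s TOTAL 0"
              using lev that pos by (simp add: sum.distinct_set_conv_list[OF d] y_def)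
            then show "sum (rmem s2 SOL) (set xs) = rmem s TOTAL 0" by (simp add: sol cong: sum.cong)
            show "\<exists>c. priced UNIV (cost f (rmem s SCALE) (rmem s SHIFT)) (rmem s LO) (rmem s HI) (set xs) (rmem s2 SOL) c"
              by (rule priced_clip[OF f _ sol]) (use pos that in auto)
          qed
          with t show ?thesis by (simp add: solves_stage_def domain_set_def)
        qed
        done
    qed
    done
qed

section \<open>The integral stage\<close>

lemma clip_mono: "x \<le> y \<Longrightarrow> l \<le> u \<Longrightarrow> clip l u x \<le> clip l u y"
  by (auto simp: clip_def)

text \<open>The levels themselves may be in the wrong order when clipping makes totals coincide. In
  that case all values are ordered the other way, and the comparison of totals forces equality in
  every term.\<close>

lemma clip_level_mono:
  assumes fin: "finite J" and J: "\<And>i. i \<in> J \<Longrightarrow> 0 < a i \<and> l i \<le> u i"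
    and le: "(\<Sum>i\<in>J. clip (l i) (u i) (a i * (y1 - b i))) \<le> (\<Sum>i\<in>J. clip (l i) (u i) (a i * (y2 - b i)))"
    and i: "i \<in> J"
  shows "clip (l i) (u i) (a i * (y1 - b i)) \<le> clip (l i) (u i) (a i * (y2 - b i))"
proof (cases "y1 \<le> y2")
  case True
  then show ?thesis using J[OF i] by (intro clip_mono) auto
next
  case False
  have ge: "clip (l i) (u i) (a i * (y2 - b i)) \<le> clip (l i) (u i) (a i * (y1 - b i))" if "i \<in> J" for i
    using False J[OF that] by (intro clip_mono) auto
  have "(\<Sum>i\<in>J. clip (l i) (u i) (a i * (y2 - b i))) = (\<Sum>i\<in>J. clip (l i) (u i) (a i * (y1 - b i)))"
  proof (rule antisym[OF _ le])
    show "(\<Sum>i\<in>J. clip (l i) (u i) (a i * (y2 - b i))) \<le> (\<Sum>i\<in>J. clip (l i) (u i) (a i * (y1 - b i)))"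
      by (rule sum_mono) (rule ge)
  qed
  from sum_mono_inv[OF this ge i fin] show ?thesis by simp
qed

text \<open>The totals at the two levels differ by at most \<open>2 * card J\<close>, and rounding
  down at one end and up at the other adds at most 2 per activity.\<close>

lemma window_sums:
  fixes l u a b :: "nat \<Rightarrow> real"
  assumes fin: "finite J" and J: "\<And>i. i \<in> J \<Longrightarrow> 0 < a i \<and> l i \<le> u i"
    and p: "\<And>i. i \<in> J \<Longrightarrow> p i = of_int \<lfloor>clip (l i) (u i) (a i * (y1 - b i))\<rfloor>"
    and q: "\<And>i. i \<in> J \<Longrightarrow> q i = of_int \<lceil>clip (l i) (u i) (a i * (y2 - b i))\<rceil>"
    and T: "sum l J \<le> T" "T \<le> sum u J"
    and sums: "(\<Sum>i\<in>J. clip (l i) (u i) (a i * (y1 - b i))) = max (sum l J) (T - card J)"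
      "(\<Sum>i\<in>J. clip (l i) (u i) (a i * (y2 - b i))) = min (sum u J) (T + card J)"
  shows "\<And>i. i \<in> J \<Longrightarrow> p i \<le> q i" "sum p J \<le> T" "T \<le> sum q J" "sum q J - sum p J \<le> 4 * card J"
proof -
  let ?c1 = "\<lambda>i. clip (l i) (u i) (a i * (y1 - b i))" and ?c2 = "\<lambda>i. clip (l i) (u i) (a i * (y2 - b i))"
  have c: "?c1 i \<le> ?c2 i" if "i \<in> J" for i
    by (rule clip_level_mono[OF fin J _ that]) (use sums T in auto)
  have pc: "p i \<le> ?c1 i" "?c1 i - 1 \<le> p i" and qc: "?c2 i \<le> q i" "q i \<le> ?c2 i + 1" if "i \<in> J" for i
    unfolding p[OF that] q[OF that] by linarith+
  show "p i \<le> q i" if "i \<in> J" for i using pc[OF that] qc[OF that] c[OF that] by linarith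
  show "sum p J \<le> T" using sum_mono[of J p ?c1, OF pc(1)] sums T by simp
  show "T \<le> sum q J" using sum_mono[of J ?c2 q, OF qc(1)] sums T by simp
  have "(\<Sum>i\<in>J. q i - p i) \<le> (\<Sum>i\<in>J. (?c2 i - ?c1 i) + 2)"
  proof (rule sum_mono)
    fix i assume "i \<in> J"
    from pc[OF this] qc[OF this] show "q i - p i \<le> (?c2 i - ?c1 i) + 2" by linarith
  qed
  also have "\<dots> = sum ?c2 J - sum ?c1 J + 2 * card J"
    by (simp add: sum.distrib sum_subtractf)
  finally show "sum q J - sum p J \<le> 4 * card J" using sums by (simp add: sum_subtractf)
qed

text \<open>
  The first pass takes units below the price \<open>c\<close>, the second one units at the price. By counting,
  neither stops early for lack of units left to distribute.
\<close>
lemma two_passes: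
  fixes \<sigma> :: "'a \<Rightarrow> nat \<Rightarrow> real" and m1 m2 w :: "'a \<Rightarrow> nat"
  assumes fin: "finite J"
    and mono: "\<And>i r r'. i \<in> J \<Longrightarrow> r \<le> r' \<Longrightarrow> \<sigma> i r \<le> \<sigma> i r'"
    and lt: "(\<Sum>i\<in>J. card {r. r < w i \<and> \<sigma> i r < c}) \<le> \<tau>"
    and le: "\<tau> \<le> (\<Sum>i\<in>J. card {r. r < w i \<and> \<sigma> i r \<le> c})"
    and pass1: "\<And>i r. i \<in> J \<Longrightarrow> r < m1 i \<Longrightarrow> r < w i \<and> \<sigma> i r < c" "\<rho>1 + sum m1 J = \<tau>"
      "\<And>i. i \<in> J \<Longrightarrow> w i \<le> m1 i \<or> \<rho>1 = 0 \<or> c \<le> \<sigma> i (m1 i)"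
    and pass2: "\<And>i r. i \<in> J \<Longrightarrow> r < m2 i \<Longrightarrow> m1 i + r < w i \<and> \<sigma> i (m1 i + r) \<le> c" "\<rho>2 + sum m2 J = \<rho>1"
      "\<And>i. i \<in> J \<Longrightarrow> w i \<le> m1 i + m2 i \<or> \<rho>2 = 0 \<or> c < \<sigma> i (m1 i + m2 i)"
  shows "(\<Sum>i\<in>J. m1 i + m2 i) = \<tau>"
    and "\<And>i. i \<in> J \<Longrightarrow> m1 i + m2 i \<le> w i"
    and "\<And>i r. i \<in> J \<Longrightarrow> r < m1 i + m2 i \<Longrightarrow> \<sigma> i r \<le> c"
    and "\<And>i r. i \<in> J \<Longrightarrow> m1 i + m2 i \<le> r \<Longrightarrow> r < w i \<Longrightarrow> c \<le> \<sigma> i r"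
proof -
  have sub1: "{..<m1 i} \<subseteq> {r. r < w i \<and> \<sigma> i r < c}" if "i \<in> J" for i
    using pass1(1)[OF that] by auto
  have fin1: "finite {r. r < w i \<and> P r}" for i P by simp
  have c1: "m1 i \<le> card {r. r < w i \<and> \<sigma> i r < c}" if "i \<in> J" for i
    using card_mono[OF fin1 sub1[OF that]] by simp
  \<comment> \<open>If the first pass exhausts the supply, it has taken \<open>\<tau>\<close> units,
    at least as many as there are below \<open>c\<close>; equality of the sums then forces all of
    those to be taken for every \<open>i\<close>.\<close>
  have above: "c \<le> \<sigma> i r" if i: "i \<in> J" and r: "m1 i \<le> r" "r < w i" for i r
  proof (cases "\<rho>1 = 0")
    case True
    then have "(\<Sum>i\<in>J. m1 i) = (\<Sum>i\<in>J. card {r. r < w i \<and> \<sigma> i r < c})"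
      using pass1(2) lt sum_mono[of J m1, OF c1] by linarith
    from sum_mono_inv[OF this c1 i fin] have "card {..<m1 i} = card {r. r < w i \<and> \<sigma> i r < c}" by simp
    from card_subset_eq[OF fin1 sub1[OF i] this] have "r \<notin> {r. r < w i \<and> \<sigma> i r < c}"
      using r(1) by (metis lessThan_iff not_less)
    then show ?thesis using r(2) by simp
  next
    case False
    then show ?thesis using pass1(3)[OF i] mono[OF i r(1)] r by linarith
  qed
  show 3: "\<sigma> i r \<le> c" if i: "i \<in> J" and r: "r < m1 i + m2 i" for i r
  proof (cases "r < m1 i")
    case True
    then show ?thesis using pass1(1)[OF i True] by simp
  next
    case False
    then show ?thesis using pass2(1)[OF i, of "r - m1 i"] r by simp
  qed
  show "m1 i + m2 i \<le> w i" if i: "i \<in> J" for i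
  proof (cases "m2 i = 0")
    case True
    then show ?thesis using pass1(1)[OF i, of "m1 i - 1"] by (cases "m1 i = 0") auto
  next
    case False
    then show ?thesis using pass2(1)[OF i, of "m2 i - 1"] by auto
  qed
  show "c \<le> \<sigma> i r" if "i \<in> J" "m1 i + m2 i \<le> r" "r < w i" for i r
    using above that by simp
  \<comment> \<open>With units left over, the second pass has stopped only at the price or the end
    of the window. Then all units up to price \<open>c\<close> are taken, and there are at least
    \<open>\<tau>\<close> of them.\<close>
  have "\<rho>2 = 0"
  proof (rule ccontr)
    assume r2: "\<rho>2 \<noteq> 0"
    have "card {r. r < w i \<and> \<sigma> i r \<le> c} \<le> m1 i + m2 i" if i: "i \<in> J" for i
    proof -
      have "r < m1 i + m2 i" if "r < w i" "\<sigma> i r \<le> c" for r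
      proof (rule ccontr)
        assume n: "\<not> ?thesis"
        then have "m1 i + m2 i \<le> r" by simp
        from pass2(3)[OF i] mono[OF i this] this that r2 show False by linarith
      qed
      then have "{r. r < w i \<and> \<sigma> i r \<le> c} \<subseteq> {..<m1 i + m2 i}" by auto
      from card_mono[OF _ this] show ?thesis by simp
    qed
    then have "(\<Sum>i\<in>J. card {r. r < w i \<and> \<sigma> i r \<le> c}) \<le> (\<Sum>i\<in>J. m1 i + m2 i)" by (rule sum_mono)
    then show False using le pass1(2) pass2(2) r2 by (simp add: sum.distrib)
  qed
  then show "(\<Sum>i\<in>J. m1 i + m2 i) = \<tau>" using pass1(2) pass2(2) by (simp add: sum.distrib)
qed

section \<open>Program text of the integral stage\<close>

abbreviation (input) "PLO \<equiv> 20 :: nat"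
abbreviation (input) "PHI \<equiv> 21 :: nat"
abbreviation (input) "SUML \<equiv> 22 :: nat"
abbreviation (input) "SUMH \<equiv> 23 :: nat"

abbreviation "floor_exp e \<equiv> Prim 1 e"
abbreviation "ceiling_exp e \<equiv> RSub (rconst 0) (Prim 1 (RSub (rconst 0) e))"
abbreviation "cost_exp v \<equiv> RMul (RGet SCALE ptr) (Prim 0 (RAdd (RDiv v (RGet SCALE ptr)) (RGet SHIFT ptr)))"
abbreviation "slope_exp \<equiv> RSub (cost_exp (RAdd (RGet SOL ptr) (rconst 1))) (cost_exp (RGet SOL ptr))"

definition rounded_level :: "nat \<Rightarrow> rexp \<Rightarrow> com" where
  "rounded_level k e = level;; foreach (clip_com k;; RSet k ptr e)"

definition tally :: com where
  "tally =
     rset SUML (rconst 0);; rset SUMH (rconst 0);; nset CNT (NConst 0);;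
     foreach (rset SUML (RAdd (rcell SUML) (RGet LO ptr));; rset SUMH (RAdd (rcell SUMH) (RGet HI ptr));;
       nset CNT (NAdd (ncell CNT) (NConst 1)))"

text \<open>No level has a total below the sum of the lower bounds, hence the truncation.\<close>

definition lower_target :: com where
  "lower_target = rset TARGET (RSub (rcell TOTAL) (OfNat (ncell CNT)));;
     Cond (RLess (rcell TARGET) (rcell SUML)) (rset TARGET (rcell SUML)) Skip"

definition upper_target :: com where
  "upper_target = rset TARGET (RAdd (rcell TOTAL) (OfNat (ncell CNT)));;
     Cond (RLess (rcell SUMH) (rcell TARGET)) (rset TARGET (rcell SUMH)) Skip"

definition window :: com where
  "window = tally;; lower_target;; rounded_level PLO (floor_exp (RGet PLO ptr));;
     upper_target;; rounded_level PHI (ceiling_exp (RGet PHI ptr))"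

text \<open>One loop serves three purposes. With a test that is always true it lists the unit slopes
  of the window as items; with a comparison against the price it hands out units, and the items then
  written are never read. \<open>FUEL\<close> counts the units still allowed.\<close>

definition unit_loop :: "bexp \<Rightarrow> com" where
  "unit_loop c =
     While (BAnd (RLess (RGet SOL ptr) (RGet PHI ptr)) (BAnd (NLess (NConst 0) (ncell FUEL)) c))
       (RSet KEY (ncell LEN) slope_exp;; RSet SLP (ncell LEN) (rconst 0);;
        RSet OFF (ncell LEN) (rconst 1);; nset LEN (NAdd (ncell LEN) (NConst 1));;
        RSet SOL ptr (RAdd (RGet SOL ptr) (rconst 1));;
        nset FUEL (NSub (ncell FUEL) (NConst 1)))"

text \<open>Naturals can only be added and subtracted, so the cap of four units per activity is
  obtained by doubling twice. \<open>TARGET\<close> becomes the number of units to be placed above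
  the lower ends of the windows, and the price is the quantile of the slopes at that rank.\<close>

definition price_units :: com where
  "price_units =
     foreach (RSet SOL ptr (RGet PLO ptr));;
     nset CNT (NAdd (ncell CNT) (ncell CNT));; nset CNT (NAdd (ncell CNT) (ncell CNT));;
     rset TARGET (rcell TOTAL);;
     foreach (rset TARGET (RSub (rcell TARGET) (RGet PLO ptr)));;
     init_search;;
     nset FUEL (ncell CNT);;
     foreach (unit_loop (NLess (NConst 0) (NConst 1)));;
     Call 0"

text \<open>The machine cannot convert a real to a natural number, hence the loop.\<close>
definition set_fuel :: com where
  "set_fuel = nset FUEL (NConst 0);;
     While (BAnd (NLess (ncell FUEL) (ncell CNT)) (RLess (OfNat (ncell FUEL)) (rcell TARGET)))
       (nset FUEL (NAdd (ncell FUEL) (NConst 1)))"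

definition fill_units :: com where
  "fill_units =
     set_fuel;;
     foreach (RSet SOL ptr (RGet PLO ptr));;
     foreach (unit_loop (RLess slope_exp (rcell RES)));;
     foreach (unit_loop (BNot (RLess (rcell RES) slope_exp)))"

definition integral_stage :: com where
  "integral_stage = window;; price_units;; fill_units"

section \<open>The integral window between two rounded levels\<close>

lemma runs_rounded_level:
  fixes s :: state
  assumes ch: "chain (nmem s NEXT) (nmem s STAGE 0) xs" and k: "k \<ge> PLO"
    and e: "\<And>s. rval pr s e = g (rmem s k (nmem s PTR 0))"
  defines "l \<equiv> rmem s LO" and "u \<equiv> rmem s HI" and "a \<equiv> rmem s SCALE" and "b \<equiv> rmem s SHIFT"
    and "T \<equiv> rmem s TARGET 0"
  shows "runs pr [search] (rounded_level k e) s (\<lambda>t s'. t \<le> 627 * length xs + 22 \<and>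
    ((\<forall>i\<in>set xs. 0 < a i \<and> l i \<le> u i) \<and> (\<Sum>i\<leftarrow>xs. l i) \<le> T \<and> T \<le> (\<Sum>i\<leftarrow>xs. u i) \<longrightarrow>
      (\<exists>y. (\<forall>i\<in>set xs. rmem s' k i = g (clip (l i) (u i) (a i * (y - b i)))) \<and>
         (\<Sum>i\<leftarrow>xs. clip (l i) (u i) (a i * (y - b i))) = T)) \<and>
    (\<forall>j. j \<notin> {PTR..SRC} \<longrightarrow> nmem s' j = nmem s j) \<and>
    (\<forall>j. j \<notin> insert k {KEY..TMP2} \<longrightarrow> rmem s' j = rmem s j))"
  unfolding rounded_level_def
  apply (rule runs_SeqI)
   apply (rule runs_level[OF ch])
  subgoal premises lev for t1 s1
  proof -
    have f1: "nmem s1 NEXT = nmem s NEXT" "nmem s1 STAGE = nmem s STAGE" "rmem s1 LO = l"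
      "rmem s1 HI = u" "rmem s1 SCALE = a" "rmem s1 SHIFT = b"
      using lev by (simp_all add: l_def u_def a_def b_def)
    define y where "y = rmem s1 RES 0"
    show ?thesis
      apply (rule runs_mono)
       apply (rule runs_assign[where xs = xs and k = k and C = 5 and g = "\<lambda>i. g (clip (l i) (u i) (a i * (y - b i)))"])
      subgoal using ch by (simp add: f1)
      subgoal by (simp add: clip_com_def)
      subgoal for i s'
        apply (rule runs_SeqI)
         apply (rule runs_clip_com)
        subgoal using k by simp
        subgoal using k by (auto simp: runs_simps e f1 y_def)
        done
      subgoal premises post for t2 s2
      proof -
        have "t1 + t2 \<le> 627 * length xs + 22" using lev post by simp
        moreover have "(\<forall>i\<in>set xs. 0 < a i \<and> l i \<le> u i) \<and> (\<Sum>i\<leftarrow>xs. l i) \<le> T \<and> T \<le> (\<Sum>i\<leftarrow>xs. u i) \<longrightarrow>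
          (\<Sum>i\<leftarrow>xs. clip (l i) (u i) (a i * (y - b i))) = T"
          using lev unfolding l_def u_def a_def b_def T_def y_def by blast
        moreover have "\<forall>i\<in>set xs. rmem s2 k i = g (clip (l i) (u i) (a i * (y - b i)))"
          using post by simp
        moreover have "nmem s2 j = nmem s j" if "j \<notin> {PTR..SRC}" for j using that lev post by auto
        moreover have "rmem s2 j = rmem s j" if "j \<notin> insert k {KEY..TMP2}" for j using that lev post by simp
        ultimately show ?thesis by blast
      qed
      done
  qed
  done

lemma runs_window:
  fixes s :: state
  assumes ch: "chain (nmem s NEXT) (nmem s STAGE 0) xs" and d: "distinct xs"
  defines "l \<equiv> rmem s LO" and "u \<equiv> rmem s HI" and "a \<equiv> rmem s SCALE" and "b \<equiv> rmem s SHIFT"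
    and "T \<equiv> rmem s TOTAL 0" and "J \<equiv> set xs"
  shows "runs (primitives Integral f) [search] window s (\<lambda>t s'. t \<le> 1260 * length xs + 60 \<and>
    nmem s' CNT 0 = length xs \<and>
    ((\<forall>i\<in>J. 0 < a i \<and> l i \<le> u i) \<and> sum l J \<le> T \<and> T \<le> sum u J \<longrightarrow>
      (\<exists>y1 y2. (\<forall>i\<in>J. rmem s' PLO i = of_int \<lfloor>clip (l i) (u i) (a i * (y1 - b i))\<rfloor> \<and>
          rmem s' PHI i = of_int \<lceil>clip (l i) (u i) (a i * (y2 - b i))\<rceil>) \<and>
        (\<Sum>i\<in>J. clip (l i) (u i) (a i * (y1 - b i))) = max (sum l J) (T - card J) \<and>
        (\<Sum>i\<in>J. clip (l i) (u i) (a i * (y2 - b i))) = min (sum u J) (T + card J))) \<and>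
    (\<forall>k. k \<notin> {PTR..CNT} \<longrightarrow> nmem s' k = nmem s k) \<and>
    (\<forall>k. k \<notin> {KEY..TMP2} \<union> {TARGET..SUMH} \<longrightarrow> rmem s' k = rmem s k))"
  (is "runs _ _ _ _ ?Q")
proof -
  have sl: "sum_list (map g xs) = sum g J" for g :: "nat \<Rightarrow> real"
    by (simp add: J_def sum.distinct_set_conv_list[OF d])
  have cJ: "card J = length xs" by (simp add: J_def distinct_card[OF d])
  let ?pr = "primitives Integral f"
  let ?A = "\<lambda>t s'. t \<le> 5 * length xs + 5 \<and>
    nmem s' CNT 0 = length xs \<and> rmem s' SUML 0 = sum l J \<and> rmem s' SUMH 0 = sum u J \<and>
    (\<forall>k. k \<notin> {PTR, CNT} \<longrightarrow> nmem s' k = nmem s k) \<and> (\<forall>k. k \<notin> {SUML, SUMH} \<longrightarrow> rmem s' k = rmem s k)"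
  have tally: "runs ?pr [search] tally s ?A"
  proof -
    define K where "K = (\<lambda>ys (t::nat) (s'::state). t \<le> 5 * length ys \<and>
      nmem s' CNT 0 = length ys \<and> rmem s' SUML 0 = (\<Sum>i\<leftarrow>ys. l i) \<and> rmem s' SUMH 0 = (\<Sum>i\<leftarrow>ys. u i) \<and>
      (\<forall>k. k \<notin> {PTR, CNT} \<longrightarrow> nmem s' k = nmem s k) \<and> (\<forall>k. k \<notin> {SUML, SUMH} \<longrightarrow> rmem s' k = rmem s k))"
    show ?thesis
      unfolding tally_def
      apply (simp add: runs_Seq runs_NSet runs_RSet)
      apply (rule runs_foreach[where W = UNIV and J = K and xs = xs])
      subgoal using ch by simp
      subgoal by simp
      subgoal by simp
      subgoal by simp
      subgoal by (simp add: K_def)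
      subgoal for ys i zs t s' by (simp add: runs_simps K_def l_def u_def)
      subgoal by (simp add: K_def sl)
      done
  qed
  let ?T1 = "max (sum l J) (T - length xs)" and ?T2 = "min (sum u J) (T + length xs)"
  let ?c = "\<lambda>y i. clip (l i) (u i) (a i * (y - b i))"
  let ?ok = "(\<forall>i\<in>J. 0 < a i \<and> l i \<le> u i) \<and> sum l J \<le> T \<and> T \<le> sum u J"
  show ?thesis
    unfolding window_def
  proof (rule runs_SeqI[OF tally], rule runs_SeqI)
    fix t1 :: nat and s1 :: state
    assume "?A t1 s1"
    then have t1: "t1 \<le> 5 * length xs + 5"
      and k1: "nmem s1 CNT 0 = length xs" "rmem s1 SUML 0 = sum l J" "rmem s1 SUMH 0 = sum u J"
      and fn1: "\<And>k. k \<notin> {PTR, CNT} \<Longrightarrow> nmem s1 k = nmem s k"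
      and fr1: "\<And>k. k \<notin> {SUML, SUMH} \<Longrightarrow> rmem s1 k = rmem s k" by auto
    show "runs ?pr [search] lower_target s1 (\<lambda>t s'. t \<le> 3 \<and> s' = rupd TARGET 0 ?T1 s1)"
      by (auto simp: lower_target_def runs_simps k1 fr1 T_def max_def)
    fix t2 :: nat and s2 :: state
    assume "t2 \<le> 3 \<and> s2 = rupd TARGET 0 ?T1 s1"
    then have t2: "t2 \<le> 3" and s2: "s2 = rupd TARGET 0 ?T1 s1" by auto
    have f2: "nmem s2 NEXT = nmem s NEXT" "nmem s2 STAGE = nmem s STAGE" "rmem s2 LO = l"
      "rmem s2 HI = u" "rmem s2 SCALE = a" "rmem s2 SHIFT = b" "rmem s2 TARGET 0 = ?T1"
      using fn1 fr1 by (simp_all add: s2 l_def u_def a_def b_def)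
    let ?L1 = "\<lambda>t s'. t \<le> 627 * length xs + 22 \<and>
      ((\<forall>i\<in>J. 0 < a i \<and> l i \<le> u i) \<and> sum l J \<le> ?T1 \<and> ?T1 \<le> sum u J \<longrightarrow>
        (\<exists>y. (\<forall>i\<in>J. rmem s' PLO i = of_int \<lfloor>?c y i\<rfloor>) \<and> sum (?c y) J = ?T1)) \<and>
      (\<forall>j. j \<notin> {PTR..SRC} \<longrightarrow> nmem s' j = nmem s2 j) \<and>
      (\<forall>j. j \<notin> insert PLO {KEY..TMP2} \<longrightarrow> rmem s' j = rmem s2 j)"
    have lev1: "runs ?pr [search] (rounded_level PLO (floor_exp (RGet PLO ptr))) s2 ?L1"
      unfolding J_def using runs_rounded_level[of s2 xs PLO ?pr "floor_exp (RGet PLO ptr)" "\<lambda>x. of_int \<lfloor>x\<rfloor>"] ch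
      unfolding f2 sl J_def by simp
    show "runs ?pr [search] (rounded_level PLO (floor_exp (RGet PLO ptr));; upper_target;;
        rounded_level PHI (ceiling_exp (RGet PHI ptr))) s2
      (\<lambda>t' s''. ?Q (t1 + (t2 + t')) s'')"
    proof (rule runs_SeqI[OF lev1], rule runs_SeqI)
      fix t3 :: nat and s3 :: state
      assume lev3: "?L1 t3 s3"
      then have fn3: "\<And>j. j \<notin> {PTR..SRC} \<Longrightarrow> nmem s3 j = nmem s2 j"
        and fr3: "\<And>j. j \<notin> insert PLO {KEY..TMP2} \<Longrightarrow> rmem s3 j = rmem s2 j" by blast+
      have k3: "nmem s3 CNT 0 = length xs" "rmem s3 SUMH 0 = sum u J" "rmem s3 TOTAL 0 = T"
        using fn3[of CNT] fr3[of SUMH] fr3[of TOTAL] k1 fr1[of TOTAL] by (simp_all add: s2 T_def)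
      show "runs ?pr [search] upper_target s3 (\<lambda>t s'. t \<le> 3 \<and> s' = rupd TARGET 0 ?T2 s3)"
        by (auto simp: upper_target_def runs_simps k3 min_def)
      fix t4 :: nat and s4 :: state
      assume "t4 \<le> 3 \<and> s4 = rupd TARGET 0 ?T2 s3"
      then have t4: "t4 \<le> 3" and s4: "s4 = rupd TARGET 0 ?T2 s3" by auto
      have f4: "nmem s4 NEXT = nmem s NEXT" "nmem s4 STAGE = nmem s STAGE" "rmem s4 LO = l"
        "rmem s4 HI = u" "rmem s4 SCALE = a" "rmem s4 SHIFT = b" "rmem s4 TARGET 0 = ?T2"
        using fn3 fr3 by (simp_all add: s4 f2)
      let ?L2 = "\<lambda>t s'. t \<le> 627 * length xs + 22 \<and>
        ((\<forall>i\<in>J. 0 < a i \<and> l i \<le> u i) \<and> sum l J \<le> ?T2 \<and> ?T2 \<le> sum u J \<longrightarrow>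
          (\<exists>y. (\<forall>i\<in>J. rmem s' PHI i = of_int \<lceil>?c y i\<rceil>) \<and> sum (?c y) J = ?T2)) \<and>
        (\<forall>j. j \<notin> {PTR..SRC} \<longrightarrow> nmem s' j = nmem s4 j) \<and>
        (\<forall>j. j \<notin> insert PHI {KEY..TMP2} \<longrightarrow> rmem s' j = rmem s4 j)"
      have lev2: "runs ?pr [search] (rounded_level PHI (ceiling_exp (RGet PHI ptr))) s4 ?L2"
        unfolding J_def using runs_rounded_level[of s4 xs PHI ?pr "ceiling_exp (RGet PHI ptr)" "\<lambda>x. of_int \<lceil>x\<rceil>"] ch
        unfolding f4 sl J_def by (simp add: ceiling_def)
      show "runs ?pr [search] (rounded_level PHI (ceiling_exp (RGet PHI ptr))) s4
        (\<lambda>t' s''. ?Q (t1 + (t2 + (t3 + (t4 + t')))) s'')"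
      proof (rule runs_mono[OF lev2])
        fix t5 :: nat and s5 :: state
        assume lev5: "?L2 t5 s5"
        then have fn5: "\<And>j. j \<notin> {PTR..SRC} \<Longrightarrow> nmem s5 j = nmem s4 j"
          and fr5: "\<And>j. j \<notin> insert PHI {KEY..TMP2} \<Longrightarrow> rmem s5 j = rmem s4 j" by blast+
        have "t1 + (t2 + (t3 + (t4 + t5))) \<le> 1260 * length xs + 60"
          using t1 t2 t4 lev3 lev5 by linarith
        moreover have "nmem s5 CNT 0 = length xs" using fn5[of CNT] k3 by (simp add: s4)
        moreover have "\<exists>y1 y2. (\<forall>i\<in>J. rmem s5 PLO i = of_int \<lfloor>?c y1 i\<rfloor> \<and> rmem s5 PHI i = of_int \<lceil>?c y2 i\<rceil>) \<and>
            sum (?c y1) J = max (sum l J) (T - card J) \<and> sum (?c y2) J = min (sum u J) (T + card J)" if ok: ?ok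
        proof -
          have "rmem s5 PLO = rmem s3 PLO" using fr5[of PLO] by (simp add: s4)
          moreover have "sum l J \<le> ?T1 \<and> ?T1 \<le> sum u J" "sum l J \<le> ?T2 \<and> ?T2 \<le> sum u J" using ok by auto
          moreover obtain y1 where "\<forall>i\<in>J. rmem s3 PLO i = of_int \<lfloor>?c y1 i\<rfloor>" "sum (?c y1) J = ?T1"
            using lev3 ok \<open>sum l J \<le> ?T1 \<and> ?T1 \<le> sum u J\<close> by blast
          moreover obtain y2 where "\<forall>i\<in>J. rmem s5 PHI i = of_int \<lceil>?c y2 i\<rceil>" "sum (?c y2) J = ?T2"
            using lev5 ok \<open>sum l J \<le> ?T2 \<and> ?T2 \<le> sum u J\<close> by blast
          ultimately show ?thesis unfolding cJ by auto
        qed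
        moreover have "nmem s5 k = nmem s k" if "k \<notin> {PTR..CNT}" for k
          using that fn5[of k] fn3[of k] fn1[of k] by (auto simp: s2 s4)
        moreover have "rmem s5 k = rmem s k" if "k \<notin> {KEY..TMP2} \<union> {TARGET..SUMH}" for k
          using that fr5[of k] fr3[of k] fr1[of k] by (auto simp: s2 s4)
        ultimately show "?Q (t1 + (t2 + (t3 + (t4 + t5)))) s5" by blast
      qed
    qed
  qed
qed

section \<open>Listing, pricing and handing out unit increments\<close>

definition unit_slope :: "(real \<Rightarrow> real) \<Rightarrow> (nat \<Rightarrow> real) \<Rightarrow> (nat \<Rightarrow> real) \<Rightarrow> nat \<Rightarrow> real \<Rightarrow> real" where
  "unit_slope f a b i v = cost f a b i (v + 1) - cost f a b i v"

lemma rval_slope_exp: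
  "rval (primitives Integral f) s slope_exp =
    unit_slope f (rmem s SCALE) (rmem s SHIFT) (nmem s PTR 0) (rmem s SOL (nmem s PTR 0))"
  by (simp add: unit_slope_def cost_def)

text \<open>The test enters as a predicate \<open>C\<close> on the slope of the next unit, which
  makes the listing and both passes instances of one statement. The three reasons for stopping are
  kept apart because the counting argument needs to know which of them occurred.\<close>

lemma runs_unit_loop:
  fixes s :: state and f :: "real \<Rightarrow> real"
  defines "i \<equiv> nmem s PTR 0"
  defines "v \<equiv> rmem s SOL i" and "n \<equiv> nmem s LEN 0"
    and "\<sigma> \<equiv> (\<lambda>r. unit_slope f (rmem s SCALE) (rmem s SHIFT) i (rmem s SOL i + real r))"
  assumes c: "\<And>s'. rmem s' RES = rmem s RES \<Longrightarrow>
    bval (primitives Integral f) s' c = C (rval (primitives Integral f) s' slope_exp)"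
  shows "runs (primitives Integral f) ps (unit_loop c) s (\<lambda>t s'. \<exists>m. t \<le> 7 * m + 1 \<and>
    rmem s' SOL = (rmem s SOL)(i := v + real m) \<and> nmem s' FUEL 0 + m = nmem s FUEL 0 \<and>
    (\<forall>r<m. v + real r < rmem s PHI i \<and> C (\<sigma> r)) \<and>
    (rmem s PHI i \<le> v + real m \<or> nmem s' FUEL 0 = 0 \<or> \<not> C (\<sigma> m)) \<and>
    (nmem s BASE 0 = 0 \<longrightarrow> items s' 0 = items s 0 @ map (\<lambda>r. (\<sigma> r, 0, 1)) [0..<m]) \<and>
    (\<forall>k. k \<notin> {LEN, FUEL} \<longrightarrow> nmem s' k = nmem s k) \<and>
    (\<forall>k. k \<notin> {SOL, KEY, SLP, OFF} \<longrightarrow> rmem s' k = rmem s k))"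
  (is "runs _ _ _ _ ?Q")
proof -
  let ?pr = "primitives Integral f"
  define J where "J = (\<lambda>(t::nat) (s'::state). \<exists>m. t \<le> 7 * m \<and>
    rmem s' SOL = (rmem s SOL)(i := v + real m) \<and> nmem s' FUEL 0 + m = nmem s FUEL 0 \<and>
    (\<forall>r<m. v + real r < rmem s PHI i \<and> C (\<sigma> r)) \<and>
    nmem s' LEN 0 = n + m \<and> (\<forall>j<n. item_at s' j = item_at s j) \<and>
    (\<forall>r<m. item_at s' (n + r) = (\<sigma> r, 0, 1)) \<and>
    (\<forall>k. k \<notin> {LEN, FUEL} \<longrightarrow> nmem s' k = nmem s k) \<and>
    (\<forall>k. k \<notin> {SOL, KEY, SLP, OFF} \<longrightarrow> rmem s' k = rmem s k))"
  have bv: "bval ?pr s' c = C (\<sigma> m)"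
    if "rmem s' SOL = (rmem s SOL)(i := v + real m)"
      "\<forall>k. k \<notin> {LEN, FUEL} \<longrightarrow> nmem s' k = nmem s k"
      "\<forall>k. k \<notin> {SOL, KEY, SLP, OFF} \<longrightarrow> rmem s' k = rmem s k" for s' m
  proof -
    have "bval ?pr s' c = C (rval ?pr s' slope_exp)" using c that(3) by simp
    then show ?thesis unfolding rval_slope_exp \<sigma>_def using that by (simp add: i_def v_def)
  qed
  show ?thesis
    unfolding unit_loop_def
  proof (rule runs_While[where J = J and \<mu> = "\<lambda>s. nmem s FUEL 0"])
    show "J 0 s" unfolding J_def by (intro exI[of _ 0]) (simp add: v_def n_def)
  next
    fix t :: nat and s1 :: state
    assume Jt: "J t s1" and b: "bval ?pr s1 (BAnd (RLess (RGet SOL ptr) (RGet PHI ptr)) (BAnd (NLess (NConst 0) (ncell FUEL)) c))"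
    obtain m where J: "t \<le> 7 * m" "rmem s1 SOL = (rmem s SOL)(i := v + real m)"
      "nmem s1 FUEL 0 + m = nmem s FUEL 0"
      "\<forall>r<m. v + real r < rmem s PHI i \<and> C (\<sigma> r)"
      "nmem s1 LEN 0 = n + m" "\<forall>j<n. item_at s1 j = item_at s j" "\<forall>r<m. item_at s1 (n + r) = (\<sigma> r, 0, 1)"
      and fn: "\<forall>k. k \<notin> {LEN, FUEL} \<longrightarrow> nmem s1 k = nmem s k"
      and fr: "\<forall>k. k \<notin> {SOL, KEY, SLP, OFF} \<longrightarrow> rmem s1 k = rmem s k"
      using Jt unfolding J_def by (elim exE conjE) (rule that; assumption)
    have f1: "nmem s1 PTR 0 = i" "rmem s1 PHI = rmem s PHI" "rmem s1 SCALE = rmem s SCALE" "rmem s1 SHIFT = rmem s SHIFT"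
      using fn fr by (simp_all add: i_def)
    have b': "v + real m < rmem s PHI i" "0 < nmem s1 FUEL 0" "C (\<sigma> m)"
      using b bv[OF J(2) fn fr] by (simp_all add: f1 J(2))
    have slope: "rmem s SCALE i * f ((v + real m + 1) / rmem s SCALE i + rmem s SHIFT i) -
        rmem s SCALE i * f ((v + real m) / rmem s SCALE i + rmem s SHIFT i) = \<sigma> m"
      by (simp add: \<sigma>_def unit_slope_def cost_def v_def)
    show "runs ?pr ps
       (RSet KEY (ncell LEN) slope_exp;; RSet SLP (ncell LEN) (rconst 0);;
        RSet OFF (ncell LEN) (rconst 1);; nset LEN (NAdd (ncell LEN) (NConst 1));;
        RSet SOL ptr (RAdd (RGet SOL ptr) (rconst 1));;
        nset FUEL (NSub (ncell FUEL) (NConst 1))) s1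
      (\<lambda>t' s'. J (Suc (t + t')) s' \<and> nmem s' FUEL 0 < nmem s1 FUEL 0)"
      apply (simp add: runs_simps f1 J(2,5) slope)
      apply (rule conjI)
      subgoal
      proof -
        show ?thesis (is "J _ ?s2")
          unfolding J_def
        proof (intro exI[of _ "Suc m"] conjI)
          show "\<forall>r<Suc m. item_at ?s2 (n + r) = (\<sigma> r, 0, 1)"
            using J(7) by (auto simp: item_at_def less_Suc_eq J(5))
          show "\<forall>r<Suc m. v + real r < rmem s PHI i \<and> C (\<sigma> r)"
            using J(4) b' less_Suc_eq by metis
          show "\<forall>j<n. item_at ?s2 j = item_at s j"
            using J(6) by (simp add: item_at_def J(5))
          show "\<forall>k. k \<notin> {LEN, FUEL} \<longrightarrow> nmem ?s2 k = nmem s k" using fn by simp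
          show "\<forall>k. k \<notin> {SOL, KEY, SLP, OFF} \<longrightarrow> rmem ?s2 k = rmem s k" using fr by simp
        qed (use J(1,2,3,5) b'(2) in \<open>simp_all add: f1 add_ac\<close>)
      qed
      subgoal using b' by simp
      done
  next
    fix t :: nat and s1 :: state
    assume Jt: "J t s1" and b: "\<not> bval ?pr s1 (BAnd (RLess (RGet SOL ptr) (RGet PHI ptr)) (BAnd (NLess (NConst 0) (ncell FUEL)) c))"
    obtain m where J: "t \<le> 7 * m" "rmem s1 SOL = (rmem s SOL)(i := v + real m)"
      "nmem s1 FUEL 0 + m = nmem s FUEL 0"
      "\<forall>r<m. v + real r < rmem s PHI i \<and> C (\<sigma> r)"
      "nmem s1 LEN 0 = n + m" "\<forall>j<n. item_at s1 j = item_at s j" "\<forall>r<m. item_at s1 (n + r) = (\<sigma> r, 0, 1)"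
      and fn: "\<forall>k. k \<notin> {LEN, FUEL} \<longrightarrow> nmem s1 k = nmem s k"
      and fr: "\<forall>k. k \<notin> {SOL, KEY, SLP, OFF} \<longrightarrow> rmem s1 k = rmem s k"
      using Jt unfolding J_def by (elim exE conjE) (rule that; assumption)
    have f1: "nmem s1 PTR 0 = i" "rmem s1 PHI = rmem s PHI"
      using fn fr by (simp_all add: i_def)
    have b': "rmem s PHI i \<le> v + real m \<or> nmem s1 FUEL 0 = 0 \<or> \<not> C (\<sigma> m)"
      using b bv[OF J(2) fn fr] by (auto simp: f1 J(2))
    have it: "items s1 0 = items s 0 @ map (\<lambda>r. (\<sigma> r, 0, 1)) [0..<m]" if "nmem s BASE 0 = 0"
      by (rule items_push) (use that fn J(5-7) in \<open>simp_all add: n_def\<close>)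
    show "?Q (Suc t) s1"
      using J(1-4) b' it fn fr by (intro exI[of _ m] conjI) (assumption | simp)+
  qed
qed

text \<open>The time is amortized: a single activity may take many units, but each iteration of its
  loop consumes fuel, so all loops together cost at most 7 steps per unit of initial fuel.\<close>

lemma runs_pass:
  fixes s :: state and f :: "real \<Rightarrow> real"
  assumes ch: "chain (nmem s NEXT) (nmem s STAGE 0) xs" and d: "distinct xs"
    and cw: "nwrites UNIV (unit_loop c) \<subseteq> {LEN, FUEL}"
  defines "\<sigma> \<equiv> (\<lambda>i r. unit_slope f (rmem s SCALE) (rmem s SHIFT) i (rmem s SOL i + real r))"
  assumes c: "\<And>s'. rmem s' RES = rmem s RES \<Longrightarrow>
    bval (primitives Integral f) s' c = C (rval (primitives Integral f) s' slope_exp)"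
  shows "runs (primitives Integral f) ps (foreach (unit_loop c)) s (\<lambda>t s'. \<exists>m.
    t \<le> 7 * nmem s FUEL 0 + 3 * length xs + 2 \<and> nmem s' FUEL 0 + sum m (set xs) = nmem s FUEL 0 \<and>
    (\<forall>i\<in>set xs. rmem s' SOL i = rmem s SOL i + real (m i) \<and>
      (\<forall>r<m i. rmem s SOL i + real r < rmem s PHI i \<and> C (\<sigma> i r)) \<and>
      (rmem s PHI i \<le> rmem s SOL i + real (m i) \<or> nmem s' FUEL 0 = 0 \<or> \<not> C (\<sigma> i (m i)))) \<and>
    (nmem s BASE 0 = 0 \<longrightarrow>
      items s' 0 = items s 0 @ concat (map (\<lambda>i. map (\<lambda>r. (\<sigma> i r, 0, 1)) [0..<m i]) xs)) \<and>
    (\<forall>k. k \<notin> {LEN, FUEL, PTR} \<longrightarrow> nmem s' k = nmem s k) \<and>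
    (\<forall>k. k \<notin> {SOL, KEY, SLP, OFF} \<longrightarrow> rmem s' k = rmem s k))"
  (is "runs _ _ _ _ ?Q")
proof -
  define J where "J = (\<lambda>ys (t::nat) (s'::state). \<exists>m.
    t \<le> 7 * sum m (set ys) + 3 * length ys \<and> nmem s' FUEL 0 + sum m (set ys) = nmem s FUEL 0 \<and>
    (\<forall>i. i \<notin> set ys \<longrightarrow> rmem s' SOL i = rmem s SOL i) \<and>
    (\<forall>i\<in>set ys. rmem s' SOL i = rmem s SOL i + real (m i) \<and>
      (\<forall>r<m i. rmem s SOL i + real r < rmem s PHI i \<and> C (\<sigma> i r)) \<and>
      (rmem s PHI i \<le> rmem s SOL i + real (m i) \<or> nmem s' FUEL 0 = 0 \<or> \<not> C (\<sigma> i (m i)))) \<and>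
    (nmem s BASE 0 = 0 \<longrightarrow>
      items s' 0 = items s 0 @ concat (map (\<lambda>i. map (\<lambda>r. (\<sigma> i r, 0, 1)) [0..<m i]) ys)) \<and>
    (\<forall>k. k \<notin> {LEN, FUEL, PTR} \<longrightarrow> nmem s' k = nmem s k) \<and>
    (\<forall>k. k \<notin> {SOL, KEY, SLP, OFF} \<longrightarrow> rmem s' k = rmem s k))"
  show ?thesis
  proof (rule runs_foreach[where W = UNIV and J = J and xs = xs, OF ch])
    show "\<forall>p\<in>set ps. nwrites UNIV p \<subseteq> UNIV" by simp
    show "PTR \<notin> nwrites UNIV (unit_loop c)" "NEXT \<notin> nwrites UNIV (unit_loop c)" using cw by auto
    show "J [] 0 (nupd PTR 0 (nmem s STAGE 0) s)" by (simp add: J_def)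
  next
    fix ys i zs t and s1 :: state
    assume xs: "xs = ys @ i # zs" and Jy: "J ys t s1" and i: "nmem s1 PTR 0 = i"
    obtain m where t: "t \<le> 7 * sum m (set ys) + 3 * length ys"
      and fuel: "nmem s1 FUEL 0 + sum m (set ys) = nmem s FUEL 0"
      and rest: "\<forall>i. i \<notin> set ys \<longrightarrow> rmem s1 SOL i = rmem s SOL i"
      and taken: "\<forall>i\<in>set ys. rmem s1 SOL i = rmem s SOL i + real (m i) \<and>
        (\<forall>r<m i. rmem s SOL i + real r < rmem s PHI i \<and> C (\<sigma> i r)) \<and>
        (rmem s PHI i \<le> rmem s SOL i + real (m i) \<or> nmem s1 FUEL 0 = 0 \<or> \<not> C (\<sigma> i (m i)))"
      and it: "nmem s BASE 0 = 0 \<longrightarrow>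
        items s1 0 = items s 0 @ concat (map (\<lambda>i. map (\<lambda>r. (\<sigma> i r, 0, 1)) [0..<m i]) ys)"
      and fn: "\<forall>k. k \<notin> {LEN, FUEL, PTR} \<longrightarrow> nmem s1 k = nmem s k"
      and fr: "\<forall>k. k \<notin> {SOL, KEY, SLP, OFF} \<longrightarrow> rmem s1 k = rmem s k"
      using Jy unfolding J_def by (elim exE conjE) (rule that; assumption)
    have iy: "i \<notin> set ys" using d xs by auto
    have f1: "rmem s1 SCALE = rmem s SCALE" "rmem s1 SHIFT = rmem s SHIFT" "rmem s1 PHI = rmem s PHI"
      "rmem s1 RES = rmem s RES" "nmem s1 BASE = nmem s BASE" "rmem s1 SOL i = rmem s SOL i"
      using fn fr rest iy by simp_all
    let ?L = "\<lambda>t s'. \<exists>m. t \<le> 7 * m + 1 \<and>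
      rmem s' SOL = (rmem s1 SOL)(i := rmem s SOL i + real m) \<and> nmem s' FUEL 0 + m = nmem s1 FUEL 0 \<and>
      (\<forall>r<m. rmem s SOL i + real r < rmem s PHI i \<and> C (\<sigma> i r)) \<and>
      (rmem s PHI i \<le> rmem s SOL i + real m \<or> nmem s' FUEL 0 = 0 \<or> \<not> C (\<sigma> i m)) \<and>
      (nmem s BASE 0 = 0 \<longrightarrow> items s' 0 = items s1 0 @ map (\<lambda>r. (\<sigma> i r, 0, 1)) [0..<m]) \<and>
      (\<forall>k. k \<notin> {LEN, FUEL} \<longrightarrow> nmem s' k = nmem s1 k) \<and>
      (\<forall>k. k \<notin> {SOL, KEY, SLP, OFF} \<longrightarrow> rmem s' k = rmem s1 k)"
    have loop: "runs (primitives Integral f) ps (unit_loop c) s1 ?L"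
      using runs_unit_loop[of s1 f c C ps] c unfolding i f1 \<sigma>_def by blast
    show "runs (primitives Integral f) ps (unit_loop c) s1
      (\<lambda>t' s''. J (ys @ [i]) (t + t' + 2) (nupd PTR 0 (nmem s NEXT i) s''))"
    proof (rule runs_mono[OF loop])
      fix t2 :: nat and s2 :: state
      assume t2: "?L t2 s2"
      obtain q where t2: "t2 \<le> 7 * q + 1" and sol: "rmem s2 SOL = (rmem s1 SOL)(i := rmem s SOL i + real q)"
        and fuel2: "nmem s2 FUEL 0 + q = nmem s1 FUEL 0"
        and q: "\<forall>r<q. rmem s SOL i + real r < rmem s PHI i \<and> C (\<sigma> i r)"
          "rmem s PHI i \<le> rmem s SOL i + real q \<or> nmem s2 FUEL 0 = 0 \<or> \<not> C (\<sigma> i q)"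
        and it2: "nmem s BASE 0 = 0 \<longrightarrow> items s2 0 = items s1 0 @ map (\<lambda>r. (\<sigma> i r, 0, 1)) [0..<q]"
        and fn2: "\<forall>k. k \<notin> {LEN, FUEL} \<longrightarrow> nmem s2 k = nmem s1 k"
        and fr2: "\<forall>k. k \<notin> {SOL, KEY, SLP, OFF} \<longrightarrow> rmem s2 k = rmem s1 k"
        using t2 by (elim exE conjE) (rule that; assumption)
      let ?m = "m(i := q)"
      have "sum ?m (set ys) = sum m (set ys)" using iy by (intro sum.cong) auto
      moreover have "sum ?m (set (ys @ [i])) = ?m i + sum ?m (set ys)"
        using iy by (simp del: fun_upd_apply)
      ultimately have s: "sum ?m (set (ys @ [i])) = sum m (set ys) + q" by (simp only: fun_upd_same add.commute)
      have l: "map (\<lambda>j. map (\<lambda>r. (\<sigma> j r, 0, 1)) [0..<?m j]) ys = map (\<lambda>j. map (\<lambda>r. (\<sigma> j r, 0::real, 1::real)) [0..<m j]) ys"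
        using iy by (intro map_cong) auto
      show "J (ys @ [i]) (t + t2 + 2) (nupd PTR 0 (nmem s NEXT i) s2)"
        unfolding J_def
      proof (intro exI[of _ ?m] conjI)
        show "t + t2 + 2 \<le> 7 * sum ?m (set (ys @ [i])) + 3 * length (ys @ [i])"
          unfolding s using t t2 by simp
        show "nmem (nupd PTR 0 (nmem s NEXT i) s2) FUEL 0 + sum ?m (set (ys @ [i])) = nmem s FUEL 0"
          unfolding s using fuel fuel2 by simp
        show "\<forall>j. j \<notin> set (ys @ [i]) \<longrightarrow> rmem (nupd PTR 0 (nmem s NEXT i) s2) SOL j = rmem s SOL j"
          using rest by (simp add: sol)
        show "\<forall>j\<in>set (ys @ [i]). rmem (nupd PTR 0 (nmem s NEXT i) s2) SOL j = rmem s SOL j + real (?m j) \<and>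
          (\<forall>r<?m j. rmem s SOL j + real r < rmem s PHI j \<and> C (\<sigma> j r)) \<and>
          (rmem s PHI j \<le> rmem s SOL j + real (?m j) \<or> nmem (nupd PTR 0 (nmem s NEXT i) s2) FUEL 0 = 0 \<or> \<not> C (\<sigma> j (?m j)))" (is "\<forall>j\<in>_. ?P j")
        proof
          fix j assume "j \<in> set (ys @ [i])"
          then consider "j = i" | "j \<noteq> i" "j \<in> set ys" by auto
          then show "?P j"
          proof cases
            case 1
            then show ?thesis using q by (simp add: sol)
          next
            case 2
            \<comment> \<open>Fuel never grows, so an activity that stopped for lack of it keeps
              this justification.\<close>
            then show ?thesis using bspec[OF taken 2(2)] fuel2 by (auto simp: sol)
          qed
        qed
        show "nmem s BASE 0 = 0 \<longrightarrow> items (nupd PTR 0 (nmem s NEXT i) s2) 0 =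
          items s 0 @ concat (map (\<lambda>i. map (\<lambda>r. (\<sigma> i r, 0, 1)) [0..<?m i]) (ys @ [i]))"
          using it it2 unfolding map_append concat_append l by simp
        show "\<forall>k. k \<notin> {LEN, FUEL, PTR} \<longrightarrow> nmem (nupd PTR 0 (nmem s NEXT i) s2) k = nmem s k"
          using fn fn2 by simp
        show "\<forall>k. k \<notin> {SOL, KEY, SLP, OFF} \<longrightarrow> rmem (nupd PTR 0 (nmem s NEXT i) s2) k = rmem s k"
          using fr fr2 by simp
      qed
    qed
  next
    fix t and s1 :: state
    assume "J xs t s1"
    then show "?Q (t + 2) s1"
      unfolding J_def by (elim exE) (rule exI, elim conjE, intro conjI, linarith, assumption+)
  qed
qed

text \<open>The cap by \<open>CNT\<close> bounds the counting even if \<open>TARGET\<close> is huge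
  or no natural number, as may happen on infeasible data.\<close>

lemma runs_set_fuel:
  "runs pr ps set_fuel s (\<lambda>t s'. t \<le> 2 * nmem s CNT 0 + 2 \<and> nmem s' FUEL 0 \<le> nmem s CNT 0 \<and>
    (\<forall>\<tau>. rmem s TARGET 0 = real \<tau> \<and> \<tau> \<le> nmem s CNT 0 \<longrightarrow> nmem s' FUEL 0 = \<tau>) \<and>
    (\<forall>k. k \<noteq> FUEL \<longrightarrow> nmem s' k = nmem s k) \<and> rmem s' = rmem s)"
proof -
  define J where "J = (\<lambda>(t::nat) (s'::state). t \<le> 2 * nmem s' FUEL 0 \<and> nmem s' FUEL 0 \<le> nmem s CNT 0 \<and>
    (\<forall>\<tau>. rmem s TARGET 0 = real \<tau> \<longrightarrow> nmem s' FUEL 0 \<le> \<tau>) \<and>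
    (\<forall>k. k \<noteq> FUEL \<longrightarrow> nmem s' k = nmem s k) \<and> rmem s' = rmem s)"
  show ?thesis
    unfolding set_fuel_def
    apply (simp add: runs_simps)
    apply (rule runs_While[where J = J and \<mu> = "\<lambda>s'. nmem s CNT 0 - nmem s' FUEL 0"])
    subgoal by (simp add: J_def)
    subgoal by (auto simp: J_def runs_simps)
    subgoal by (auto simp: J_def)
    done
qed

definition unit_items :: "('a \<Rightarrow> nat \<Rightarrow> real) \<Rightarrow> ('a \<Rightarrow> nat) \<Rightarrow> 'a list \<Rightarrow> item list" where
  "unit_items \<sigma> w xs = concat (map (\<lambda>i. map (\<lambda>r. (\<sigma> i r, 0, 1)) [0..<w i]) xs)"

lemma length_unit_items: "distinct xs \<Longrightarrow> length (unit_items \<sigma> w xs) = sum w (set xs)"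
  by (simp add: unit_items_def length_concat comp_def sum.distinct_set_conv_list)

lemma count_unit_items:
  assumes "distinct xs"
  shows "length (filter (\<lambda>x. P (key x)) (unit_items \<sigma> w xs)) = (\<Sum>i\<in>set xs. card {r. r < w i \<and> P (\<sigma> i r)})"
proof -
  have "length (filter (\<lambda>r. P (\<sigma> i r)) [0..<w i]) = card {r. r < w i \<and> P (\<sigma> i r)}" for i
    unfolding length_filter_conv_card by (rule arg_cong[where f = card]) auto
  then show ?thesis
    by (simp add: unit_items_def filter_concat length_concat comp_def filter_map
        sum.distinct_set_conv_list[OF assms])
qed

text \<open>Window widths are naturals only for sensible data, hence the conclusion about any
  \<open>w\<close> that happens to describe them. If their sum respects the cap, the list of slopes
  is complete and the price is a quantile of all of them.\<close>

lemma runs_price_units: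
  fixes s :: state and f :: "real \<Rightarrow> real"
  assumes ch: "chain (nmem s NEXT) (nmem s STAGE 0) xs" and d: "distinct xs"
    and k: "nmem s CNT 0 = length xs"
  defines "\<sigma> \<equiv> (\<lambda>i r. unit_slope f (rmem s SCALE) (rmem s SHIFT) i (rmem s PLO i + real r))"
  shows "runs (primitives Integral f) [search] price_units s (\<lambda>t s'. t \<le> 1240 * length xs + 40 \<and>
    nmem s' CNT 0 = 4 * length xs \<and>
    rmem s' TARGET 0 = rmem s TOTAL 0 - sum (rmem s PLO) (set xs) \<and>
    (\<forall>w. (\<forall>i\<in>set xs. rmem s PHI i = rmem s PLO i + real (w i)) \<and> sum w (set xs) \<le> 4 * length xs \<longrightarrow>
      crossing (unit_items \<sigma> w xs) (rmem s' TARGET 0) (rmem s' RES 0)) \<and>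
    (\<forall>k. k \<notin> {PTR..CNT} \<longrightarrow> nmem s' k = nmem s k) \<and>
    (\<forall>k. k \<notin> {SOL, TARGET} \<union> {KEY..TMP2} \<longrightarrow> rmem s' k = rmem s k))"
  unfolding price_units_def
  apply (rule runs_SeqI)
   apply (rule runs_assign[where xs = xs and k = SOL and C = 1 and g = "rmem s PLO", OF ch])
  subgoal by simp
  subgoal by (simp add: runs_simps)
  subgoal premises p1 for t1 s1
  proof -
    have fn1: "\<And>j. j \<noteq> PTR \<Longrightarrow> nmem s1 j = nmem s j" and fr1: "\<And>j. j \<noteq> SOL \<Longrightarrow> rmem s1 j = rmem s j"
      and sol1: "\<And>i. i \<in> set xs \<Longrightarrow> rmem s1 SOL i = rmem s PLO i" and t1: "t1 \<le> 3 * length xs + 2"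
      using p1 by auto
    define s2 where "s2 = rupd TARGET 0 (rmem s TOTAL 0) (nupd CNT 0 (4 * length xs) s1)"
    have eq2: "rupd TARGET 0 (rmem s TOTAL 0) (nupd CNT 0 (length xs + length xs + (length xs + length xs)) (nupd CNT 0 (length xs + length xs) s1)) = s2"
    proof -
      have "length xs + length xs + (length xs + length xs) = 4 * length xs" by simp
      then show ?thesis by (simp only: s2_def nupd_def rupd_def) simp
    qed
    define K where "K = (\<lambda>ys (t::nat) (s'::state). t = 3 * length ys \<and>
      rmem s' TARGET 0 = rmem s TOTAL 0 - (\<Sum>i\<leftarrow>ys. rmem s PLO i) \<and>
      (\<forall>k. k \<noteq> PTR \<longrightarrow> nmem s' k = nmem s2 k) \<and> (\<forall>k. k \<noteq> TARGET \<longrightarrow> rmem s' k = rmem s2 k))"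
    show ?thesis
      apply (simp add: runs_Seq runs_NSet runs_RSet fn1 fr1 k eq2)
      apply (rule runs_foreach[where W = UNIV and J = K and xs = xs])
      subgoal using ch by (simp add: s2_def fn1)
      subgoal by simp
      subgoal by simp
      subgoal by simp
      subgoal by (simp add: K_def s2_def)
      subgoal by (simp add: K_def runs_simps s2_def fr1)
      subgoal premises p3 for t3 s3
      proof -
        have t3: "t3 = 3 * length xs" and tg: "rmem s3 TARGET 0 = rmem s TOTAL 0 - sum (rmem s PLO) (set xs)"
          and fn3: "\<And>k. k \<noteq> PTR \<Longrightarrow> nmem s3 k = nmem s2 k" and fr3: "\<And>k. k \<noteq> TARGET \<Longrightarrow> rmem s3 k = rmem s2 k"
          using p3 by (auto simp: K_def sum.distinct_set_conv_list[OF d])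
        have f3: "nmem s3 CNT 0 = 4 * length xs" "nmem s3 NEXT = nmem s NEXT" "nmem s3 STAGE = nmem s STAGE"
          "\<And>j. j \<notin> {TARGET, SOL} \<Longrightarrow> rmem s3 j = rmem s j" "rmem s3 SOL = rmem s1 SOL"
          using fn3 fr3 by (simp_all add: s2_def fn1 fr1)
        define s4 where "s4 = nupd FUEL 0 (4 * length xs) (rupd RES 0 0 (rupd SOFF 0 0 (rupd SSLP 0 0
          (rupd GOAL 0 (rmem s3 TARGET 0) (nupd BASE 0 0 (nupd LEN 0 0 (nupd DEPTH 0 0 s3)))))))"
        have f4: "nmem s4 NEXT = nmem s NEXT" "nmem s4 STAGE = nmem s STAGE" "rmem s4 SCALE = rmem s SCALE"
          "rmem s4 SHIFT = rmem s SHIFT" "rmem s4 SOL = rmem s1 SOL" "rmem s4 PHI = rmem s PHI"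
          "nmem s4 FUEL 0 = 4 * length xs" "nmem s4 BASE 0 = 0" "items s4 0 = []"
          by (simp_all add: s4_def f3 items_def)
        have \<sigma>': "unit_slope f (rmem s SCALE) (rmem s SHIFT) i (rmem s1 SOL i + real r) = \<sigma> i r" if "i \<in> set xs" for i r
          using sol1[OF that] by (simp add: \<sigma>_def)
        show ?thesis
          apply (simp add: runs_Seq runs_NSet runs_RSet init_search_def f3)
          apply (subst s4_def[symmetric])
          apply (rule runs_mono)
           apply (rule runs_pass[where xs = xs and C = "\<lambda>_. True" and f = f])
          subgoal using ch by (simp add: f4)
          subgoal by (rule d)
          subgoal by (simp add: unit_loop_def)
          subgoal by simp
          subgoal premises p5 for t5 s5
          proof -
            obtain m where t5: "t5 \<le> 7 * nmem s4 FUEL 0 + 3 * length xs + 2"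
              and fuel: "nmem s5 FUEL 0 + sum m (set xs) = nmem s4 FUEL 0"
              and m: "\<forall>i\<in>set xs. rmem s5 SOL i = rmem s4 SOL i + real (m i) \<and>
                (\<forall>r<m i. rmem s4 SOL i + real r < rmem s4 PHI i \<and> True) \<and>
                (rmem s4 PHI i \<le> rmem s4 SOL i + real (m i) \<or> nmem s5 FUEL 0 = 0 \<or> \<not> True)"
              and it: "nmem s4 BASE 0 = 0 \<longrightarrow> items s5 0 = items s4 0 @ concat (map (\<lambda>i. map
                (\<lambda>r. (unit_slope f (rmem s4 SCALE) (rmem s4 SHIFT) i (rmem s4 SOL i + real r), 0, 1)) [0..<m i]) xs)"
              and fn5: "\<forall>k. k \<notin> {LEN, FUEL, PTR} \<longrightarrow> nmem s5 k = nmem s4 k"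
              and fr5: "\<forall>k. k \<notin> {SOL, KEY, SLP, OFF} \<longrightarrow> rmem s5 k = rmem s4 k"
              using p5 by (elim exE conjE) (rule that; assumption)
            have "items s5 0 = concat (map (\<lambda>i. map
                (\<lambda>r. (unit_slope f (rmem s SCALE) (rmem s SHIFT) i (rmem s1 SOL i + real r), 0, 1)) [0..<m i]) xs)"
              using it by (simp add: f4)
            also have "\<dots> = unit_items \<sigma> m xs"
              unfolding unit_items_def by (intro arg_cong[where f = concat] map_cong refl) (simp add: \<sigma>')
            finally have it5: "items s5 0 = unit_items \<sigma> m xs" .
            have "length (items s5 0) = nmem s5 LEN 0" by (simp add: items_def)
            then have len: "nmem s5 LEN 0 \<le> 4 * length xs"
              using fuel length_unit_items[OF d, of \<sigma> m] by (simp add: it5 f4)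
            have g5: "rmem s5 GOAL 0 = rmem s3 TARGET 0" "rmem s5 TARGET 0 = rmem s3 TARGET 0" "rmem s5 SSLP 0 = 0" "rmem s5 SOFF 0 = 0"
              "nmem s5 DEPTH 0 = 0"
              using fr5 fn5 by (simp_all add: s4_def)
            \<comment> \<open>If fuel remains, each activity has stopped at the top of its window.
              If none remains, as many units as the cap allows have been listed, and the windows
              contain no more than that.\<close>
            have mw: "unit_items \<sigma> m xs = unit_items \<sigma> w xs"
              if w: "\<forall>i\<in>set xs. rmem s PHI i = rmem s PLO i + real (w i)" "sum w (set xs) \<le> 4 * length xs" for w
            proof -
              have le: "m i \<le> w i" if "i \<in> set xs" for i
                using m w(1) that sol1[OF that] by (cases "m i") (auto simp: f4 dest!: spec[of _ "m i - 1"])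
              have "m i = w i" if i: "i \<in> set xs" for i
              proof (cases "nmem s5 FUEL 0 = 0")
                case True
                then have "sum m (set xs) = sum w (set xs)"
                  using fuel w(2) sum_mono[of "set xs" m w, OF le] by (simp add: f4)
                from sum_mono_inv[OF this le i] show ?thesis by simp
              next
                case False
                then have "w i \<le> m i" using m w(1) i sol1[OF i] by (auto simp: f4)
                with le[OF i] show ?thesis by simp
              qed
              then show ?thesis unfolding unit_items_def by (intro arg_cong[where f = concat] map_cong) auto
            qed
            show ?thesis
              apply (rule runs_mono)
               apply (rule runs_search_init)
              subgoal by (rule g5)
              subgoal by (rule g5)
              subgoal by (rule g5)
              subgoal premises p6 for t6 s6
              proof -
                have t6: "t6 \<le> 300 * nmem s5 LEN 0 + 5"
                  and cr: "crossing (items s5 0) (rmem s5 GOAL 0) (rmem s6 RES 0)"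
                  and fn6: "\<forall>k. k \<notin> {DEPTH..SRC} \<longrightarrow> nmem s6 k = nmem s5 k"
                  and fr6: "\<forall>k. k \<notin> {KEY..TMP2} \<longrightarrow> rmem s6 k = rmem s5 k"
                  using p6 by blast+
                have tg6: "rmem s6 TARGET 0 = rmem s3 TARGET 0" using fr6 g5 by simp
                have "nmem s6 CNT 0 = 4 * length xs" using fn6 fn5 by (simp add: s4_def f3)
                moreover have "crossing (unit_items \<sigma> w xs) (rmem s6 TARGET 0) (rmem s6 RES 0)"
                  if "(\<forall>i\<in>set xs. rmem s PHI i = rmem s PLO i + real (w i)) \<and> sum w (set xs) \<le> 4 * length xs" for w
                  using cr mw[of w] that unfolding it5 g5 tg6 by simp
                moreover have "nmem s6 k = nmem s k" if "k \<notin> {PTR..CNT}" for k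
                proof -
                  have "k \<notin> {DEPTH..SRC}" "k \<notin> {LEN, FUEL, PTR}" "k \<notin> {DEPTH, BASE, CNT}" using that by auto
                  then show ?thesis using fn6 fn5 fn3[of k] fn1[of k] by (simp add: s4_def s2_def)
                qed
                moreover have "rmem s6 k = rmem s k" if "k \<notin> {SOL, TARGET} \<union> {KEY..TMP2}" for k
                proof -
                  have "k \<notin> {KEY..TMP2}" "k \<notin> {SOL, KEY, SLP, OFF}" "k \<notin> {GOAL, SSLP, SOFF, RES, TARGET, SOL}" using that by auto
                  then show ?thesis using fr6 fr5 f3(4)[of k] by (simp add: s4_def)
                qed
                moreover have "t1 + t3 + t5 + t6 + 20 \<le> 1240 * length xs + 40"
                  using t1 t3 t5 t6 len by (simp add: f4)
                ultimately show ?thesis using tg tg6 by simp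
              qed
              done
          qed
          done
      qed
      done
  qed
  done

lemma runs_fill_units:
  fixes s :: state and f :: "real \<Rightarrow> real"
  assumes ch: "chain (nmem s NEXT) (nmem s STAGE 0) xs" and d: "distinct xs"
    and k: "nmem s CNT 0 = 4 * length xs"
  defines "\<sigma> \<equiv> (\<lambda>i r. unit_slope f (rmem s SCALE) (rmem s SHIFT) i (rmem s PLO i + real r))"
    and "J \<equiv> set xs" and "c \<equiv> rmem s RES 0"
  shows "runs (primitives Integral f) [search] fill_units s (\<lambda>t s'. t \<le> 80 * length xs + 10 \<and>
    (\<forall>w \<tau>. (\<forall>i\<in>J. rmem s PHI i = rmem s PLO i + real (w i)) \<and> rmem s TARGET 0 = real \<tau> \<and>
      \<tau> \<le> 4 * length xs \<and> (\<forall>i\<in>J. \<forall>r r'. r \<le> r' \<longrightarrow> \<sigma> i r \<le> \<sigma> i r') \<and>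
      (\<Sum>i\<in>J. card {r. r < w i \<and> \<sigma> i r < c}) \<le> \<tau> \<and> \<tau> \<le> (\<Sum>i\<in>J. card {r. r < w i \<and> \<sigma> i r \<le> c}) \<longrightarrow>
      (\<exists>m. (\<forall>i\<in>J. rmem s' SOL i = rmem s PLO i + real (m i) \<and> m i \<le> w i \<and>
        (\<forall>r<m i. \<sigma> i r \<le> c) \<and> (\<forall>r. m i \<le> r \<longrightarrow> r < w i \<longrightarrow> c \<le> \<sigma> i r)) \<and> sum m J = \<tau>)))"
  unfolding fill_units_def
  apply (rule runs_SeqI)
   apply (rule runs_set_fuel)
  subgoal premises p1 for t1 s1
  proof -
    have t1: "t1 \<le> 8 * length xs + 2" and fu1: "nmem s1 FUEL 0 \<le> 4 * length xs"
      "\<And>\<tau>. rmem s TARGET 0 = real \<tau> \<Longrightarrow> \<tau> \<le> 4 * length xs \<Longrightarrow> nmem s1 FUEL 0 = \<tau>"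
      and fn1: "\<And>k. k \<noteq> FUEL \<Longrightarrow> nmem s1 k = nmem s k" and fr1: "rmem s1 = rmem s"
      using p1 by (simp_all add: k)
    show ?thesis
      apply (rule runs_SeqI)
       apply (rule runs_assign[where xs = xs and k = SOL and C = 1 and g = "rmem s PLO"])
      subgoal using ch by (simp add: fn1)
      subgoal by simp
      subgoal by (simp add: runs_simps fr1)
      subgoal premises p2 for t2 s2
      proof -
        have fn2: "\<And>j. j \<noteq> PTR \<Longrightarrow> nmem s2 j = nmem s1 j" and fr2: "\<And>j. j \<noteq> SOL \<Longrightarrow> rmem s2 j = rmem s j"
          and sol2: "\<And>i. i \<in> J \<Longrightarrow> rmem s2 SOL i = rmem s PLO i" and t2: "t2 \<le> 3 * length xs + 2"
          using p2 by (auto simp: fr1 J_def)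
        have f2: "nmem s2 NEXT = nmem s NEXT" "nmem s2 STAGE = nmem s STAGE" "nmem s2 FUEL 0 = nmem s1 FUEL 0"
          "rmem s2 SCALE = rmem s SCALE" "rmem s2 SHIFT = rmem s SHIFT" "rmem s2 PHI = rmem s PHI" "rmem s2 RES 0 = c" "rmem s2 RES = rmem s RES"
          using fn2 fn1 fr2 by (simp_all add: c_def)
        show ?thesis
          apply (rule runs_SeqI)
           apply (rule runs_pass[where xs = xs and C = "\<lambda>v. v < c" and f = f])
          subgoal using ch by (simp add: f2)
          subgoal by (rule d)
          subgoal by (simp add: unit_loop_def)
          subgoal by (simp add: f2 c_def)
          subgoal premises p3 for t3 s3
          proof -
            obtain m1 where t3: "t3 \<le> 7 * nmem s2 FUEL 0 + 3 * length xs + 2"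
              and fuel3: "nmem s3 FUEL 0 + sum m1 (set xs) = nmem s2 FUEL 0"
              and m1: "\<forall>i\<in>set xs. rmem s3 SOL i = rmem s2 SOL i + real (m1 i) \<and>
                (\<forall>r<m1 i. rmem s2 SOL i + real r < rmem s2 PHI i \<and>
                  unit_slope f (rmem s2 SCALE) (rmem s2 SHIFT) i (rmem s2 SOL i + real r) < c) \<and>
                (rmem s2 PHI i \<le> rmem s2 SOL i + real (m1 i) \<or> nmem s3 FUEL 0 = 0 \<or>
                  \<not> unit_slope f (rmem s2 SCALE) (rmem s2 SHIFT) i (rmem s2 SOL i + real (m1 i)) < c)"
              and fn3: "\<forall>k. k \<notin> {LEN, FUEL, PTR} \<longrightarrow> nmem s3 k = nmem s2 k"
              and fr3: "\<forall>k. k \<notin> {SOL, KEY, SLP, OFF} \<longrightarrow> rmem s3 k = rmem s2 k"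
              using p3 by (elim exE conjE) (rule that; assumption)
            have f3: "nmem s3 NEXT = nmem s NEXT" "nmem s3 STAGE = nmem s STAGE"
              "rmem s3 SCALE = rmem s SCALE" "rmem s3 SHIFT = rmem s SHIFT" "rmem s3 PHI = rmem s PHI" "rmem s3 RES = rmem s RES"
              using fn3 fr3 by (simp_all add: f2)
            have sol3: "rmem s3 SOL i = rmem s PLO i + real (m1 i)" if "i \<in> J" for i
              using m1 sol2[OF that] that by (simp add: J_def)
            show ?thesis
              apply (rule runs_mono)
               apply (rule runs_pass[where xs = xs and C = "\<lambda>v. \<not> c < v" and f = f])
              subgoal using ch by (simp add: f3)
              subgoal by (rule d)
              subgoal by (simp add: unit_loop_def)
              subgoal by (simp add: f3 c_def)
              subgoal premises p4 for t4 s4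
              proof -
                obtain m2 where t4: "t4 \<le> 7 * nmem s3 FUEL 0 + 3 * length xs + 2"
                  and fuel4: "nmem s4 FUEL 0 + sum m2 (set xs) = nmem s3 FUEL 0"
                  and m2: "\<forall>i\<in>set xs. rmem s4 SOL i = rmem s3 SOL i + real (m2 i) \<and>
                    (\<forall>r<m2 i. rmem s3 SOL i + real r < rmem s3 PHI i \<and>
                      \<not> c < unit_slope f (rmem s3 SCALE) (rmem s3 SHIFT) i (rmem s3 SOL i + real r)) \<and>
                    (rmem s3 PHI i \<le> rmem s3 SOL i + real (m2 i) \<or> nmem s4 FUEL 0 = 0 \<or>
                      \<not> \<not> c < unit_slope f (rmem s3 SCALE) (rmem s3 SHIFT) i (rmem s3 SOL i + real (m2 i)))"
                  using p4 by (elim exE conjE) (rule that; assumption)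
                have "t1 + (t2 + (t3 + t4)) \<le> 80 * length xs + 10"
                  using t1 t2 t3 t4 fu1(1) fuel3 by (simp add: f2)
                moreover have "\<exists>m. (\<forall>i\<in>J. rmem s4 SOL i = rmem s PLO i + real (m i) \<and> m i \<le> w i \<and>
                  (\<forall>r<m i. \<sigma> i r \<le> c) \<and> (\<forall>r. m i \<le> r \<longrightarrow> r < w i \<longrightarrow> c \<le> \<sigma> i r)) \<and> sum m J = \<tau>"
                  if w: "\<forall>i\<in>J. rmem s PHI i = rmem s PLO i + real (w i)"
                    and \<tau>: "rmem s TARGET 0 = real \<tau>" "\<tau> \<le> 4 * length xs"
                    and mono: "\<forall>i\<in>J. \<forall>r r'. r \<le> r' \<longrightarrow> \<sigma> i r \<le> \<sigma> i r'"
                    and lt: "(\<Sum>i\<in>J. card {r. r < w i \<and> \<sigma> i r < c}) \<le> \<tau>"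
                    and le: "\<tau> \<le> (\<Sum>i\<in>J. card {r. r < w i \<and> \<sigma> i r \<le> c})" for w \<tau>
                proof -
                  have pass1: "\<And>i r. i \<in> J \<Longrightarrow> r < m1 i \<Longrightarrow> r < w i \<and> \<sigma> i r < c"
                    "\<And>i. i \<in> J \<Longrightarrow> w i \<le> m1 i \<or> nmem s3 FUEL 0 = 0 \<or> c \<le> \<sigma> i (m1 i)"
                    using m1 w sol2 by (auto simp: J_def f2 \<sigma>_def not_less)
                  have pass2: "\<And>i r. i \<in> J \<Longrightarrow> r < m2 i \<Longrightarrow> m1 i + r < w i \<and> \<sigma> i (m1 i + r) \<le> c"
                    "\<And>i. i \<in> J \<Longrightarrow> w i \<le> m1 i + m2 i \<or> nmem s4 FUEL 0 = 0 \<or> c < \<sigma> i (m1 i + m2 i)"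
                    using m2 w sol3 by (auto simp: J_def f3 \<sigma>_def not_less add.assoc simp flip: of_nat_add)
                  have fin: "finite J" by (simp add: J_def)
                  \<comment> \<open>The fuel left after a pass is the number of units not yet
                    distributed, the quantities \<open>\<rho>1\<close> and \<open>\<rho>2\<close> of
                    the counting argument.\<close>
                  have s1: "nmem s3 FUEL 0 + sum m1 J = \<tau>" using fuel3 fu1(2)[OF \<tau>] by (simp add: f2 J_def)
                  have s2: "nmem s4 FUEL 0 + sum m2 J = nmem s3 FUEL 0" using fuel4 by (simp add: J_def)
                  note tp = two_passes[where \<sigma> = \<sigma> and J = J and c = c, OF fin _ lt le pass1(1) s1 pass1(2) pass2(1) s2 pass2(2)]
                  have "rmem s4 SOL i = rmem s PLO i + real (m1 i + m2 i)" if "i \<in> J" for i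
                    using m2 sol3[OF that] that by (simp add: J_def)
                  then show ?thesis using tp mono by (intro exI[of _ "\<lambda>i. m1 i + m2 i"]) simp
                qed
                ultimately show ?thesis by blast
              qed
              done
          qed
          done
      qed
      done
  qed
  done

lemma integral_stage_correct: "correct_stage Integral 2600 integral_stage"
  unfolding correct_stage_def
proof (intro conjI allI impI)
  show "nwrites {DEPTH..SRC} integral_stage \<subseteq> {PTR..}" "rwrites {KEY..TMP2} integral_stage \<subseteq> insert SOL {KEY..}"
    using level_writes
    by (auto simp: integral_stage_def window_def tally_def lower_target_def upper_target_def
        rounded_level_def clip_com_def price_units_def init_search_def unit_loop_def fill_units_def
        set_fuel_def foreach_def)
next
  fix f :: "real \<Rightarrow> real" and s :: state and xs
  assume f: "convex_on UNIV f" and ch: "chain (nmem s NEXT) (nmem s STAGE 0) xs" and d: "distinct xs"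
    and pos: "\<forall>i\<in>set xs. 0 < rmem s SCALE i"
  define l u a b T J where "l = rmem s LO" and "u = rmem s HI" and "a = rmem s SCALE"
    and "b = rmem s SHIFT" and "T = rmem s TOTAL 0" and "J = set xs"
  have fin: "finite J" by (simp add: J_def)
  have cJ: "card J = length xs" by (simp add: J_def distinct_card[OF d])
  show "runs (primitives Integral f) [search] integral_stage s (\<lambda>t s'. t \<le> 2600 * (length xs + 1) \<and>
    solves_stage Integral f xs s (rmem s' SOL))"
    unfolding integral_stage_def
    apply (rule runs_SeqI)
     apply (rule runs_window[OF ch d])
    subgoal premises p1 for t1 s1
    proof -
      have t1: "t1 \<le> 1260 * length xs + 60" and k1: "nmem s1 CNT 0 = length xs"
        and win: "(\<forall>i\<in>J. 0 < a i \<and> l i \<le> u i) \<and> sum l J \<le> T \<and> T \<le> sum u J \<longrightarrow>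
          (\<exists>y1 y2. (\<forall>i\<in>J. rmem s1 PLO i = of_int \<lfloor>clip (l i) (u i) (a i * (y1 - b i))\<rfloor> \<and>
              rmem s1 PHI i = of_int \<lceil>clip (l i) (u i) (a i * (y2 - b i))\<rceil>) \<and>
            (\<Sum>i\<in>J. clip (l i) (u i) (a i * (y1 - b i))) = max (sum l J) (T - card J) \<and>
            (\<Sum>i\<in>J. clip (l i) (u i) (a i * (y2 - b i))) = min (sum u J) (T + card J))"
        and fn1: "\<forall>k. k \<notin> {PTR..CNT} \<longrightarrow> nmem s1 k = nmem s k"
        and fr1: "\<forall>k. k \<notin> {KEY..TMP2} \<union> {TARGET..SUMH} \<longrightarrow> rmem s1 k = rmem s k"
        using p1[folded l_def u_def a_def b_def T_def J_def] by - (elim conjE, assumption)+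
      have f1: "nmem s1 NEXT = nmem s NEXT" "nmem s1 STAGE = nmem s STAGE" "rmem s1 SCALE = a"
        "rmem s1 SHIFT = b" "rmem s1 TOTAL 0 = T"
        using fn1 fr1 by (simp_all add: a_def b_def T_def)
      define p q where "p = rmem s1 PLO" and "q = rmem s1 PHI"
      define \<sigma> where "\<sigma> = (\<lambda>i r. unit_slope f a b i (p i + real r))"
      show ?thesis
        apply (rule runs_SeqI)
         apply (rule runs_price_units[where xs = xs])
        subgoal using ch by (simp add: f1)
        subgoal by (rule d)
        subgoal by (rule k1)
        subgoal premises p2 for t2 s2
        proof -
          have t2: "t2 \<le> 1240 * length xs + 40" and k2: "nmem s2 CNT 0 = 4 * length xs"
            and tg2: "rmem s2 TARGET 0 = T - sum p J"
            and cr: "\<forall>w. (\<forall>i\<in>J. q i = p i + real (w i)) \<and> sum w J \<le> 4 * length xs \<longrightarrow>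
              crossing (unit_items \<sigma> w xs) (rmem s2 TARGET 0) (rmem s2 RES 0)"
            and fn2: "\<forall>k. k \<notin> {PTR..CNT} \<longrightarrow> nmem s2 k = nmem s1 k"
            and fr2: "\<forall>k. k \<notin> {SOL, TARGET} \<union> {KEY..TMP2} \<longrightarrow> rmem s2 k = rmem s1 k"
            using p2[unfolded f1 p_def[symmetric] q_def[symmetric] J_def[symmetric], folded \<sigma>_def] by - (elim conjE, assumption)+
          have f2: "nmem s2 NEXT = nmem s NEXT" "nmem s2 STAGE = nmem s STAGE" "rmem s2 SCALE = a"
            "rmem s2 SHIFT = b" "rmem s2 PLO = p" "rmem s2 PHI = q"
            using fn2 fr2 by (simp_all add: f1 p_def q_def)
          define c where "c = rmem s2 RES 0"
          show ?thesis
            apply (rule runs_mono)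
             apply (rule runs_fill_units[where xs = xs])
            subgoal using ch by (simp add: f2)
            subgoal by (rule d)
            subgoal by (rule k2)
            subgoal premises p3 for t3 s3
            proof -
              have t3: "t3 \<le> 80 * length xs + 10"
                and fill: "\<forall>w \<tau>. (\<forall>i\<in>J. q i = p i + real (w i)) \<and> rmem s2 TARGET 0 = real \<tau> \<and>
                  \<tau> \<le> 4 * length xs \<and> (\<forall>i\<in>J. \<forall>r r'. r \<le> r' \<longrightarrow> \<sigma> i r \<le> \<sigma> i r') \<and>
                  (\<Sum>i\<in>J. card {r. r < w i \<and> \<sigma> i r < c}) \<le> \<tau> \<and> \<tau> \<le> (\<Sum>i\<in>J. card {r. r < w i \<and> \<sigma> i r \<le> c}) \<longrightarrow>
                  (\<exists>m. (\<forall>i\<in>J. rmem s3 SOL i = p i + real (m i) \<and> m i \<le> w i \<and>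
                    (\<forall>r<m i. \<sigma> i r \<le> c) \<and> (\<forall>r. m i \<le> r \<longrightarrow> r < w i \<longrightarrow> c \<le> \<sigma> i r)) \<and> sum m J = \<tau>)"
                using p3[unfolded f2 J_def[symmetric] c_def[symmetric]] unfolding \<sigma>_def by - (elim conjE, assumption)+
              have "sum (rmem s3 SOL) J = T \<and> (\<exists>c. priced \<int> (cost f a b) l u J (rmem s3 SOL) c)"
                if ok: "\<forall>i\<in>J. l i \<in> \<int> \<and> u i \<in> \<int> \<and> l i \<le> u i" and Ti: "T \<in> \<int>"
                  and T: "sum l J \<le> T" "T \<le> sum u J"
              proof -
                have ok': "0 < a i \<and> l i \<in> \<int> \<and> u i \<in> \<int> \<and> l i \<le> u i" "0 < a i \<and> l i \<le> u i" if "i \<in> J" for i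
                  using ok pos that by (auto simp: a_def J_def)
                from win[THEN mp] ok'(2) T have "\<exists>y1 y2. (\<forall>i\<in>J. p i = of_int \<lfloor>clip (l i) (u i) (a i * (y1 - b i))\<rfloor> \<and>
                      q i = of_int \<lceil>clip (l i) (u i) (a i * (y2 - b i))\<rceil>) \<and>
                    (\<Sum>i\<in>J. clip (l i) (u i) (a i * (y1 - b i))) = max (sum l J) (T - card J) \<and>
                    (\<Sum>i\<in>J. clip (l i) (u i) (a i * (y2 - b i))) = min (sum u J) (T + card J)"
                  by (simp add: p_def q_def)
                then obtain y1 y2 where pq: "\<forall>i\<in>J. p i = of_int \<lfloor>clip (l i) (u i) (a i * (y1 - b i))\<rfloor> \<and>
                    q i = of_int \<lceil>clip (l i) (u i) (a i * (y2 - b i))\<rceil>"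
                  and sums: "(\<Sum>i\<in>J. clip (l i) (u i) (a i * (y1 - b i))) = max (sum l J) (T - card J)"
                    "(\<Sum>i\<in>J. clip (l i) (u i) (a i * (y2 - b i))) = min (sum u J) (T + card J)"
                  by (elim exE conjE) (rule that; assumption)
                have p': "p i = of_int \<lfloor>clip (l i) (u i) (a i * (y1 - b i))\<rfloor>"
                  and q': "q i = of_int \<lceil>clip (l i) (u i) (a i * (y2 - b i))\<rceil>" if "i \<in> J" for i
                  using pq that by auto
                have ws: "p i \<le> q i" if "i \<in> J" for i
                  by (rule window_sums(1)[OF fin ok'(2) p' q' T sums that])
                have ws': "sum p J \<le> T" "T \<le> sum q J" "sum q J - sum p J \<le> 4 * card J"
                  by (rule window_sums(2-4)[OF fin ok'(2) p' q' T sums]; assumption)+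
                have int: "p i \<in> \<int>" "q i \<in> \<int>" if "i \<in> J" for i using p'[OF that] q'[OF that] by auto
                \<comment> \<open>Both ends of the window are integers, so the floor merely turns
                  the width into a natural number.\<close>
                define w where "w = (\<lambda>i. nat \<lfloor>q i - p i\<rfloor>)"
                have nat_floor: "real (nat \<lfloor>x\<rfloor>) = x" if "x \<in> \<int>" "0 \<le> x" for x :: real
                  using that by (auto elim!: Ints_cases)
                have w: "q i = p i + real (w i)" if "i \<in> J" for i
                  using nat_floor[of "q i - p i"] int[OF that] ws[OF that] by (simp add: w_def)
                have sw: "real (sum w J) = sum q J - sum p J"
                  using w by (simp add: sum_subtractf[symmetric])
                have w4: "sum w J \<le> 4 * length xs" using ws'(3) unfolding sw[symmetric] cJ by linarith
                \<comment> \<open>The number of units to be distributed above the lower ends of the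
                  windows.\<close>
                define \<tau> where "\<tau> = nat \<lfloor>T - sum p J\<rfloor>"
                have \<tau>: "real \<tau> = T - sum p J"
                  unfolding \<tau>_def by (rule nat_floor) (use int Ti ws'(1) in auto)
                have \<tau>w: "\<tau> \<le> sum w J" using \<tau> sw ws'(2) by linarith
                have mono: "\<sigma> i r \<le> \<sigma> i r'" if "i \<in> J" "r \<le> r'" for i r r'
                proof (cases "r = r'")
                  case False
                  then have "p i + real r + 1 \<le> p i + real r'" using that(2) by simp
                  from slope_mono[where a = a and b = b and i = i, OF f _ this] ok'(2)[OF that(1)] show ?thesis
                    by (simp add: \<sigma>_def unit_slope_def)
                qed simp
                \<comment> \<open>As a quantile of the slopes, \<open>c\<close> has at most
                  \<open>\<tau>\<close> units strictly below it and at least \<open>\<tau>\<close>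
                  units at or below it, which is what the two passes require.\<close>
                have "crossing (unit_items \<sigma> w xs) (real \<tau>) c"
                  using cr[THEN spec, of w] w w4 by (simp add: tg2 \<tau> c_def)
                note cu = crossing_unit[OF this]
                have unit: "snd x = (0, 1)" if "x \<in> set (unit_items \<sigma> w xs)" for x
                  using that by (auto simp: unit_items_def)
                have lx: "real \<tau> \<le> real (length (unit_items \<sigma> w xs))"
                  using \<tau>w by (simp only: length_unit_items[OF d] J_def of_nat_le_iff)
                have lt: "(\<Sum>i\<in>J. card {r. r < w i \<and> \<sigma> i r < c}) \<le> \<tau>"
                  using cu(1)[OF unit of_nat_0_le_iff lx]
                  by (simp only: count_unit_items[OF d, of "\<lambda>k. k < c" \<sigma> w] J_def of_nat_le_iff)
                have le: "\<tau> \<le> (\<Sum>i\<in>J. card {r. r < w i \<and> \<sigma> i r \<le> c})"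
                  using cu(2)[OF unit of_nat_0_le_iff lx]
                  by (simp only: count_unit_items[OF d, of "\<lambda>k. k \<le> c" \<sigma> w] J_def of_nat_le_iff)
                have t4: "\<tau> \<le> 4 * length xs" using \<tau>w w4 by simp
                have tg: "rmem s2 TARGET 0 = real \<tau>" by (simp add: tg2 \<tau>)
                have w': "\<forall>i\<in>J. q i = p i + real (w i)" using w by simp
                have mono': "\<forall>i\<in>J. \<forall>r r'. r \<le> r' \<longrightarrow> \<sigma> i r \<le> \<sigma> i r'" using mono by simp
                obtain m where m: "\<forall>i\<in>J. rmem s3 SOL i = p i + real (m i) \<and> m i \<le> w i \<and>
                    (\<forall>r<m i. \<sigma> i r \<le> c) \<and> (\<forall>r. m i \<le> r \<longrightarrow> r < w i \<longrightarrow> c \<le> \<sigma> i r)" and sm: "sum m J = \<tau>"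
                  using fill[THEN spec, THEN spec, THEN mp, OF conjI[OF w' conjI[OF tg conjI[OF t4 conjI[OF mono' conjI[OF lt le]]]]]]
                  by (elim exE conjE) (rule that; assumption)
                have "sum (rmem s3 SOL) J = (\<Sum>i\<in>J. p i + real (m i))" using m by (intro sum.cong) auto
                also have "\<dots> = T" using \<tau> by (simp add: sum.distrib sm[symmetric])
                finally have ST: "sum (rmem s3 SOL) J = T" .
                have idx: "\<exists>r. v = p i + real r" if "i \<in> J" "v \<in> \<int>" "p i \<le> v" for i v
                  using nat_floor[of "v - p i"] int(1)[OF that(1)] that by (intro exI[of _ "nat \<lfloor>v - p i\<rfloor>"]) simp
                have "priced \<int> (cost f a b) p q J (rmem s3 SOL) c"
                proof (rule priced_units)
                  fix i assume i: "i \<in> J"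
                  show "p i \<in> \<int> \<and> rmem s3 SOL i \<in> \<int> \<and> p i \<le> rmem s3 SOL i \<and> rmem s3 SOL i \<le> q i"
                    using m i int(1)[OF i] w[OF i] by auto
                next
                  fix i v assume i: "i \<in> J" and v: "v \<in> \<int>" "p i \<le> v" "v < rmem s3 SOL i"
                  obtain r where r: "v = p i + real r" using idx[OF i v(1,2)] by blast
                  have "r < m i" using v(3) m i r by auto
                  then show "cost f a b i (v + 1) - cost f a b i v \<le> c"
                    using m i by (simp add: r \<sigma>_def unit_slope_def)
                next
                  fix i v assume i: "i \<in> J" and v: "v \<in> \<int>" "rmem s3 SOL i \<le> v" "v < q i"
                  have "p i \<le> v" using v(2) m i by auto
                  then obtain r where r: "v = p i + real r" using idx[OF i v(1)] by blast
                  have "m i \<le> r" "r < w i" using v m i r w[OF i] by auto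
                  then show "c \<le> cost f a b i (v + 1) - cost f a b i v"
                    using m i by (simp add: r \<sigma>_def unit_slope_def)
                qed
                \<comment> \<open>Up to here \<open>c\<close> prices only moves within the window;
                  now it is extended to the original bounds.\<close>
                from priced_window[OF f fin ok'(1) p' q' _ _ this] sums ST
                have "priced \<int> (cost f a b) l u J (rmem s3 SOL) c" by simp
                with ST show ?thesis by blast
              qed
              moreover have "t1 + (t2 + t3) \<le> 2600 * (length xs + 1)" using t1 t2 t3 by simp
              ultimately show ?thesis
                unfolding solves_stage_def domain_set_def l_def u_def a_def b_def T_def J_def by simp
            qed
            done
        qed
        done
    qed
    done
qed

section \<open>The allocation program\<close>

abbreviation "act \<equiv> ncell 4"
abbreviation "blk \<equiv> ncell 5"

text \<open>Head insertion into one list per block is a bucket sort and groups the activities in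
  linear time. The same sweep rounds the activity bounds into the domain, which leaves the feasible
  set as it is.\<close>

definition build_lists :: "(rexp \<Rightarrow> rexp) \<Rightarrow> (rexp \<Rightarrow> rexp) \<Rightarrow> com" where
  "build_lists up dn =
     nset 4 (NConst 1);;
     While (NLess act (NAdd (ncell 0) (NConst 1)))
       (NSet NEXT act (NGet HEAD (NGet 1 act));; NSet HEAD (NGet 1 act) act;;
        RSet LO act (up (RGet LO act));; RSet HI act (dn (RGet HI act));;
        nset 4 (NAdd act (NConst 1)))"

definition raise_lower :: "com \<Rightarrow> (rexp \<Rightarrow> rexp) \<Rightarrow> com" where
  "raise_lower stage up =
     rset SUML (rconst 0);; foreach (rset SUML (RAdd (rcell SUML) (RGet LO ptr)));;
     rset TOTAL (up (RGet BLO blk));; Cond (RLess (rcell TOTAL) (rcell SUML)) (rset TOTAL (rcell SUML)) Skip;;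
     stage;; foreach (RSet LO ptr (RGet SOL ptr))"

definition reduce_upper :: "com \<Rightarrow> (rexp \<Rightarrow> rexp) \<Rightarrow> com" where
  "reduce_upper stage dn =
     rset SUMH (rconst 0);; foreach (rset SUMH (RAdd (rcell SUMH) (RGet HI ptr)));;
     rset TOTAL (dn (RGet BHI blk));; Cond (RLess (rcell SUMH) (rcell TOTAL)) (rset TOTAL (rcell SUMH)) Skip;;
     stage;; foreach (RSet HI ptr (RGet SOL ptr))"

definition solve_blocks :: "com \<Rightarrow> (rexp \<Rightarrow> rexp) \<Rightarrow> (rexp \<Rightarrow> rexp) \<Rightarrow> com" where
  "solve_blocks stage up dn =
     nset 5 (NConst 1);;
     While (NLess blk (NAdd (NGet 0 (NConst 1)) (NConst 1)))
       (nset STAGE (NGet HEAD blk);; raise_lower stage up;; reduce_upper stage dn;;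
        nset 5 (NAdd blk (NConst 1)))"

text \<open>The block lists have served their purpose and are overwritten: with every activity
  pointing to its predecessor, the chain from n runs through all of them down to the null
  pointer.\<close>

definition link_all :: com where
  "link_all =
     nset 4 (NConst 1);;
     While (NLess act (NAdd (ncell 0) (NConst 1)))
       (NSet NEXT act (NSub act (NConst 1));; nset 4 (NAdd act (NConst 1)));;
     nset STAGE (ncell 0)"

definition allocate :: "com \<Rightarrow> (rexp \<Rightarrow> rexp) \<Rightarrow> (rexp \<Rightarrow> rexp) \<Rightarrow> com" where
  "allocate stage up dn =
     build_lists up dn;; solve_blocks stage up dn;; link_all;; rset TOTAL (rcell 1);; stage"

lemma runs_accumulate:
  assumes ch: "chain (nmem s NEXT) (nmem s STAGE 0) xs" and "k \<noteq> j"
  shows "runs pr ps (foreach (rset k (RAdd (rcell k) (RGet j ptr)))) s (\<lambda>t s'. t \<le> 3 * length xs + 2 \<and>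
    rmem s' k 0 = rmem s k 0 + (\<Sum>i\<leftarrow>xs. rmem s j i) \<and>
    (\<forall>i. i \<noteq> PTR \<longrightarrow> nmem s' i = nmem s i) \<and> (\<forall>i. i \<noteq> k \<longrightarrow> rmem s' i = rmem s i))"
proof -
  define J where "J = (\<lambda>ys (t::nat) (s'::state). t \<le> 3 * length ys \<and>
    rmem s' k 0 = rmem s k 0 + (\<Sum>i\<leftarrow>ys. rmem s j i) \<and>
    (\<forall>i. i \<noteq> PTR \<longrightarrow> nmem s' i = nmem s i) \<and> (\<forall>i. i \<noteq> k \<longrightarrow> rmem s' i = rmem s i))"
  show ?thesis
    apply (rule runs_foreach[where W = UNIV and J = J and xs = xs, OF ch])
    subgoal by simp
    subgoal by simp
    subgoal by simp
    subgoal by (simp add: J_def)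
    subgoal using \<open>k \<noteq> j\<close> by (auto simp: J_def runs_simps)
    subgoal by (simp add: J_def)
    done
qed

lemma chain_upd: "k \<notin> set xs \<Longrightarrow> chain (nx(k := v)) p xs = chain nx p xs"
  by (induction xs arbitrary: p) auto

text \<open>Both domains share everything but the stage and the rounding. \<open>U x\<close> is the
  least element of the domain above \<open>x\<close> and \<open>V x\<close> the greatest one below,
  so a point of the domain meets a bound iff it meets the rounded one. They are the identity over
  the reals, ceiling and floor over the integers.\<close>

locale allocation =
  fixes \<gamma> :: domain and f :: "real \<Rightarrow> real" and P :: gbc and C :: nat and stage :: com
    and up dn :: "rexp \<Rightarrow> rexp" and U V :: "real \<Rightarrow> real"
  assumes convex: "convex_on UNIV f" and inst: "gbc_instance P"
    and stage: "correct_stage \<gamma> C stage"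
    and up: "rval (primitives \<gamma> f) s (up e) = U (rval (primitives \<gamma> f) s e)"
    and dn: "rval (primitives \<gamma> f) s (dn e) = V (rval (primitives \<gamma> f) s e)"
    and U: "U x \<in> domain_set \<gamma>" "x \<le> U x" "z \<in> domain_set \<gamma> \<Longrightarrow> x \<le> z \<Longrightarrow> U x \<le> z"
    and V: "V x \<in> domain_set \<gamma>" "V x \<le> x" "z \<in> domain_set \<gamma> \<Longrightarrow> z \<le> x \<Longrightarrow> z \<le> V x"
begin

abbreviation "pr \<equiv> primitives \<gamma> f"
abbreviation "D \<equiv> domain_set \<gamma>"

definition "n = num_acts P"
definition "m = num_blocks P"
definition "B = block P"
definition "a = vec_array n (scale P)"
definition "b = vec_array n (shift P)"
definition "l i = U (vec_array n (act_lo P) i)"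
definition "u i = V (vec_array n (act_hi P) i)"

abbreviation "F \<equiv> cost f a b"

lemma sum_in_D: "(\<And>i. i \<in> J \<Longrightarrow> x i \<in> D) \<Longrightarrow> sum x J \<in> D"
  by (auto simp: domain_set_def intro: Ints_sum)

lemma a_pos: "i \<in> {1..n} \<Longrightarrow> 0 < a i"
  using inst by (auto simp: gbc_instance_def a_def vec_array_def n_def)

lemma part: "partition_on {1..n} (B ` {1..m})" and inj: "inj_on B {1..m}"
  using inst by (auto simp: gbc_instance_def n_def m_def B_def)

lemma B_sub: "j \<in> {1..m} \<Longrightarrow> B j \<subseteq> {1..n}" and B_ne: "j \<in> {1..m} \<Longrightarrow> B j \<noteq> {}"
  and B_union: "(\<Union>j\<in>{1..m}. B j) = {1..n}"
  using part by (auto simp: partition_on_def)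

lemma B_disj: "i \<in> {1..m} \<Longrightarrow> j \<in> {1..m} \<Longrightarrow> i \<noteq> j \<Longrightarrow> B i \<inter> B j = {}"
  using part inj by (auto simp: partition_on_def disjoint_def inj_on_eq_iff)

lemma B_fin: "j \<in> {1..m} \<Longrightarrow> finite (B j)"
  using B_sub finite_subset by blast

lemma sum_blocks:
  fixes g :: "nat \<Rightarrow> 'b::comm_monoid_add"
  shows "sum g {1..n} = (\<Sum>j\<in>{1..m}. sum g (B j))"
  unfolding B_union[symmetric] by (rule sum.UNION_disjoint) (use B_fin B_disj in auto)

text \<open>Every block contains an activity, and distinct blocks are disjoint. This is what pays
  for the constant overhead of each block in a bound that depends on \<open>n\<close> alone.\<close>

lemma m_le_n: "m \<le> n"
proof -
  have "m = (\<Sum>j\<in>{1..m}. 1)" by simp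
  also have "\<dots> \<le> (\<Sum>j\<in>{1..m}. sum (\<lambda>_. 1) (B j))"
    by (rule sum_mono) (use B_fin B_ne in \<open>auto simp: Suc_le_eq card_gt_0_iff\<close>)
  also have "\<dots> = n" unfolding sum_blocks[symmetric] by simp
  finally show ?thesis .
qed

lemma block_index_eq: "j \<in> {1..m} \<Longrightarrow> i \<in> B j \<Longrightarrow> block_index P i = j"
proof -
  assume j: "j \<in> {1..m}" "i \<in> B j"
  have "(THE j. j \<in> {1..num_blocks P} \<and> i \<in> block P j) = j"
    using j B_disj by (intro the_equality) (auto simp: m_def B_def)
  then show ?thesis using B_sub[OF j(1)] j(2) by (auto simp: block_index_def n_def)
qed

lemma block_index_mem:
  assumes "i \<in> {1..n}" shows "block_index P i \<in> {1..m}" "i \<in> B (block_index P i)"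
proof -
  obtain j where "j \<in> {1..m}" "i \<in> B j" using assms B_union by blast
  then show "block_index P i \<in> {1..m}" "i \<in> B (block_index P i)" using block_index_eq by auto
qed

lemma runs_stage:
  assumes "chain (nmem s NEXT) (nmem s STAGE 0) xs" "distinct xs" "set xs \<subseteq> {1..n}" "rmem s SCALE = a"
  shows "runs pr [search] stage s (\<lambda>t s'. t \<le> C * (length xs + 1) \<and> solves_stage \<gamma> f xs s (rmem s' SOL) \<and>
    (\<forall>k. k < PTR \<longrightarrow> nmem s' k = nmem s k) \<and> (\<forall>k. k \<notin> insert SOL {KEY..} \<longrightarrow> rmem s' k = rmem s k))"
proof -
  note st = stage[unfolded correct_stage_def]
  have "runs pr [search] stage s (\<lambda>t s'. t \<le> C * (length xs + 1) \<and> solves_stage \<gamma> f xs s (rmem s' SOL))"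
    by (rule st[THEN conjunct2, THEN conjunct2, THEN spec, THEN spec, THEN spec, THEN mp, THEN mp, THEN mp, THEN mp])
      (use convex assms a_pos in auto)
  from runs_frame_search[OF this st[THEN conjunct1] st[THEN conjunct2, THEN conjunct1]] show ?thesis
    by (rule runs_mono) auto
qed

definition inputs_kept :: "state \<Rightarrow> bool" where
  "inputs_kept s \<longleftrightarrow> nmem s 0 0 = n \<and> nmem s 0 1 = m \<and> rmem s 1 0 = resource P \<and>
     (\<forall>j\<in>{1..m}. rmem s BLO j = block_lo P j \<and> rmem s BHI j = block_hi P j) \<and>
     rmem s SCALE = a \<and> rmem s SHIFT = b"

lemma inputs_kept_frame:
  "inputs_kept s \<Longrightarrow> (nmem s' 0 = nmem s 0) \<Longrightarrow> (\<And>k. k \<in> {1, BLO, BHI, SCALE, SHIFT} \<Longrightarrow> rmem s' k = rmem s k) \<Longrightarrow>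
    inputs_kept s'"
  by (simp add: inputs_kept_def)

lemma runs_build_lists:
  "runs pr [search] (build_lists up dn) (input_state P) (\<lambda>t s'. t \<le> 6 * n + 2 \<and> inputs_kept s' \<and>
    (\<forall>j\<in>{1..m}. \<exists>xs. chain (nmem s' NEXT) (nmem s' HEAD j) xs \<and> distinct xs \<and> set xs = B j) \<and>
    (\<forall>i\<in>{1..n}. rmem s' LO i = l i \<and> rmem s' HI i = u i))"
proof -
  define s where "s = input_state P"
  have s0: "nmem s 0 0 = n" "nmem s 1 = block_index P" "nmem s HEAD = (\<lambda>_. 0)"
    "rmem s LO = vec_array n (act_lo P)" "rmem s HI = vec_array n (act_hi P)"
    by (simp_all add: s_def input_state_def n_def)
  have kept: "inputs_kept s"
    by (auto simp: s_def input_state_def inputs_kept_def n_def m_def a_def b_def vec_array_def)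
  \<comment> \<open>The loop starts at activity 1 and takes 6 steps per round; adding 6 on the left
    avoids a truncated subtraction.\<close>
  define J where "J = (\<lambda>(t::nat) (s'::state). \<exists>k. t + 6 = 6 * k \<and> nmem s' 4 0 = k \<and> 1 \<le> k \<and> k \<le> n + 1 \<and>
    nmem s' 0 = nmem s 0 \<and> nmem s' 1 = nmem s 1 \<and> (\<forall>k. k \<notin> {LO, HI} \<longrightarrow> rmem s' k = rmem s k) \<and>
    (\<forall>j\<in>{1..m}. \<exists>xs. chain (nmem s' NEXT) (nmem s' HEAD j) xs \<and> distinct xs \<and> set xs = B j \<inter> {1..<k}) \<and>
    (\<forall>i\<in>{1..n}. rmem s' LO i = (if i < k then l i else rmem s LO i) \<and>
      rmem s' HI i = (if i < k then u i else rmem s HI i)))"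
  show ?thesis
    unfolding build_lists_def s_def[symmetric]
    apply (simp add: runs_simps)
    apply (rule runs_While[where J = J and \<mu> = "\<lambda>s. Suc n - nmem s 4 0"])
    subgoal unfolding J_def
      by (rule exI[of _ 1]) (auto simp: s0 intro!: exI[of _ "[]"])
    subgoal premises prems for t s1
    proof -
      obtain k where k: "t + 6 = 6 * k" "nmem s1 4 0 = k" "1 \<le> k" "k \<le> n + 1"
        and f1: "nmem s1 0 = nmem s 0" "nmem s1 1 = nmem s 1" "\<forall>k. k \<notin> {LO, HI} \<longrightarrow> rmem s1 k = rmem s k"
        and lists: "\<forall>j\<in>{1..m}. \<exists>xs. chain (nmem s1 NEXT) (nmem s1 HEAD j) xs \<and> distinct xs \<and> set xs = B j \<inter> {1..<k}"
        and bnd: "\<forall>i\<in>{1..n}. rmem s1 LO i = (if i < k then l i else rmem s LO i) \<and>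
          rmem s1 HI i = (if i < k then u i else rmem s HI i)"
        using prems(1) unfolding J_def by (elim exE conjE) (rule that; assumption)
      have kn: "k \<in> {1..n}" using prems(2) k by (simp add: f1 s0)
      define q where "q = block_index P k"
      have q: "q \<in> {1..m}" "k \<in> B q" using block_index_mem[OF kn] by (simp_all add: q_def)
      have f1': "nmem s1 (Suc 0) = block_index P" using f1 s0 by simp
      have bk: "rmem s1 LO k = vec_array n (act_lo P) k" "rmem s1 HI k = vec_array n (act_hi P) k"
        using bnd kn by (auto simp: s0)
      show ?thesis
        apply (simp add: runs_simps k(2) f1' q_def[symmetric] up dn bk)
        apply (rule conjI)
        subgoal
        proof -
          show ?thesis (is "J _ ?s2")
            unfolding J_def
          proof (intro exI[of _ "Suc k"] conjI)
            show "\<forall>j\<in>{1..m}. \<exists>xs. chain (nmem ?s2 NEXT) (nmem ?s2 HEAD j) xs \<and> distinct xs \<and> set xs = B j \<inter> {1..<Suc k}"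
            proof
              fix j assume j: "j \<in> {1..m}"
              obtain xs where xs: "chain (nmem s1 NEXT) (nmem s1 HEAD j) xs" "distinct xs" "set xs = B j \<inter> {1..<k}"
                using lists j by blast
              then have kx: "k \<notin> set xs" by auto
              show "\<exists>xs. chain (nmem ?s2 NEXT) (nmem ?s2 HEAD j) xs \<and> distinct xs \<and> set xs = B j \<inter> {1..<Suc k}"
              proof (cases "j = q")
                case True
                have "B q \<inter> {1..<Suc k} = insert k (B q \<inter> {1..<k})" using q(2) k(3) by (auto simp: less_Suc_eq)
                then have "set (k # xs) = B j \<inter> {1..<Suc k}" using xs(3) True by simp
                moreover have "chain (nmem ?s2 NEXT) (nmem ?s2 HEAD j) (k # xs)"
                  using xs(1) kx True k(3) by (simp add: chain_upd)
                ultimately show ?thesis using xs(2) kx by (intro exI[of _ "k # xs"]) simp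
              next
                case False
                then have "k \<notin> B j" using B_disj[OF j q(1)] q(2) by auto
                then have "B j \<inter> {1..<Suc k} = B j \<inter> {1..<k}" by (auto simp: less_Suc_eq)
                moreover have "chain (nmem ?s2 NEXT) (nmem ?s2 HEAD j) xs"
                  using xs(1) kx False by (simp add: chain_upd)
                ultimately show ?thesis using xs(2,3) by (intro exI[of _ xs]) simp
              qed
            qed
            show "\<forall>i\<in>{1..n}. rmem ?s2 LO i = (if i < Suc k then l i else rmem s LO i) \<and>
              rmem ?s2 HI i = (if i < Suc k then u i else rmem s HI i)"
              using bnd by (auto simp: l_def u_def less_Suc_eq)
          qed (use k f1 kn in simp_all)
        qed
        subgoal using kn by auto
        done
    qed
    subgoal premises prems for t s1
    proof -
      obtain k where k: "t + 6 = 6 * k" "nmem s1 4 0 = k" "1 \<le> k" "k \<le> n + 1"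
        and f1: "nmem s1 0 = nmem s 0" "nmem s1 1 = nmem s 1" "\<forall>k. k \<notin> {LO, HI} \<longrightarrow> rmem s1 k = rmem s k"
        and lists: "\<forall>j\<in>{1..m}. \<exists>xs. chain (nmem s1 NEXT) (nmem s1 HEAD j) xs \<and> distinct xs \<and> set xs = B j \<inter> {1..<k}"
        and bnd: "\<forall>i\<in>{1..n}. rmem s1 LO i = (if i < k then l i else rmem s LO i) \<and>
          rmem s1 HI i = (if i < k then u i else rmem s HI i)"
        using prems(1) unfolding J_def by (elim exE conjE) (rule that; assumption)
      have kn: "k = Suc n" using prems(2) k by (simp add: f1 s0)
      have "B j \<inter> {1..<k} = B j" if "j \<in> {1..m}" for j using B_sub[OF that] kn by auto
      then have "\<forall>j\<in>{1..m}. \<exists>xs. chain (nmem s1 NEXT) (nmem s1 HEAD j) xs \<and> distinct xs \<and> set xs = B j"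
        using lists by simp
      moreover have "inputs_kept s1" by (rule inputs_kept_frame[OF kept]) (use f1 in auto)
      ultimately show ?thesis using k kn bnd by auto
    qed
    done
qed

end

section \<open>Tightening the bounds within one block\<close>

context allocation
begin

text \<open>The truncation in \<open>T\<close> ensures that the current lower bounds do not exceed
  it in total, so \<open>T \<le> sum (rmem s HI) (B j)\<close> is what remains to be known about the
  total; feasibility will provide it.\<close>

lemma runs_raise_lower:
  assumes ch: "chain (nmem s NEXT) (nmem s STAGE 0) xs" and d: "distinct xs" and xs: "set xs = B j"
    and j: "j \<in> {1..m}" and kept: "inputs_kept s" and jj: "nmem s 5 0 = j"
  defines "T \<equiv> max (U (block_lo P j)) (sum (rmem s LO) (B j))"
  shows "runs pr [search] (raise_lower stage up) s (\<lambda>t s'. t \<le> (C + 9) * (length xs + 1) \<and>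
    ((\<forall>i\<in>B j. rmem s LO i \<in> D \<and> rmem s HI i \<in> D \<and> rmem s LO i \<le> rmem s HI i) \<and>
      T \<le> sum (rmem s HI) (B j) \<longrightarrow>
      sum (rmem s' LO) (B j) = T \<and> (\<exists>c. priced D F (rmem s LO) (rmem s HI) (B j) (rmem s' LO) c)) \<and>
    (\<forall>i. i \<notin> B j \<longrightarrow> rmem s' LO i = rmem s LO i) \<and>
    (\<forall>k. k < PTR \<longrightarrow> nmem s' k = nmem s k) \<and>
    (\<forall>k. k \<notin> {SOL, LO} \<union> {KEY..} \<longrightarrow> rmem s' k = rmem s k))"
  unfolding raise_lower_def
  apply (simp only: runs_Seq runs_RSet)
  apply (rule runs_mono)
   apply (rule runs_accumulate[where xs = xs])
  subgoal using ch by simp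
  subgoal by simp
  subgoal premises p1 for t1 s1
  proof -
    have t1: "t1 \<le> 3 * length xs + 2" and sl: "rmem s1 SUML 0 = sum (rmem s LO) (B j)"
      and fn1: "\<And>i. i \<noteq> PTR \<Longrightarrow> nmem s1 i = nmem s i" and fr1: "\<And>i. i \<noteq> SUML \<Longrightarrow> rmem s1 i = rmem s i"
      using p1 by (auto simp: xs[symmetric] sum.distinct_set_conv_list[OF d])
    have blo: "rmem s BLO j = block_lo P j" using kept j by (simp add: inputs_kept_def)
    define s2 where "s2 = rupd TOTAL 0 T s1"
    have tot: "rval pr s1 (up (RGet BLO blk)) = U (block_lo P j)"
      using fn1 fr1 by (simp add: up jj blo)
    have f2: "nmem s2 NEXT = nmem s NEXT" "nmem s2 STAGE = nmem s STAGE" "rmem s2 LO = rmem s LO"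
      "rmem s2 HI = rmem s HI" "rmem s2 SCALE = a" "rmem s2 SHIFT = b" "rmem s2 TOTAL 0 = T"
      using fn1 fr1 kept by (simp_all add: s2_def inputs_kept_def)
    have st: "runs pr [search] (stage;; foreach (RSet LO ptr (RGet SOL ptr))) s2 (\<lambda>t s'.
      t \<le> C * (length xs + 1) + 3 * length xs + 2 \<and>
      ((\<forall>i\<in>B j. rmem s LO i \<in> D \<and> rmem s HI i \<in> D \<and> rmem s LO i \<le> rmem s HI i) \<and>
      T \<le> sum (rmem s HI) (B j) \<longrightarrow>
      sum (rmem s' LO) (B j) = T \<and> (\<exists>c. priced D F (rmem s LO) (rmem s HI) (B j) (rmem s' LO) c)) \<and>
      (\<forall>i. i \<notin> B j \<longrightarrow> rmem s' LO i = rmem s LO i) \<and>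
      (\<forall>k. k < PTR \<longrightarrow> nmem s' k = nmem s k) \<and>
      (\<forall>k. k \<notin> {SOL, LO} \<union> {KEY..} \<longrightarrow> rmem s' k = rmem s k))"
      apply (rule runs_SeqI)
       apply (rule runs_stage[where xs = xs])
      subgoal using ch by (simp add: f2)
      subgoal by (rule d)
      subgoal using xs B_sub[OF j] by simp
      subgoal by (rule f2)
      subgoal premises p3 for t3 s3
      proof -
        have t3: "t3 \<le> C * (length xs + 1)" and sol: "solves_stage \<gamma> f xs s2 (rmem s3 SOL)"
          and fn3: "\<forall>k. k < PTR \<longrightarrow> nmem s3 k = nmem s2 k"
          and fr3: "\<forall>k. k \<notin> insert SOL {KEY..} \<longrightarrow> rmem s3 k = rmem s2 k"
          using p3 by - (elim conjE, assumption)+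
        show ?thesis
          apply (rule runs_mono)
           apply (rule runs_assign[where xs = xs and k = LO and C = 1 and g = "rmem s3 SOL"])
          subgoal using ch fn3 f2 by simp
          subgoal by simp
          subgoal by (simp add: runs_simps)
          subgoal premises p4 for t4 s4
          proof -
            have t4: "t4 \<le> 3 * length xs + 2" and fn4: "\<And>j. j \<noteq> PTR \<Longrightarrow> nmem s4 j = nmem s3 j"
              and fr4: "\<And>j. j \<noteq> LO \<Longrightarrow> rmem s4 j = rmem s3 j"
              and lo: "rmem s4 LO = (\<lambda>i. if i \<in> B j then rmem s3 SOL i else rmem s3 LO i)"
              using p4 by (auto simp: xs)
            have "sum (rmem s4 LO) (B j) = T \<and> (\<exists>c. priced D F (rmem s LO) (rmem s HI) (B j) (rmem s4 LO) c)"
              if "\<forall>i\<in>B j. rmem s LO i \<in> D \<and> rmem s HI i \<in> D \<and> rmem s LO i \<le> rmem s HI i" "T \<le> sum (rmem s HI) (B j)"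
            proof -
              have "T \<in> D" using U(1) sum_in_D[of "B j" "rmem s LO"] that(1) by (auto simp: T_def max_def)
              moreover have "sum (rmem s LO) (B j) \<le> T" by (simp add: T_def)
              ultimately have "sum (rmem s3 SOL) (B j) = T \<and> (\<exists>c. priced D F (rmem s LO) (rmem s HI) (B j) (rmem s3 SOL) c)"
                using sol that unfolding solves_stage_def f2 xs by simp
              then obtain c where c: "sum (rmem s3 SOL) (B j) = T" "priced D F (rmem s LO) (rmem s HI) (B j) (rmem s3 SOL) c" by blast
              have "priced D F (rmem s LO) (rmem s HI) (B j) (rmem s4 LO) c"
                by (rule priced_narrow[OF c(2)]) (use pricedD(2,3)[OF c(2)] in \<open>simp add: lo\<close>)
              moreover have "sum (rmem s4 LO) (B j) = T" using c(1) by (simp add: lo)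
              ultimately show ?thesis by blast
            qed
            moreover have "rmem s4 LO i = rmem s LO i" if "i \<notin> B j" for i
              using that fr3 by (simp add: lo f2)
            moreover have "nmem s4 k = nmem s k" if "k < PTR" for k
              using that fn4[of k] fn3 fn1[of k] by (simp add: s2_def)
            moreover have "rmem s4 k = rmem s k" if "k \<notin> {SOL, LO} \<union> {KEY..}" for k
              using that fr4[of k] fr3 fr1[of k] by (simp add: s2_def)
            moreover have "t3 + t4 \<le> C * (length xs + 1) + 3 * length xs + 2" using t3 t4 by linarith
            ultimately show ?thesis by simp
          qed
          done
      qed
      done
    have cond: "runs pr [search] (Cond (RLess (rcell TOTAL) (rcell SUML)) (rset TOTAL (rcell SUML)) Skip)
      (rupd TOTAL 0 (U (block_lo P j)) s1) (\<lambda>t s'. t \<le> 2 \<and> s' = s2)"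
      by (auto simp: runs_simps sl s2_def T_def max_def)
    show ?thesis
      apply (simp only: tot nval.simps)
      apply (rule runs_mono[OF cond])
      apply (elim conjE)
      apply (simp only:)
      apply (rule runs_mono[OF st[unfolded runs_Seq]])
      apply (erule runs_mono)
      subgoal premises q using q t1 by (auto simp: algebra_simps)
      done
  qed
  done

lemma runs_reduce_upper:
  assumes ch: "chain (nmem s NEXT) (nmem s STAGE 0) xs" and d: "distinct xs" and xs: "set xs = B j"
    and j: "j \<in> {1..m}" and kept: "inputs_kept s" and jj: "nmem s 5 0 = j"
  defines "T \<equiv> min (V (block_hi P j)) (sum (rmem s HI) (B j))"
  shows "runs pr [search] (reduce_upper stage dn) s (\<lambda>t s'. t \<le> (C + 9) * (length xs + 1) \<and>
    ((\<forall>i\<in>B j. rmem s LO i \<in> D \<and> rmem s HI i \<in> D \<and> rmem s LO i \<le> rmem s HI i) \<and>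
      sum (rmem s LO) (B j) \<le> T \<longrightarrow>
      sum (rmem s' HI) (B j) = T \<and> (\<exists>c. priced D F (rmem s LO) (rmem s HI) (B j) (rmem s' HI) c)) \<and>
    (\<forall>i. i \<notin> B j \<longrightarrow> rmem s' HI i = rmem s HI i) \<and>
    (\<forall>k. k < PTR \<longrightarrow> nmem s' k = nmem s k) \<and>
    (\<forall>k. k \<notin> {SOL, HI} \<union> {KEY..} \<longrightarrow> rmem s' k = rmem s k))"
  unfolding reduce_upper_def
  apply (simp only: runs_Seq runs_RSet)
  apply (rule runs_mono)
   apply (rule runs_accumulate[where xs = xs])
  subgoal using ch by simp
  subgoal by simp
  subgoal premises p1 for t1 s1
  proof -
    have t1: "t1 \<le> 3 * length xs + 2" and sl: "rmem s1 SUMH 0 = sum (rmem s HI) (B j)"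
      and fn1: "\<And>i. i \<noteq> PTR \<Longrightarrow> nmem s1 i = nmem s i" and fr1: "\<And>i. i \<noteq> SUMH \<Longrightarrow> rmem s1 i = rmem s i"
      using p1 by (auto simp: xs[symmetric] sum.distinct_set_conv_list[OF d])
    have bhi: "rmem s BHI j = block_hi P j" using kept j by (simp add: inputs_kept_def)
    define s2 where "s2 = rupd TOTAL 0 T s1"
    have tot: "rval pr s1 (dn (RGet BHI blk)) = V (block_hi P j)"
      using fn1 fr1 by (simp add: dn jj bhi)
    have f2: "nmem s2 NEXT = nmem s NEXT" "nmem s2 STAGE = nmem s STAGE" "rmem s2 LO = rmem s LO"
      "rmem s2 HI = rmem s HI" "rmem s2 SCALE = a" "rmem s2 SHIFT = b" "rmem s2 TOTAL 0 = T"
      using fn1 fr1 kept by (simp_all add: s2_def inputs_kept_def)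
    have st: "runs pr [search] (stage;; foreach (RSet HI ptr (RGet SOL ptr))) s2 (\<lambda>t s'.
      t \<le> C * (length xs + 1) + 3 * length xs + 2 \<and>
      ((\<forall>i\<in>B j. rmem s LO i \<in> D \<and> rmem s HI i \<in> D \<and> rmem s LO i \<le> rmem s HI i) \<and>
      sum (rmem s LO) (B j) \<le> T \<longrightarrow>
      sum (rmem s' HI) (B j) = T \<and> (\<exists>c. priced D F (rmem s LO) (rmem s HI) (B j) (rmem s' HI) c)) \<and>
      (\<forall>i. i \<notin> B j \<longrightarrow> rmem s' HI i = rmem s HI i) \<and>
      (\<forall>k. k < PTR \<longrightarrow> nmem s' k = nmem s k) \<and>
      (\<forall>k. k \<notin> {SOL, HI} \<union> {KEY..} \<longrightarrow> rmem s' k = rmem s k))"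
      apply (rule runs_SeqI)
       apply (rule runs_stage[where xs = xs])
      subgoal using ch by (simp add: f2)
      subgoal by (rule d)
      subgoal using xs B_sub[OF j] by simp
      subgoal by (rule f2)
      subgoal premises p3 for t3 s3
      proof -
        have t3: "t3 \<le> C * (length xs + 1)" and sol: "solves_stage \<gamma> f xs s2 (rmem s3 SOL)"
          and fn3: "\<forall>k. k < PTR \<longrightarrow> nmem s3 k = nmem s2 k"
          and fr3: "\<forall>k. k \<notin> insert SOL {KEY..} \<longrightarrow> rmem s3 k = rmem s2 k"
          using p3 by - (elim conjE, assumption)+
        show ?thesis
          apply (rule runs_mono)
           apply (rule runs_assign[where xs = xs and k = HI and C = 1 and g = "rmem s3 SOL"])
          subgoal using ch fn3 f2 by simp
          subgoal by simp
          subgoal by (simp add: runs_simps)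
          subgoal premises p4 for t4 s4
          proof -
            have t4: "t4 \<le> 3 * length xs + 2" and fn4: "\<And>j. j \<noteq> PTR \<Longrightarrow> nmem s4 j = nmem s3 j"
              and fr4: "\<And>j. j \<noteq> HI \<Longrightarrow> rmem s4 j = rmem s3 j"
              and lo: "rmem s4 HI = (\<lambda>i. if i \<in> B j then rmem s3 SOL i else rmem s3 HI i)"
              using p4 by (auto simp: xs)
            have "sum (rmem s4 HI) (B j) = T \<and> (\<exists>c. priced D F (rmem s LO) (rmem s HI) (B j) (rmem s4 HI) c)"
              if "\<forall>i\<in>B j. rmem s LO i \<in> D \<and> rmem s HI i \<in> D \<and> rmem s LO i \<le> rmem s HI i" "sum (rmem s LO) (B j) \<le> T"
            proof -
              have "T \<in> D" using V(1) sum_in_D[of "B j" "rmem s HI"] that(1) by (auto simp: T_def min_def)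
              moreover have "T \<le> sum (rmem s HI) (B j)" by (simp add: T_def)
              ultimately have "sum (rmem s3 SOL) (B j) = T \<and> (\<exists>c. priced D F (rmem s LO) (rmem s HI) (B j) (rmem s3 SOL) c)"
                using sol that unfolding solves_stage_def f2 xs by simp
              then obtain c where c: "sum (rmem s3 SOL) (B j) = T" "priced D F (rmem s LO) (rmem s HI) (B j) (rmem s3 SOL) c" by blast
              have "priced D F (rmem s LO) (rmem s HI) (B j) (rmem s4 HI) c"
                by (rule priced_narrow[OF c(2)]) (use pricedD(2,3)[OF c(2)] in \<open>simp add: lo\<close>)
              moreover have "sum (rmem s4 HI) (B j) = T" using c(1) by (simp add: lo)
              ultimately show ?thesis by blast
            qed
            moreover have "rmem s4 HI i = rmem s HI i" if "i \<notin> B j" for i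
              using that fr3 by (simp add: lo f2)
            moreover have "nmem s4 k = nmem s k" if "k < PTR" for k
              using that fn4[of k] fn3 fn1[of k] by (simp add: s2_def)
            moreover have "rmem s4 k = rmem s k" if "k \<notin> {SOL, HI} \<union> {KEY..}" for k
              using that fr4[of k] fr3 fr1[of k] by (simp add: s2_def)
            moreover have "t3 + t4 \<le> C * (length xs + 1) + 3 * length xs + 2" using t3 t4 by linarith
            ultimately show ?thesis by simp
          qed
          done
      qed
      done
    have cond: "runs pr [search] (Cond (RLess (rcell SUMH) (rcell TOTAL)) (rset TOTAL (rcell SUMH)) Skip)
      (rupd TOTAL 0 (V (block_hi P j)) s1) (\<lambda>t s'. t \<le> 2 \<and> s' = s2)"
      by (auto simp: runs_simps sl s2_def T_def min_def)
    show ?thesis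
      apply (simp only: tot nval.simps)
      apply (rule runs_mono[OF cond])
      apply (elim conjE)
      apply (simp only:)
      apply (rule runs_mono[OF st[unfolded runs_Seq]])
      apply (erule runs_mono)
      subgoal premises q using q t1 by (auto simp: algebra_simps)
      done
  qed
  done

end

section \<open>From the tightened blocks to the whole problem\<close>

context allocation
begin

text \<open>These are the premises of \<open>priced_block\<close> about a block: \<open>x\<close>
  and \<open>y\<close> are its extreme allocations, and the second is priced between the first and
  the original upper bounds.\<close>

definition block_done :: "nat \<Rightarrow> (nat \<Rightarrow> real) \<Rightarrow> (nat \<Rightarrow> real) \<Rightarrow> bool" where
  "block_done j x y \<longleftrightarrow>
     (\<exists>c. priced D F l u (B j) x c) \<and> (\<exists>c. priced D F x u (B j) y c) \<and>
     sum x (B j) = max (U (block_lo P j)) (sum l (B j)) \<and>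
     sum y (B j) = min (V (block_hi P j)) (sum u (B j))"

lemma priced_cong:
  assumes "\<And>i. i \<in> J \<Longrightarrow> p i = p' i" "\<And>i. i \<in> J \<Longrightarrow> q i = q' i" "\<And>i. i \<in> J \<Longrightarrow> x i = x' i"
  shows "priced S G p q J x c \<longleftrightarrow> priced S G p' q' J x' c"
  unfolding priced_def using assms by (intro ball_cong refl) simp

lemma block_done_cong:
  assumes "\<And>i. i \<in> B j \<Longrightarrow> x i = x' i" "\<And>i. i \<in> B j \<Longrightarrow> y i = y' i"
  shows "block_done j x y = block_done j x' y'"
proof -
  have "priced D F l u (B j) x = priced D F l u (B j) x'" "priced D F x u (B j) y = priced D F x' u (B j) y'"
    by (intro ext priced_cong; simp add: assms)+
  then show ?thesis
    unfolding block_done_def by (simp add: sum.cong[OF refl assms(1)] sum.cong[OF refl assms(2)])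
qed

lemma feasible_bounds:
  assumes "feasible \<gamma> P z" "i \<in> {1..n}"
  shows "z i \<in> D" "l i \<le> z i" "z i \<le> u i"
proof -
  show D: "z i \<in> D" using assms by (auto simp: feasible_def domain_set_def n_def)
  have "act_lo P i \<le> z i" "z i \<le> act_hi P i" using assms by (auto simp: feasible_def n_def)
  then show "l i \<le> z i" "z i \<le> u i"
    using U(3)[OF D] V(3)[OF D] assms(2) by (auto simp: l_def u_def vec_array_def)
qed

text \<open>A block total of a feasible point is a sum of domain elements and hence respects the
  rounded block bounds as well. In particular the existence of such a point makes the totals
  demanded of the stages attainable.\<close>

lemma feasible_block:
  assumes "feasible \<gamma> P z" "j \<in> {1..m}"
  shows "max (U (block_lo P j)) (sum l (B j)) \<le> sum z (B j)"
    and "sum z (B j) \<le> min (V (block_hi P j)) (sum u (B j))"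
proof -
  have i: "i \<in> {1..n}" if "i \<in> B j" for i using that B_sub[OF assms(2)] by blast
  have D: "sum z (B j) \<in> D" using sum_in_D feasible_bounds(1)[OF assms(1) i] by blast
  have "block_lo P j \<le> sum z (B j)" "sum z (B j) \<le> block_hi P j"
    using assms by (auto simp: feasible_def m_def B_def)
  then have "U (block_lo P j) \<le> sum z (B j)" "sum z (B j) \<le> V (block_hi P j)"
    using U(3)[OF D] V(3)[OF D] by auto
  moreover have "sum l (B j) \<le> sum z (B j)" by (rule sum_mono) (rule feasible_bounds(2)[OF assms(1) i])
  moreover have "sum z (B j) \<le> sum u (B j)" by (rule sum_mono) (rule feasible_bounds(3)[OF assms(1) i])
  ultimately show "max (U (block_lo P j)) (sum l (B j)) \<le> sum z (B j)"
    "sum z (B j) \<le> min (V (block_hi P j)) (sum u (B j))" by auto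
qed

lemma lu_in_D: "l i \<in> D" "u i \<in> D"
  by (simp_all add: l_def u_def U(1) V(1))

lemma runs_block:
  assumes ch: "chain (nmem s NEXT) (nmem s STAGE 0) xs" and d: "distinct xs" and xs: "set xs = B j"
    and j: "j \<in> {1..m}" and kept: "inputs_kept s" and jj: "nmem s 5 0 = j"
    and lu: "\<forall>i\<in>B j. rmem s LO i = l i \<and> rmem s HI i = u i"
  shows "runs pr [search] (raise_lower stage up;; reduce_upper stage dn) s (\<lambda>t s'.
    t \<le> 2 * (C + 9) * (card (B j) + 1) \<and>
    ((\<exists>z. feasible \<gamma> P z) \<longrightarrow> block_done j (rmem s' LO) (rmem s' HI)) \<and>
    (\<forall>i. i \<notin> B j \<longrightarrow> rmem s' LO i = rmem s LO i \<and> rmem s' HI i = rmem s HI i) \<and>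
    (\<forall>k. k < PTR \<longrightarrow> nmem s' k = nmem s k) \<and>
    (\<forall>k. k \<notin> {SOL, LO, HI} \<union> {KEY..} \<longrightarrow> rmem s' k = rmem s k))"
  apply (rule runs_SeqI)
   apply (rule runs_raise_lower[OF ch d xs j kept jj])
  subgoal premises p1 for t1 s1
  proof -
    have sum_lo: "sum (rmem s LO) (B j) = sum l (B j)" and sum_hi: "sum (rmem s HI) (B j) = sum u (B j)"
      using lu by (auto intro: sum.cong)
    have t1: "t1 \<le> (C + 9) * (length xs + 1)"
      and lower: "(\<forall>i\<in>B j. rmem s LO i \<in> D \<and> rmem s HI i \<in> D \<and> rmem s LO i \<le> rmem s HI i) \<and>
        max (U (block_lo P j)) (sum l (B j)) \<le> sum u (B j) \<longrightarrow>
        sum (rmem s1 LO) (B j) = max (U (block_lo P j)) (sum l (B j)) \<and>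
        (\<exists>c. priced D F (rmem s LO) (rmem s HI) (B j) (rmem s1 LO) c)"
      and out1: "\<forall>i. i \<notin> B j \<longrightarrow> rmem s1 LO i = rmem s LO i"
      and fn1: "\<forall>k. k < PTR \<longrightarrow> nmem s1 k = nmem s k"
      and fr1: "\<forall>k. k \<notin> {SOL, LO} \<union> {KEY..} \<longrightarrow> rmem s1 k = rmem s k"
      using p1[unfolded sum_lo sum_hi] by - (elim conjE, assumption)+
    have hi1: "rmem s1 HI = rmem s HI" using fr1 by simp
    have kept1: "inputs_kept s1" by (rule inputs_kept_frame[OF kept]) (use fn1 fr1 in auto)
    show ?thesis
      apply (rule runs_mono)
       apply (rule runs_reduce_upper[OF _ d xs j kept1])
      subgoal using ch fn1 by simp
      subgoal using fn1 jj by simp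
      subgoal premises p2 for t2 s2
      proof -
        have t2: "t2 \<le> (C + 9) * (length xs + 1)"
          and upper: "(\<forall>i\<in>B j. rmem s1 LO i \<in> D \<and> rmem s HI i \<in> D \<and> rmem s1 LO i \<le> rmem s HI i) \<and>
            sum (rmem s1 LO) (B j) \<le> min (V (block_hi P j)) (sum u (B j)) \<longrightarrow>
            sum (rmem s2 HI) (B j) = min (V (block_hi P j)) (sum u (B j)) \<and>
            (\<exists>c. priced D F (rmem s1 LO) (rmem s HI) (B j) (rmem s2 HI) c)"
          and out2: "\<forall>i. i \<notin> B j \<longrightarrow> rmem s2 HI i = rmem s HI i"
          and fn2: "\<forall>k. k < PTR \<longrightarrow> nmem s2 k = nmem s1 k"
          and fr2: "\<forall>k. k \<notin> {SOL, HI} \<union> {KEY..} \<longrightarrow> rmem s2 k = rmem s1 k"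
          using p2[unfolded hi1 sum_hi] by - (elim conjE, assumption)+
        have lo2: "rmem s2 LO = rmem s1 LO" using fr2 by simp
        have "block_done j (rmem s2 LO) (rmem s2 HI)" if z: "feasible \<gamma> P z" for z
        proof -
          note fb = feasible_block[OF z j]
          have lz: "l i \<le> u i" if "i \<in> B j" for i
            using feasible_bounds[OF z, of i] that B_sub[OF j] by fastforce
          have "max (U (block_lo P j)) (sum l (B j)) \<le> sum u (B j)" using fb by simp
          moreover have "\<forall>i\<in>B j. rmem s LO i \<in> D \<and> rmem s HI i \<in> D \<and> rmem s LO i \<le> rmem s HI i"
            using lu lu_in_D lz by simp
          ultimately have s1: "sum (rmem s1 LO) (B j) = max (U (block_lo P j)) (sum l (B j))"
            and "\<exists>c. priced D F (rmem s LO) (rmem s HI) (B j) (rmem s1 LO) c"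
            using lower by simp_all
          then obtain c where "priced D F (rmem s LO) (rmem s HI) (B j) (rmem s1 LO) c" by blast
          then have c: "priced D F l u (B j) (rmem s1 LO) c"
            using lu priced_cong[of "B j" "rmem s LO" l "rmem s HI" u "rmem s1 LO" "rmem s1 LO"] by simp
          have "sum (rmem s1 LO) (B j) \<le> min (V (block_hi P j)) (sum u (B j))" using s1 fb by simp
          moreover have "\<forall>i\<in>B j. rmem s1 LO i \<in> D \<and> rmem s HI i \<in> D \<and> rmem s1 LO i \<le> rmem s HI i"
            using pricedD(1,3)[OF c] lu lu_in_D by simp
          ultimately have s2: "sum (rmem s2 HI) (B j) = min (V (block_hi P j)) (sum u (B j))"
            and "\<exists>c. priced D F (rmem s1 LO) (rmem s HI) (B j) (rmem s2 HI) c"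
            using upper by simp_all
          then obtain c' where "priced D F (rmem s1 LO) (rmem s HI) (B j) (rmem s2 HI) c'" by blast
          then have c': "priced D F (rmem s1 LO) u (B j) (rmem s2 HI) c'"
            using lu priced_cong[of "B j" "rmem s1 LO" "rmem s1 LO" "rmem s HI" u "rmem s2 HI" "rmem s2 HI"] by simp
          show ?thesis unfolding block_done_def lo2 using c c' s1 s2 by blast
        qed
        moreover have "t1 + t2 \<le> 2 * (C + 9) * (card (B j) + 1)"
          using t1 t2 distinct_card[OF d] by (simp add: xs algebra_simps)
        moreover have "rmem s2 LO i = rmem s LO i \<and> rmem s2 HI i = rmem s HI i" if "i \<notin> B j" for i
          using that out1 out2 by (simp add: lo2)
        moreover have "nmem s2 k = nmem s k" if "k < PTR" for k using that fn1 fn2 by simp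
        moreover have "rmem s2 k = rmem s k" if "k \<notin> {SOL, LO, HI} \<union> {KEY..}" for k
          using that fr1 fr2 by simp
        ultimately show ?thesis by blast
      qed
      done
  qed
  done

lemma runs_solve_blocks:
  assumes kept: "inputs_kept s"
    and lists: "\<forall>j\<in>{1..m}. \<exists>xs. chain (nmem s NEXT) (nmem s HEAD j) xs \<and> distinct xs \<and> set xs = B j"
    and lu: "\<forall>i\<in>{1..n}. rmem s LO i = l i \<and> rmem s HI i = u i"
  shows "runs pr [search] (solve_blocks stage up dn) s (\<lambda>t s'. t \<le> (4 * C + 40) * n + 2 \<and> inputs_kept s' \<and>
    ((\<exists>z. feasible \<gamma> P z) \<longrightarrow> (\<forall>j\<in>{1..m}. block_done j (rmem s' LO) (rmem s' HI))))"
proof -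
  define J where "J = (\<lambda>(t::nat) (s'::state). \<exists>k.
    t \<le> (\<Sum>j\<in>{1..<k}. 2 * (C + 9) * (card (B j) + 1) + 3) \<and> nmem s' 5 0 = k \<and> 1 \<le> k \<and> k \<le> m + 1 \<and>
    inputs_kept s' \<and> nmem s' NEXT = nmem s NEXT \<and> nmem s' HEAD = nmem s HEAD \<and>
    ((\<exists>z. feasible \<gamma> P z) \<longrightarrow> (\<forall>j\<in>{1..<k}. block_done j (rmem s' LO) (rmem s' HI))) \<and>
    (\<forall>j\<in>{k..m}. \<forall>i\<in>B j. rmem s' LO i = l i \<and> rmem s' HI i = u i))"
  show ?thesis
    unfolding solve_blocks_def
    apply (simp only: runs_Seq[of _ _ "nset 5 (NConst 1)"] runs_NSet nval.simps)
    apply (rule runs_While[where J = J and \<mu> = "\<lambda>s. Suc m - nmem s 5 0"])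
    subgoal unfolding J_def
      using kept lu B_sub by (intro exI[of _ 1]) (fastforce simp: inputs_kept_def)
    subgoal premises prems for t s1
    proof -
      obtain k where k: "t \<le> (\<Sum>j\<in>{1..<k}. 2 * (C + 9) * (card (B j) + 1) + 3)" "nmem s1 5 0 = k" "1 \<le> k" "k \<le> m + 1"
        and kept1: "inputs_kept s1" and f1: "nmem s1 NEXT = nmem s NEXT" "nmem s1 HEAD = nmem s HEAD"
        and bd: "(\<exists>z. feasible \<gamma> P z) \<longrightarrow> (\<forall>j\<in>{1..<k}. block_done j (rmem s1 LO) (rmem s1 HI))"
        and todo: "\<forall>j\<in>{k..m}. \<forall>i\<in>B j. rmem s1 LO i = l i \<and> rmem s1 HI i = u i"
        using prems(1) unfolding J_def by (elim exE conjE) (rule that; assumption)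
      have km: "k \<in> {1..m}" using prems(2) k kept1 by (simp add: inputs_kept_def)
      obtain xs where xs: "chain (nmem s NEXT) (nmem s HEAD k) xs" "distinct xs" "set xs = B k" using lists km by blast
      define s2 where "s2 = nupd STAGE 0 (nmem s1 HEAD k) s1"
      have kept2: "inputs_kept s2" by (rule inputs_kept_frame[OF kept1]) (simp_all add: s2_def)
      have ch2: "chain (nmem s2 NEXT) (nmem s2 STAGE 0) xs" using xs(1) by (simp add: s2_def f1)
      have j2: "nmem s2 5 0 = k" by (simp add: s2_def k)
      have lu2: "\<forall>i\<in>B k. rmem s2 LO i = l i \<and> rmem s2 HI i = u i" using bspec[OF todo, of k] km by (simp add: s2_def)
      note body = runs_block[OF ch2 xs(2,3) km kept2 j2 lu2, unfolded runs_Seq]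
      show ?thesis
        apply (simp only: runs_Seq runs_NSet nval.simps k(2))
        apply (subst s2_def[symmetric])
        apply (rule runs_mono[OF body])
        apply (erule runs_mono)
        subgoal premises p3 for t2 s2' t3 s3
        proof -
          have t3: "t2 + t3 \<le> 2 * (C + 9) * (card (B k) + 1)"
            and bk: "(\<exists>z. feasible \<gamma> P z) \<longrightarrow> block_done k (rmem s3 LO) (rmem s3 HI)"
            and out: "\<forall>i. i \<notin> B k \<longrightarrow> rmem s3 LO i = rmem s2 LO i \<and> rmem s3 HI i = rmem s2 HI i"
            and fn3: "\<forall>k. k < PTR \<longrightarrow> nmem s3 k = nmem s2 k"
            and fr3: "\<forall>k. k \<notin> {SOL, LO, HI} \<union> {KEY..} \<longrightarrow> rmem s3 k = rmem s2 k"
            using p3 by - (elim conjE, assumption)+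
          have k3: "nmem s3 5 0 = k" using fn3 j2 by simp
          define s4 where "s4 = nupd 5 0 (k + 1) s3"
          have kept4: "inputs_kept s4" by (rule inputs_kept_frame[OF kept2]) (use fn3 fr3 in \<open>auto simp: s4_def\<close>)
          have other: "rmem s4 LO i = rmem s1 LO i \<and> rmem s4 HI i = rmem s1 HI i"
            if "i \<in> B j" "j \<in> {1..m}" "j \<noteq> k" for i j
            using B_disj[OF that(2) km that(3)] that(1) out by (auto simp: s4_def s2_def)
          have "J (Suc (t + (1 + (t2 + (t3 + 1))))) s4"
            unfolding J_def
          proof (intro exI[of _ "Suc k"] conjI)
            show "Suc (t + (1 + (t2 + (t3 + 1)))) \<le> (\<Sum>j\<in>{1..<Suc k}. 2 * (C + 9) * (card (B j) + 1) + 3)"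
              using k(1,3) t3 by simp
            show "(\<exists>z. feasible \<gamma> P z) \<longrightarrow> (\<forall>j\<in>{1..<Suc k}. block_done j (rmem s4 LO) (rmem s4 HI))"
            proof (intro impI ballI)
              fix j assume z: "\<exists>z. feasible \<gamma> P z" and j: "j \<in> {1..<Suc k}"
              show "block_done j (rmem s4 LO) (rmem s4 HI)"
              proof (cases "j = k")
                case True
                then show ?thesis using bk z by (simp add: s4_def)
              next
                case False
                then have "block_done j (rmem s1 LO) (rmem s1 HI)" using bd z j by simp
                then show ?thesis
                  using other[of _ j] False j km block_done_cong[of j "rmem s4 LO" "rmem s1 LO" "rmem s4 HI" "rmem s1 HI"]
                  by simp
              qed
            qed
            show "\<forall>j\<in>{Suc k..m}. \<forall>i\<in>B j. rmem s4 LO i = l i \<and> rmem s4 HI i = u i"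
            proof (intro ballI)
              fix j i assume "j \<in> {Suc k..m}" "i \<in> B j"
              then show "rmem s4 LO i = l i \<and> rmem s4 HI i = u i" using other[of i j] todo by auto
            qed
          qed (use kept4 fn3 km f1 in \<open>simp_all add: s4_def s2_def\<close>)
          moreover have "Suc m - nmem s4 5 0 < Suc m - nmem s1 5 0" using km by (auto simp: s4_def k)
          ultimately show ?thesis by (simp add: s4_def k3 k(2) add.assoc)
        qed
        done
    qed
    subgoal premises prems for t s1
    proof -
      obtain k where k: "t \<le> (\<Sum>j\<in>{1..<k}. 2 * (C + 9) * (card (B j) + 1) + 3)" "nmem s1 5 0 = k" "1 \<le> k" "k \<le> m + 1"
        and kept1: "inputs_kept s1"
        and bd: "(\<exists>z. feasible \<gamma> P z) \<longrightarrow> (\<forall>j\<in>{1..<k}. block_done j (rmem s1 LO) (rmem s1 HI))"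
        using prems(1) unfolding J_def by (elim exE conjE) (rule that; assumption)
      have km: "k = Suc m" using prems(2) k kept1 by (simp add: inputs_kept_def)
      then have set: "{1..<k} = {1..m}" by auto
      \<comment> \<open>The part proportional to the block sizes adds up to n activities, and the
        constant part is charged to at most n blocks.\<close>
      have "(\<Sum>j\<in>{1..m}. 2 * (C + 9) * (card (B j) + 1) + 3) =
          2 * (C + 9) * (\<Sum>j\<in>{1..m}. card (B j)) + 2 * (C + 9) * m + 3 * m"
        by (simp add: sum.distrib sum_distrib_left algebra_simps)
      also have "(\<Sum>j\<in>{1..m}. card (B j)) = n"
        using sum_blocks[of "\<lambda>_. 1 :: nat"] by simp
      also have "2 * (C + 9) * n + 2 * (C + 9) * m + 3 * m \<le> 2 * (C + 9) * n + 2 * (C + 9) * n + 3 * n"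
        using m_le_n by (intro add_mono mult_le_mono2) auto
      also have "\<dots> \<le> (4 * C + 40) * n" by (simp add: algebra_simps)
      finally have "t \<le> (4 * C + 40) * n" using k(1) unfolding set by linarith
      then show ?thesis using kept1 bd unfolding set by simp
    qed
    done
qed

lemma chain_pred: "\<forall>i\<in>{1..k}. nx i = i - 1 \<Longrightarrow> chain nx k (rev [1..<Suc k])"
proof (induction k)
  case (Suc k)
  then show ?case by (simp add: upt_conv_Cons)
qed simp

lemma runs_link_all:
  assumes "nmem s 0 0 = n"
  shows "runs pr [search] link_all s (\<lambda>t s'. t \<le> 3 * n + 3 \<and>
    chain (nmem s' NEXT) (nmem s' STAGE 0) (rev [1..<Suc n]) \<and>
    nmem s' 0 = nmem s 0 \<and> rmem s' = rmem s)"
proof -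
  define J where "J = (\<lambda>(t::nat) (s'::state). t + 3 = 3 * nmem s' 4 0 \<and> 1 \<le> nmem s' 4 0 \<and> nmem s' 4 0 \<le> n + 1 \<and>
    (\<forall>i\<in>{1..<nmem s' 4 0}. nmem s' NEXT i = i - 1) \<and> nmem s' 0 = nmem s 0 \<and> rmem s' = rmem s)"
  show ?thesis
    unfolding link_all_def
    apply (simp only: runs_Seq runs_NSet nval.simps)
    apply (rule runs_While[where J = J and \<mu> = "\<lambda>s. Suc n - nmem s 4 0"])
    subgoal by (simp add: J_def)
    subgoal using assms by (auto simp: J_def runs_simps less_Suc_eq)
    subgoal premises prems for t s1
    proof -
      have "nmem s1 4 0 = Suc n" using prems assms by (simp add: J_def)
      moreover have "chain (nmem s1 NEXT) n (rev [1..<Suc n])"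
        by (rule chain_pred) (use prems(1) calculation in \<open>auto simp: J_def\<close>)
      ultimately show ?thesis using prems(1) assms by (simp add: J_def del: upt_Suc)
    qed
    done
qed

lemma objective_eq: "objective f P x = (\<Sum>i\<in>{1..n}. F i (x i))"
  unfolding objective_def n_def[symmetric]
  by (rule sum.cong) (auto simp: cost_def a_def b_def vec_array_def)

text \<open>The final price \<open>c\<close> bounds the cost difference in every block by
  \<open>c\<close> times the difference of the block totals. Summed over the blocks, these terms
  cancel, since both points have total \<open>resource P\<close>.\<close>

lemma optimal_from_blocks:
  assumes blocks: "\<And>j. j \<in> {1..m} \<Longrightarrow> block_done j lo hi"
    and x: "priced D F lo hi {1..n} x c" and R: "sum x {1..n} = resource P"
  shows "optimal \<gamma> f P x"
proof -
  have bounds: "l i \<le> x i" "x i \<le> u i" if i: "i \<in> {1..n}" for i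
  proof -
    obtain j where j: "j \<in> {1..m}" "i \<in> B j" using i B_union by blast
    obtain c1 c2 where "priced D F l u (B j) lo c1" "priced D F lo u (B j) hi c2"
      using blocks[OF j(1)] unfolding block_done_def by blast
    from pricedD(2)[OF this(1) j(2)] pricedD(3)[OF this(2) j(2)] pricedD(2,3)[OF x i]
    show "l i \<le> x i" "x i \<le> u i" by linarith+
  qed
  have feas: "feasible \<gamma> P x"
    unfolding feasible_def n_def[symmetric] m_def[symmetric] B_def[symmetric]
  proof (intro conjI ballI impI)
    show "sum x {1..n} = resource P" by (rule R)
  next
    fix j assume j: "j \<in> {1..m}"
    have bd: "sum lo (B j) = max (U (block_lo P j)) (sum l (B j))"
      "sum hi (B j) = min (V (block_hi P j)) (sum u (B j))"
      using blocks[OF j] unfolding block_done_def by blast+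
    have "sum lo (B j) \<le> sum x (B j)" "sum x (B j) \<le> sum hi (B j)"
      using pricedD(2,3)[OF x] B_sub[OF j] by (auto intro!: sum_mono)
    then show "block_lo P j \<le> sum x (B j)" "sum x (B j) \<le> block_hi P j"
      using bd U(2)[of "block_lo P j"] V(2)[of "block_hi P j"] by linarith+
  next
    fix i assume i: "i \<in> {1..n}"
    show "act_lo P i \<le> x i" "x i \<le> act_hi P i"
      using bounds[OF i] U(2)[of "act_lo P i"] V(2)[of "act_hi P i"] i
      by (auto simp: l_def u_def vec_array_def)
    assume "\<gamma> = Integral"
    then show "x i \<in> \<int>" using pricedD(1)[OF x i] by (simp add: domain_set_def)
  qed
  have "objective f P x \<le> objective f P z" if z: "feasible \<gamma> P z" for z
  proof -
    have "c * (sum z (B j) - sum x (B j)) \<le> (\<Sum>i\<in>B j. F i (z i)) - (\<Sum>i\<in>B j. F i (x i))"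
      if j: "j \<in> {1..m}" for j
    proof -
      obtain c1 c2 where c: "priced D F l u (B j) lo c1" "priced D F lo u (B j) hi c2"
        and s: "sum lo (B j) = max (U (block_lo P j)) (sum l (B j))"
          "sum hi (B j) = min (V (block_hi P j)) (sum u (B j))"
        using blocks[OF j] unfolding block_done_def by blast
      have "priced D F lo hi (B j) x c"
        using x B_sub[OF j] unfolding priced_def by (meson subsetD)
      then show ?thesis
        by (rule priced_block[OF c]) (use feasible_bounds[OF z] feasible_block[OF z j] B_sub[OF j] s in auto)
    qed
    then have "(\<Sum>j\<in>{1..m}. c * (sum z (B j) - sum x (B j))) \<le>
      (\<Sum>j\<in>{1..m}. (\<Sum>i\<in>B j. F i (z i)) - (\<Sum>i\<in>B j. F i (x i)))" by (rule sum_mono)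
    also have "(\<Sum>j\<in>{1..m}. c * (sum z (B j) - sum x (B j))) = c * (sum z {1..n} - sum x {1..n})"
      unfolding sum_blocks by (simp add: sum_subtractf sum_distrib_left[symmetric])
    also have "sum z {1..n} = sum x {1..n}" using z R by (simp add: feasible_def n_def)
    finally show ?thesis unfolding objective_eq sum_blocks by (simp add: sum_subtractf)
  qed
  with feas show ?thesis unfolding optimal_def is_arg_min_def by (meson not_less)
qed

lemma runs_allocate:
  "runs pr [search] (allocate stage up dn) (input_state P) (\<lambda>t s'. t \<le> (5 * C + 60) * (n + 1) \<and>
    ((\<exists>z. feasible \<gamma> P z) \<longrightarrow> optimal \<gamma> f P (solution s')))"
  unfolding allocate_def
  apply (rule runs_SeqI)
   apply (rule runs_build_lists)
  apply (elim conjE)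
  apply (rule runs_SeqI)
   apply (rule runs_solve_blocks; assumption)
  apply (elim conjE)
  subgoal premises p for t1 s1 t2 s2
  proof -
    note t1 = p(1) and t2 = p(5) and kept2 = p(6) and bd = p(7)
    have n2: "nmem s2 0 0 = n" using kept2 by (simp add: inputs_kept_def)
    show ?thesis
      apply (rule runs_SeqI)
       apply (rule runs_link_all[OF n2])
      subgoal premises q for t3 s3
      proof -
        have t3: "t3 \<le> 3 * n + 3" and ch: "chain (nmem s3 NEXT) (nmem s3 STAGE 0) (rev [1..<Suc n])"
          and f3: "nmem s3 0 = nmem s2 0" "rmem s3 = rmem s2"
          using q by - (elim conjE, assumption)+
        define s4 where "s4 = rupd TOTAL 0 (resource P) s3"
        have f4: "rmem s4 SCALE = a" "rmem s4 SHIFT = b" "rmem s4 LO = rmem s2 LO" "rmem s4 HI = rmem s2 HI"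
          "rmem s4 TOTAL 0 = resource P"
          using kept2 by (simp_all add: s4_def f3 inputs_kept_def)
        have tot: "rmem s3 1 0 = resource P" using kept2 by (simp add: f3 inputs_kept_def)
        have set: "set (rev [1..<Suc n]) = {1..n}" by auto
        have len: "length (rev [1..<Suc n]) = n" by simp
        show ?thesis
          apply (simp only: runs_Seq runs_RSet rval.simps nval.simps tot)
          apply (subst s4_def[symmetric])
          apply (rule runs_mono)
           apply (rule runs_stage[where xs = "rev [1..<Suc n]"])
          subgoal using ch by (simp add: s4_def del: upt_Suc)
          subgoal by simp
          subgoal by auto
          subgoal by (rule f4)
          subgoal premises r for t5 s5
          proof -
            have t5: "t5 \<le> C * (n + 1)" and sol: "solves_stage \<gamma> f (rev [1..<Suc n]) s4 (rmem s5 SOL)"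
              using r unfolding len by blast+
            have "optimal \<gamma> f P (rmem s5 SOL)" if z: "feasible \<gamma> P z" for z
            proof -
              let ?lo = "rmem s2 LO" and ?hi = "rmem s2 HI"
              have blocks: "block_done j ?lo ?hi" if "j \<in> {1..m}" for j using bd z that by blast
              have lohi: "?lo i \<in> D" "?hi i \<in> D" "?lo i \<le> ?hi i" if i: "i \<in> {1..n}" for i
              proof -
                obtain j where j: "j \<in> {1..m}" "i \<in> B j" using i B_union by blast
                obtain c1 c2 where "priced D F l u (B j) ?lo c1" "priced D F ?lo u (B j) ?hi c2"
                  using blocks[OF j(1)] unfolding block_done_def by blast
                from pricedD(1)[OF this(1) j(2)] pricedD(1,2)[OF this(2) j(2)]
                show "?lo i \<in> D" "?hi i \<in> D" "?lo i \<le> ?hi i" by auto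
              qed
              have Z: "sum z {1..n} = resource P" using z by (simp add: feasible_def n_def)
              \<comment> \<open>The extreme block totals enclose those of any feasible point, so the
                final box problem can attain the total \<open>resource P\<close>, even though
                \<open>z\<close> itself may violate its bounds.\<close>
              have "sum ?lo (B j) \<le> sum z (B j)" "sum z (B j) \<le> sum ?hi (B j)" if "j \<in> {1..m}" for j
                using feasible_block[OF z that] blocks[OF that] unfolding block_done_def by auto
              then have "sum ?lo {1..n} \<le> resource P" "resource P \<le> sum ?hi {1..n}"
                unfolding Z[symmetric] sum_blocks by (auto intro: sum_mono)
              moreover have "resource P \<in> D" unfolding Z[symmetric] by (rule sum_in_D) (rule feasible_bounds(1)[OF z])
              ultimately have "sum (rmem s5 SOL) {1..n} = resource P \<and>
                (\<exists>c. priced D F ?lo ?hi {1..n} (rmem s5 SOL) c)"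
                using sol lohi unfolding solves_stage_def f4 set by simp
              then show ?thesis using optimal_from_blocks[OF blocks] by blast
            qed
            moreover have "t1 + (t2 + (t3 + (1 + t5))) \<le> (5 * C + 60) * (n + 1)"
              using t1 t2 t3 t5 by (simp add: algebra_simps)
            ultimately show ?thesis by (auto simp: solution_def)
          qed
          done
      qed
      done
  qed
  done

lemma allocate_solves:
  "solves_within ([search], allocate stage up dn) \<gamma> f P (real ((5 * C + 60) * (num_acts P + 1)))"
  using runs_allocate unfolding solves_within_def runs_def n_def by (simp del: of_nat_mult of_nat_add)

end

section \<open>Linear time for both domains\<close>

lemma linear_bound: "(\<lambda>k. real (c * (k + 1))) \<in> O(\<lambda>k. real k)"
proof (rule landau_o.bigI[of "2 * real c + 1"])
  show "\<forall>\<^sub>F k in at_top. norm (real (c * (k + 1))) \<le> (2 * real c + 1) * norm (real k)"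
    using eventually_ge_at_top[of 1]
  proof eventually_elim
    case (elim k)
    then have "c * (k + 1) \<le> c * (2 * k)" by (intro mult_le_mono2) simp
    then have "real (c * (k + 1)) \<le> real (c * (2 * k))" by (rule of_nat_mono)
    then show ?case by (simp add: algebra_simps)
  qed
qed simp

theorem corollary5:
  shows
    "(\<exists>prog T. T \<in> O(\<lambda>n. real n) \<and>
        (\<forall>f P. convex_on UNIV f \<longrightarrow> gbc_instance P \<longrightarrow>
           solves_within prog Continuous f P (T (num_acts P)))) \<and>
     (\<exists>prog T. T \<in> O(\<lambda>n. real n) \<and>
        (\<forall>f P. convex_on UNIV f \<longrightarrow> gbc_instance P \<longrightarrow>
           solves_within prog Integral f P (T (num_acts P))))"
proof (intro conjI exI allI impI)
  fix f P assume "convex_on UNIV (f :: real \<Rightarrow> real)" "gbc_instance P"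
  then interpret allocation Continuous f P 700 continuous_stage "\<lambda>e. e" "\<lambda>e. e" "\<lambda>x. x" "\<lambda>x. x"
    by unfold_locales (simp_all add: continuous_stage_correct domain_set_def)
  show "solves_within ([search], allocate continuous_stage (\<lambda>e. e) (\<lambda>e. e)) Continuous f P
    ((\<lambda>k. real ((5 * 700 + 60) * (k + 1))) (num_acts P))"
    using allocate_solves .
next
  fix f P assume "convex_on UNIV (f :: real \<Rightarrow> real)" "gbc_instance P"
  \<comment> \<open>The rounding needs only the floor primitive: the ceiling is the negated floor of
    the negated argument.\<close>
  then interpret allocation Integral f P 2600 integral_stage "\<lambda>e. ceiling_exp e" "\<lambda>e. floor_exp e"
    "\<lambda>x. of_int \<lceil>x\<rceil>" "\<lambda>x. of_int \<lfloor>x\<rfloor>"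
    by unfold_locales
      (auto simp: integral_stage_correct domain_set_def floor_minus ceiling_le_iff le_floor_iff elim!: Ints_cases)
  show "solves_within ([search], allocate integral_stage (\<lambda>e. ceiling_exp e) (\<lambda>e. floor_exp e)) Integral f P
    ((\<lambda>k. real ((5 * 2600 + 60) * (k + 1))) (num_acts P))"
    using allocate_solves .
qed (rule linear_bound)+

end
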